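(* Let $d\geq1$, let $S=\{i_1<\dots<i_{d'}\}$ be a non-empty subset of $\{1,\dots,d\}$ with $d'=|S|$, and let $\boldsymbol{\tau}=(\tau^1,\dots,\tau^{d'})$ be any choice of $d'$ Markov traces on $\{\widehat{H}_n\}_{n\geq1}$. Then, for any non-framed link $L$ (classical or in the solid torus), $$P_L^{d,S,\boldsymbol{\tau}}=P_L^{d',\{1,\dots,d'\},\boldsymbol{\tau}}\ ,$$ where on the left-hand side $\tau^j$ is placed in position $i_j\in S$, and on the right-hand side in position $j$.
   Context: Let $u,v,\gamma$ be indeterminates, $R=\mathbb{C}[u^{\pm1},v^{\pm1},\gamma^{\pm1}]$; all algebras are over $R$. $s_i=(i,i+1)\in\mathfrak{S}_n$, $\ell$ is the length function. Affine Yokonuma--Hecke algebra: $\widehat{Y}_{d,n}$ is the unital associative algebra generated by $g_1,\dots,g_{n-1},X_1^{\pm1},t_1,\dots,t_n$ with relations: (1) $g_ig_j=g_jg_i$ for $|i-j|>1$; $g_ig_{i+1}g_i=g_{i+1}g_ig_{i+1}$; $X_1g_1X_1g_1=g_1X_1g_1X_1$; $X_1g_i=g_iX_1$ for $i\geq2$; (2) $t_it_j=t_jt_i$; $g_it_j=t_{s_i(j)}g_i$; $t_j^d=1$; $X_1t_j=t_jX_1$; (3) $g_i^2=u^2+v\,e_ig_i$, where $e_i=\frac1d\sum_{s=1}^{d}t_i^st_{i+1}^{-s}$. For $w$ with reduced expression $s_{i_1}\cdots s_{i_r}$, $g_w=g_{i_1}\cdots g_{i_r}$; $X_{i+1}=u^{-2}g_iX_ig_i$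 (the $X_i$ commute with each other and with the $t_j$); $X^{\lambda}=X_1^{\lambda_1}\cdots X_n^{\lambda_n}$. $\widehat{Y}_{d,n}\subset\widehat{Y}_{d,n+1}$ via the generators with the same names. The affine Hecke algebra is $\widehat{H}_n=\widehat{Y}_{1,n}$ ($t_j=1$, $e_i=1$), with generators $\overline{g}_i,\overline{X}_1^{\pm1}$ and elements $\overline{X}_i,\overline{g}_w$ defined likewise; $\widehat{H}_0$ is the ground ring. Markov traces: a Markov trace on $\{\widehat{Y}_{d,n}\}_{n\geq1}$ is a family of linear maps $\rho_{d,n}$ on $\widehat{Y}_{d,n}$ with values in $\mathbb{C}[u^{\pm1},v^{\pm1}]$ (extended $R$-linearly) such that $\rho_{d,n}(xy)=\rho_{d,n}(yx)$ for $x,y\in\widehat{Y}_{d,n}$, and $\rho_{d,n+1}(xg_n)=\rho_{d,n+1}(xg_n^{-1})=\rho_{d,n}(x)$ for $x\in\widehat{Y}_{d,n}$, $n\geq1$. A Markov trace on $\{\widehat{H}_n\}_{n\geq1}$ is the same notion with $d=1$. Isomorphism: a $d$-composition of $n$ is $\mu\in\mathbb{Z}_{\geq0}^d$ with $\sum_a\mu_a=n$. $\mathfrak{S}^{\mu}$ is the Young subgroup permuting the consecutive blocks of sizes $\mu_1,\dots,\mu_d$; $m_{\mu}=\frac{n!}{\mu_1!\cdots\mu_d!}$; $\widehat{H}^{\mu}=\widehat{H}_{\mu_1}\otimes\dots\otimes\widehat{H}_{\mu_d}$, identified with the subalgebra of $\widehat{H}_n$ generated by all $\overline{X}_j^{\pm1}$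 and the $\overline{g}_i$ with $s_i\in\mathfrak{S}^{\mu}$. Let $\xi_1,\dots,\xi_d$ be the $d$-th roots of unity. $\mathcal{T}_{d,n}=\langle t_1,\dots,t_n\rangle$ is the group algebra of $(\mathbb{Z}/d\mathbb{Z})^n$, $\operatorname{Irr}(\mathcal{T}_{d,n})$ its set of characters ($\chi(t_j)\in\{\xi_1,\dots,\xi_d\}$), $E_{\chi}$ the primitive idempotent of $\chi$, $\operatorname{Comp}(\chi)=\mu$ with $\mu_a=\#\{j:\chi(t_j)=\xi_a\}$. $\mathfrak{S}_n$ acts by $w(\chi)(t_i)=\chi(t_{w^{-1}(i)})$. $\chi_0^{\mu}$ takes the value $\xi_1$ on the first $\mu_1$ of the $t_j$, $\xi_2$ on the next $\mu_2$, etc.; $\pi_{\chi}$ is the element of minimal length with $\pi_{\chi}(\chi_0^{\mu})=\chi$, $\mu=\operatorname{Comp}(\chi)$. Matrices in $\operatorname{Mat}_{m_{\mu}}(\widehat{H}^{\mu})$ are indexed by the characters $\chi$ with $\operatorname{Comp}(\chi)=\mu$, with matrix units $\boldsymbol{1}_{\chi,\chi'}$. $\Psi_{d,n}:\widehat{Y}_{d,n}\to\bigoplus_{\mu}\operatorname{Mat}_{m_{\mu}}(\widehat{H}^{\mu})$ is the algebra isomorphism $$E_{\chi}X^{\lambda}g_{w^{-1}}\mapsto u^{\ell(w^{-1})-\ell(\pi_{\chi}^{-1}w^{-1}\pi_{w(\chi)})}\boldsymbol{1}_{\chi,w(\chi)}\Bigl(\prod_j\overline{X}_{\pi_{\chi}^{-1}(j)}^{\lambda_j}\Bigr)\overline{g}_{\pi_{\chi}^{-1}w^{-1}\pi_{w(\chi)}}.$$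 Basic Markov traces: for a non-empty $S\subseteq\{1,\dots,d\}$ and a choice $\boldsymbol{\tau}$ of a Markov trace $\{\tau_n^a\}_{n\geq1}$ on $\{\widehat{H}_n\}_{n\geq1}$ for each position $a\in S$, $\rho_{d,n}^{S,\boldsymbol{\tau}}(x)=\sum_{\mu}\bigl(\bigotimes_{a\in S}\tau^a_{\mu_a}\bigr)\bigl(\operatorname{Tr}(\Psi_{d,n}(x)_{\mu})\bigr)$, the sum being over the $d$-compositions $\mu$ of $n$ such that $\mu_a\neq0$ if and only if $a\in S$, where $\Psi_{d,n}(x)_{\mu}$ is the component in $\operatorname{Mat}_{m_{\mu}}(\widehat{H}^{\mu})$, $\operatorname{Tr}$ is the usual matrix trace with values in $\widehat{H}^{\mu}$, and factors $\widehat{H}_0$ are treated by the identity. These families are Markov traces on $\{\widehat{Y}_{d,n}\}_{n\geq1}$. Braids, links and invariants: the $\mathbb{Z}/d\mathbb{Z}$-framed affine braid group $\mathbb{Z}/d\mathbb{Z}\wr B_n^{\mathrm{aff}}$ is generated by $\sigma_1,\dots,\sigma_{n-1},\sigma_0,t_1,\dots,t_n$ with relations (1)--(2) in which $g_i$ is replaced by $\sigma_i$ and $X_1$ by $\sigma_0$; the affine braid group $B_n^{\mathrm{aff}}$ is its subgroup generated by $\sigma_0,\dots,\sigma_{n-1}$, and the classical braid group the one generated by $\sigma_1,\dots,\sigma_{n-1}$. Links in the solid torus (resp. classical links) are closures of affine (resp. classical) braids, $\sigma_0$ being the braid whose first strand winds once around the core axis; the framed closure of $t_1^{a_1}\cdots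 t_n^{a_n}\beta$ is the closure of $\beta$ with each component carrying as framing the sum mod $d$ of the $a_j$ over its strands. A non-framed link is regarded as a $\mathbb{Z}/d\mathbb{Z}$-framed link with all framings $0$, thus as the closure of an element of $B_n^{\mathrm{aff}}$. Let $\delta_{d,n}:R[\mathbb{Z}/d\mathbb{Z}\wr B_n^{\mathrm{aff}}]\to\widehat{Y}_{d,n}$ be the algebra morphism $t_j\mapsto t_j$, $\sigma_0\mapsto X_1$, $\sigma_i\mapsto(\gamma+(1-\gamma)e_i)g_i$. The basic invariant is $P_L^{d,S,\boldsymbol{\tau}}=\rho_{d,n}^{S,\boldsymbol{\tau}}(\delta_{d,n}(\beta_L))\in R$, where $\beta_L$ is any (framed) braid closing to $L$; it does not depend on the choice of $\beta_L$. *)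

theory Defs
  imports Complex_Main
    "HOL-Library.FuncSet"
    "HOL-Library.Product_Plus"
    "HOL-Library.Poly_Mapping"
    "HOL-Combinatorics.Permutations"
    "HOL-Algebra.QuotRing"
    "HOL-Algebra.Generated_Rings"
begin

section \<open>The ground ring\<close>

text \<open>Laurent polynomials in \<open>u, v, \<gamma>\<close> over the complex numbers, as the group algebra of
  \<open>\<int>\<^sup>3\<close>: the key \<open>(a, b, c)\<close> stands for \<open>u\<^sup>a v\<^sup>b \<gamma>\<^sup>c\<close>.\<close>

type_synonym coeff = "(int \<times> int \<times> int) \<Rightarrow>\<^sub>0 complex"

definition cconst :: "complex \<Rightarrow> coeff" where
  "cconst z = Poly_Mapping.single 0 z"

definition upow :: "int \<Rightarrow> coeff" where
  "upow k = Poly_Mapping.single (k, 0, 0) 1"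

definition vpow :: "int \<Rightarrow> coeff" where
  "vpow k = Poly_Mapping.single (0, k, 0) 1"

definition gampow :: "int \<Rightarrow> coeff" where
  "gampow k = Poly_Mapping.single (0, 0, k) 1"

text \<open>The subring \<open>\<complex>[u\<^sup>\<plusminus>\<^sup>1, v\<^sup>\<plusminus>\<^sup>1]\<close>.\<close>

definition coeff_uv :: "coeff set" where
  "coeff_uv = {p. \<forall>(a, b, c) \<in> Poly_Mapping.keys p. c = 0}"

section \<open>Affine Yokonuma--Hecke algebras\<close>

text \<open>Lists under concatenation are the free monoid, so that \<open>gen list \<Rightarrow>\<^sub>0 coeff\<close>
  is the free associative unital algebra on \<open>gen\<close>.\<close>

instantiation list :: (type) monoid_add
begin
definition zero_list :: "'a list" where "zero_list = []"
definition plus_list :: "'a list \<Rightarrow> 'a list \<Rightarrow> 'a list" where "plus_list xs ys = xs @ ys"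
instance by standard (simp_all add: zero_list_def plus_list_def)
end

text \<open>\<open>Gg i\<close>, \<open>Xp\<close>, \<open>Xm\<close>, \<open>Tt j\<close> are the letters for \<open>g\<^sub>i\<close>, \<open>X\<^sub>1\<close>, the inverse of \<open>X\<^sub>1\<close>,
  and \<open>t\<^sub>j\<close>.\<close>

datatype gen = Gg nat | Xp | Xm | Tt nat

type_synonym falg = "gen list \<Rightarrow>\<^sub>0 coeff"

definition fvar :: "gen \<Rightarrow> falg" where
  "fvar a = Poly_Mapping.single [a] 1"

definition fscal :: "coeff \<Rightarrow> falg" where
  "fscal c = Poly_Mapping.single [] c"

definition gens :: "nat \<Rightarrow> gen set" where
  "gens n = Gg ` {1..<n} \<union> {Xp, Xm} \<union> Tt ` {1..n}"

definition free_alg :: "nat \<Rightarrow> falg ring" where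
  "free_alg n = \<lparr>carrier = {f. Poly_Mapping.keys f \<subseteq> lists (gens n)},
     mult = (*), one = 1, zero = 0, add = (+)\<rparr>"

text \<open>Negative powers of \<open>t\<^sub>i\<^sub>+\<^sub>1\<close> are written via \<open>t\<^sup>-\<^sup>s = t\<^sup>d\<^sup>-\<^sup>s\<close>.\<close>

definition e_elt :: "nat \<Rightarrow> nat \<Rightarrow> falg" where
  "e_elt d i = fscal (cconst (1 / of_nat d)) *
     (\<Sum>s = 1..d. fvar (Tt i) ^ s * fvar (Tt (i + 1)) ^ (d - s))"

text \<open>An element \<open>l - r\<close> of this set stands for the defining relation \<open>l = r\<close>.\<close>

inductive_set yrels :: "nat \<Rightarrow> nat \<Rightarrow> falg set" for d n :: nat where
  X_inv_r: "fvar Xp * fvar Xm - 1 \<in> yrels d n"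
| X_inv_l: "fvar Xm * fvar Xp - 1 \<in> yrels d n"
| g_comm: "\<lbrakk>i \<in> {1..<n}; j \<in> {1..<n}; i + 1 < j \<or> j + 1 < i\<rbrakk> \<Longrightarrow>
    fvar (Gg i) * fvar (Gg j) - fvar (Gg j) * fvar (Gg i) \<in> yrels d n"
| g_braid: "\<lbrakk>i \<in> {1..<n}; i + 1 \<in> {1..<n}\<rbrakk> \<Longrightarrow>
    fvar (Gg i) * fvar (Gg (i + 1)) * fvar (Gg i)
      - fvar (Gg (i + 1)) * fvar (Gg i) * fvar (Gg (i + 1)) \<in> yrels d n"
| Xg_braid: "1 \<in> {1..<n} \<Longrightarrow>
    fvar Xp * fvar (Gg 1) * fvar Xp * fvar (Gg 1)
      - fvar (Gg 1) * fvar Xp * fvar (Gg 1) * fvar Xp \<in> yrels d n"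
| Xg_comm: "\<lbrakk>i \<in> {1..<n}; 2 \<le> i\<rbrakk> \<Longrightarrow>
    fvar Xp * fvar (Gg i) - fvar (Gg i) * fvar Xp \<in> yrels d n"
| t_comm: "\<lbrakk>i \<in> {1..n}; j \<in> {1..n}\<rbrakk> \<Longrightarrow>
    fvar (Tt i) * fvar (Tt j) - fvar (Tt j) * fvar (Tt i) \<in> yrels d n"
| gt_comm: "\<lbrakk>i \<in> {1..<n}; j \<in> {1..n}\<rbrakk> \<Longrightarrow>
    fvar (Gg i) * fvar (Tt j) - fvar (Tt (transpose i (i + 1) j)) * fvar (Gg i) \<in> yrels d n"
| t_pow: "j \<in> {1..n} \<Longrightarrow> fvar (Tt j) ^ d - 1 \<in> yrels d n"
| Xt_comm: "j \<in> {1..n} \<Longrightarrow> fvar Xp * fvar (Tt j) - fvar (Tt j) * fvar Xp \<in> yrels d n"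
| g_quad: "i \<in> {1..<n} \<Longrightarrow>
    fvar (Gg i) ^ 2 - (fscal (upow 2) + fscal (vpow 1) * e_elt d i * fvar (Gg i)) \<in> yrels d n"

definition yideal :: "nat \<Rightarrow> nat \<Rightarrow> falg set" where
  "yideal d n = genideal (free_alg n) (yrels d n)"

text \<open>\<open>Y 1 n\<close> is the affine Hecke algebra.\<close>

definition Y :: "nat \<Rightarrow> nat \<Rightarrow> falg set ring" where
  "Y d n = free_alg n Quot yideal d n"

definition cls :: "nat \<Rightarrow> nat \<Rightarrow> falg \<Rightarrow> falg set" where
  "cls d n f = yideal d n +>\<^bsub>free_alg n\<^esub> f"

definition scal :: "nat \<Rightarrow> nat \<Rightarrow> coeff \<Rightarrow> falg set" where
  "scal d n c = cls d n (fscal c)"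

definition lprod :: "('a, 'b) monoid_scheme \<Rightarrow> 'a list \<Rightarrow> 'a" where
  "lprod M xs = foldr (\<lambda>x y. x \<otimes>\<^bsub>M\<^esub> y) xs \<one>\<^bsub>M\<^esub>"

definition gY :: "nat \<Rightarrow> nat \<Rightarrow> nat \<Rightarrow> falg set" where
  "gY d n i = cls d n (fvar (Gg i))"

text \<open>\<open>X_elt j\<close> represents \<open>X\<^sub>j\<close> for \<open>j \<ge> 1\<close>; the value at \<open>0\<close> is irrelevant.\<close>

fun X_elt :: "nat \<Rightarrow> falg" where
  "X_elt 0 = 1"
| "X_elt (Suc 0) = fvar Xp"
| "X_elt (Suc (Suc k)) =
     fscal (upow (-2)) * fvar (Gg (Suc k)) * X_elt (Suc k) * fvar (Gg (Suc k))"

definition XY :: "nat \<Rightarrow> nat \<Rightarrow> nat \<Rightarrow> falg set" where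
  "XY d n j = cls d n (X_elt j)"

definition X_monom :: "nat \<Rightarrow> nat \<Rightarrow> (nat \<Rightarrow> int) \<Rightarrow> falg set" where
  "X_monom d n l = lprod (Y d n) (map (\<lambda>j. XY d n j [^]\<^bsub>Y d n\<^esub> l j) [1..<n + 1])"

text \<open>Elements of the symmetric group on \<open>{1..n}\<close> are functions \<open>w\<close> with \<open>w permutes {1..n}\<close>.\<close>

definition perm_of :: "nat list \<Rightarrow> nat \<Rightarrow> nat" where
  "perm_of is = foldr (\<lambda>i w. transpose i (i + 1) \<circ> w) is id"

definition len :: "nat \<Rightarrow> (nat \<Rightarrow> nat) \<Rightarrow> nat" where
  "len n w = (LEAST r. \<exists>is. set is \<subseteq> {1..<n} \<and> perm_of is = w \<and> length is = r)"

definition reduced_word :: "nat \<Rightarrow> (nat \<Rightarrow> nat) \<Rightarrow> nat list \<Rightarrow> bool" where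
  "reduced_word n w is \<longleftrightarrow> set is \<subseteq> {1..<n} \<and> perm_of is = w \<and> length is = len n w"

definition gw :: "nat \<Rightarrow> nat \<Rightarrow> (nat \<Rightarrow> nat) \<Rightarrow> falg set" where
  "gw d n w = lprod (Y d n) (map (gY d n) (SOME is. reduced_word n w is))"

section \<open>Markov traces\<close>

text \<open>A family of linear maps with values in \<open>\<complex>[u\<^sup>\<plusminus>\<^sup>1, v\<^sup>\<plusminus>\<^sup>1]\<close>, extended linearly to \<open>\<gamma>\<close>, is a
  family of linear maps over the ground ring that takes values in \<open>\<complex>[u\<^sup>\<plusminus>\<^sup>1, v\<^sup>\<plusminus>\<^sup>1]\<close> on the words in
  the generators. The inclusion of \<open>Y d n\<close> in \<open>Y d (n + 1)\<close> sends the class of \<open>f\<close> to the class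
  of \<open>f\<close>.\<close>

definition markov_trace :: "nat \<Rightarrow> (nat \<Rightarrow> falg set \<Rightarrow> coeff) \<Rightarrow> bool" where
  "markov_trace d r \<longleftrightarrow>
     (\<forall>n \<ge> 1. \<forall>x \<in> carrier (Y d n). \<forall>y \<in> carrier (Y d n).
        r n (x \<oplus>\<^bsub>Y d n\<^esub> y) = r n x + r n y) \<and>
     (\<forall>n \<ge> 1. \<forall>c. \<forall>x \<in> carrier (Y d n). r n (scal d n c \<otimes>\<^bsub>Y d n\<^esub> x) = c * r n x) \<and>
     (\<forall>n \<ge> 1. \<forall>w \<in> lists (gens n). r n (cls d n (Poly_Mapping.single w 1)) \<in> coeff_uv) \<and>
     (\<forall>n \<ge> 1. \<forall>x \<in> carrier (Y d n). \<forall>y \<in> carrier (Y d n).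
        r n (x \<otimes>\<^bsub>Y d n\<^esub> y) = r n (y \<otimes>\<^bsub>Y d n\<^esub> x)) \<and>
     (\<forall>n \<ge> 1. \<forall>f \<in> carrier (free_alg n).
        r (n + 1) (cls d (n + 1) f \<otimes>\<^bsub>Y d (n + 1)\<^esub> gY d (n + 1) n) = r n (cls d n f) \<and>
        r (n + 1) (cls d (n + 1) f \<otimes>\<^bsub>Y d (n + 1)\<^esub> inv\<^bsub>Y d (n + 1)\<^esub> (gY d (n + 1) n))
          = r n (cls d n f))"

section \<open>The isomorphism with matrix algebras\<close>

text \<open>A \<open>d\<close>-composition is a function on \<open>nat\<close> that vanishes outside \<open>{1..d}\<close>.\<close>

definition compositions :: "nat \<Rightarrow> nat \<Rightarrow> (nat \<Rightarrow> nat) set" where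
  "compositions d n = {\<mu>. (\<forall>a. a \<notin> {1..d} \<longrightarrow> \<mu> a = 0) \<and> (\<Sum>a = 1..d. \<mu> a) = n}"

text \<open>\<open>block \<mu> j\<close> is the index of the block of \<open>\<mu>\<close> that contains the position \<open>j\<close>.\<close>

definition block :: "(nat \<Rightarrow> nat) \<Rightarrow> nat \<Rightarrow> nat" where
  "block \<mu> j = (LEAST a. j \<le> (\<Sum>b = 1..a. \<mu> b))"

definition young_subgroup :: "nat \<Rightarrow> (nat \<Rightarrow> nat) \<Rightarrow> (nat \<Rightarrow> nat) set" where
  "young_subgroup n \<mu> = {w. w permutes {1..n} \<and> (\<forall>j \<in> {1..n}. block \<mu> (w j) = block \<mu> j)}"

text \<open>The tensor product of the affine Hecke algebras on \<open>\<mu>\<^sub>1, \<dots>, \<mu>\<^sub>d\<close> strands, as a subalgebra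
  of the one on \<open>n\<close> strands.\<close>

definition Hmu :: "nat \<Rightarrow> (nat \<Rightarrow> nat) \<Rightarrow> falg set set" where
  "Hmu n \<mu> = generate_ring (Y 1 n)
     (range (scal 1 n) \<union> XY 1 n ` {1..n} \<union> (\<lambda>j. inv\<^bsub>Y 1 n\<^esub> (XY 1 n j)) ` {1..n} \<union>
      gY 1 n ` {i \<in> {1..<n}. transpose i (i + 1) \<in> young_subgroup n \<mu>})"

text \<open>A character of the group algebra of \<open>(\<int>/d\<int>)\<^sup>n\<close> is given by its values on
  \<open>t\<^sub>1, \<dots>, t\<^sub>n\<close>. An enumeration of the \<open>d\<close>-th roots of unity is a function \<open>\<xi>\<close> on \<open>{1..d}\<close>.\<close>

definition roots_enum :: "nat \<Rightarrow> (nat \<Rightarrow> complex) \<Rightarrow> bool" where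
  "roots_enum d \<xi> \<longleftrightarrow> bij_betw \<xi> {1..d} {z. z ^ d = 1}"

type_synonym chr = "nat \<Rightarrow> complex"

definition Irr :: "nat \<Rightarrow> nat \<Rightarrow> chr set" where
  "Irr d n = {1..n} \<rightarrow>\<^sub>E {z. z ^ d = 1}"

definition Comp :: "(nat \<Rightarrow> complex) \<Rightarrow> nat \<Rightarrow> nat \<Rightarrow> chr \<Rightarrow> nat \<Rightarrow> nat" where
  "Comp \<xi> d n \<chi> = (\<lambda>a. if a \<in> {1..d} then card {j \<in> {1..n}. \<chi> j = \<xi> a} else 0)"

text \<open>The primitive idempotent of \<open>\<chi>\<close>, as the product over \<open>j\<close> of the idempotents of the cyclic
  groups generated by the \<open>t\<^sub>j\<close>.\<close>

definition E_elt :: "nat \<Rightarrow> nat \<Rightarrow> chr \<Rightarrow> falg" where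
  "E_elt d n \<chi> = prod_list (map (\<lambda>j. fscal (cconst (1 / of_nat d)) *
     (\<Sum>s<d. fscal (cconst (inverse (\<chi> j) ^ s)) * fvar (Tt j) ^ s)) [1..<n + 1])"

definition act :: "(nat \<Rightarrow> nat) \<Rightarrow> chr \<Rightarrow> chr" where
  "act w \<chi> = (\<lambda>i. \<chi> (Hilbert_Choice.inv w i))"

definition chi0 :: "(nat \<Rightarrow> complex) \<Rightarrow> nat \<Rightarrow> (nat \<Rightarrow> nat) \<Rightarrow> chr" where
  "chi0 \<xi> n \<mu> = restrict (\<lambda>j. \<xi> (block \<mu> j)) {1..n}"

definition pi_chi :: "(nat \<Rightarrow> complex) \<Rightarrow> nat \<Rightarrow> nat \<Rightarrow> chr \<Rightarrow> nat \<Rightarrow> nat" where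
  "pi_chi \<xi> d n \<chi> =
     (ARG_MIN (len n) w. w permutes {1..n} \<and> act w (chi0 \<xi> n (Comp \<xi> d n \<chi>)) = \<chi>)"

text \<open>The direct sum over all \<open>\<mu>\<close> of the matrix algebras over \<open>Hmu n \<mu>\<close> indexed by the characters
  \<open>\<chi>\<close> with \<open>Comp \<chi> = \<mu>\<close>, as block diagonal matrices indexed by all characters.\<close>

definition mat_alg :: "(nat \<Rightarrow> complex) \<Rightarrow> nat \<Rightarrow> nat \<Rightarrow> (chr \<Rightarrow> chr \<Rightarrow> falg set) ring" where
  "mat_alg \<xi> d n =
     \<lparr>carrier = {M. \<forall>\<chi> \<chi>'.
          (if \<chi> \<in> Irr d n \<and> \<chi>' \<in> Irr d n \<and> Comp \<xi> d n \<chi> = Comp \<xi> d n \<chi>'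
           then M \<chi> \<chi>' \<in> Hmu n (Comp \<xi> d n \<chi>) else M \<chi> \<chi>' = \<zero>\<^bsub>Y 1 n\<^esub>)},
      mult = (\<lambda>M N \<chi> \<chi>'. \<Oplus>\<^bsub>Y 1 n\<^esub>\<kappa>\<in>Irr d n. M \<chi> \<kappa> \<otimes>\<^bsub>Y 1 n\<^esub> N \<kappa> \<chi>'),
      one = (\<lambda>\<chi> \<chi>'. if \<chi> = \<chi>' \<and> \<chi> \<in> Irr d n then \<one>\<^bsub>Y 1 n\<^esub> else \<zero>\<^bsub>Y 1 n\<^esub>),
      zero = (\<lambda>\<chi> \<chi>'. \<zero>\<^bsub>Y 1 n\<^esub>),
      add = (\<lambda>M N \<chi> \<chi>'. M \<chi> \<chi>' \<oplus>\<^bsub>Y 1 n\<^esub> N \<chi> \<chi>')\<rparr>"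

definition mat_unit :: "nat \<Rightarrow> chr \<Rightarrow> chr \<Rightarrow> falg set \<Rightarrow> chr \<Rightarrow> chr \<Rightarrow> falg set" where
  "mat_unit n \<chi> \<chi>' h = (\<lambda>\<kappa> \<kappa>'. if \<kappa> = \<chi> \<and> \<kappa>' = \<chi>' then h else \<zero>\<^bsub>Y 1 n\<^esub>)"

text \<open>The elements \<open>E\<^sub>\<chi> X\<^sup>\<lambda> g\<^sub>w\<close> span \<open>Y d n\<close>, so there is at most one such linear map on the
  carrier of \<open>Y d n\<close>; that it exists, and is bijective, is the isomorphism theorem.\<close>

definition is_Psi ::
  "(nat \<Rightarrow> complex) \<Rightarrow> nat \<Rightarrow> nat \<Rightarrow> (falg set \<Rightarrow> chr \<Rightarrow> chr \<Rightarrow> falg set) \<Rightarrow> bool" where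
  "is_Psi \<xi> d n \<Psi> \<longleftrightarrow>
     \<Psi> \<in> ring_hom (Y d n) (mat_alg \<xi> d n) \<and>
     (\<forall>c. \<forall>x \<in> carrier (Y d n).
        \<Psi> (scal d n c \<otimes>\<^bsub>Y d n\<^esub> x) = (\<lambda>\<chi> \<chi>'. scal 1 n c \<otimes>\<^bsub>Y 1 n\<^esub> \<Psi> x \<chi> \<chi>')) \<and>
     (\<forall>\<chi> \<in> Irr d n. \<forall>l :: nat \<Rightarrow> int. \<forall>w. w permutes {1..n} \<longrightarrow>
        (let w' = Hilbert_Choice.inv w;
             p = Hilbert_Choice.inv (pi_chi \<xi> d n \<chi>);
             y = p \<circ> w' \<circ> pi_chi \<xi> d n (act w \<chi>)
         in \<Psi> (cls d n (E_elt d n \<chi>) \<otimes>\<^bsub>Y d n\<^esub> X_monom d n l \<otimes>\<^bsub>Y d n\<^esub> gw d n w') =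
            mat_unit n \<chi> (act w \<chi>)
              (scal 1 n (upow (int (len n w') - int (len n y))) \<otimes>\<^bsub>Y 1 n\<^esub>
               lprod (Y 1 n) (map (\<lambda>j. XY 1 n (p j) [^]\<^bsub>Y 1 n\<^esub> l j) [1..<n + 1]) \<otimes>\<^bsub>Y 1 n\<^esub>
               gw 1 n y)))"

definition Psi :: "(nat \<Rightarrow> complex) \<Rightarrow> nat \<Rightarrow> nat \<Rightarrow> falg set \<Rightarrow> chr \<Rightarrow> chr \<Rightarrow> falg set" where
  "Psi \<xi> d n = (SOME \<Psi>. is_Psi \<xi> d n \<Psi>)"

section \<open>Basic Markov traces\<close>

text \<open>The embedding of the affine Hecke algebra on \<open>m\<close> strands into the one on \<open>n\<close> strands on the
  consecutive positions \<open>k + 1, \<dots>, k + m\<close>, given on representatives in the free algebra.\<close>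

definition block_letter :: "nat \<Rightarrow> nat \<Rightarrow> gen \<Rightarrow> falg set" where
  "block_letter n k a = (case a of
      Gg i \<Rightarrow> gY 1 n (k + i)
    | Xp \<Rightarrow> XY 1 n (k + 1)
    | Xm \<Rightarrow> inv\<^bsub>Y 1 n\<^esub> (XY 1 n (k + 1))
    | Tt j \<Rightarrow> \<one>\<^bsub>Y 1 n\<^esub>)"

definition block_emb :: "nat \<Rightarrow> nat \<Rightarrow> falg \<Rightarrow> falg set" where
  "block_emb n k f = (\<Oplus>\<^bsub>Y 1 n\<^esub>w\<in>Poly_Mapping.keys f.
     scal 1 n (Poly_Mapping.lookup f w) \<otimes>\<^bsub>Y 1 n\<^esub> lprod (Y 1 n) (map (block_letter n k) w))"

text \<open>The tensor product over \<open>a \<in> S\<close> of the \<open>\<tau>\<^sup>a\<close>, for \<open>\<mu>\<close> with support \<open>S\<close>, as a linear form on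
  \<open>Hmu n \<mu>\<close>; the remaining tensor factors are the ground ring.\<close>

definition is_tensor_trace ::
  "nat \<Rightarrow> nat set \<Rightarrow> (nat \<Rightarrow> nat \<Rightarrow> falg set \<Rightarrow> coeff) \<Rightarrow> (nat \<Rightarrow> nat) \<Rightarrow>
   (falg set \<Rightarrow> coeff) \<Rightarrow> bool" where
  "is_tensor_trace n S \<tau> \<mu> T \<longleftrightarrow>
     (\<forall>x \<in> Hmu n \<mu>. \<forall>y \<in> Hmu n \<mu>. T (x \<oplus>\<^bsub>Y 1 n\<^esub> y) = T x + T y) \<and>
     (\<forall>c. \<forall>x \<in> Hmu n \<mu>. T (scal 1 n c \<otimes>\<^bsub>Y 1 n\<^esub> x) = c * T x) \<and>
     (\<forall>f. (\<forall>a \<in> S. f a \<in> carrier (free_alg (\<mu> a))) \<longrightarrow>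
        T (lprod (Y 1 n) (map (\<lambda>a. block_emb n (\<Sum>b = 1..<a. \<mu> b) (f a)) (sorted_list_of_set S)))
          = (\<Prod>a\<in>S. \<tau> a (\<mu> a) (cls 1 (\<mu> a) (f a))))"

definition tensor_trace ::
  "nat \<Rightarrow> nat set \<Rightarrow> (nat \<Rightarrow> nat \<Rightarrow> falg set \<Rightarrow> coeff) \<Rightarrow> (nat \<Rightarrow> nat) \<Rightarrow> falg set \<Rightarrow> coeff" where
  "tensor_trace n S \<tau> \<mu> = (SOME T. is_tensor_trace n S \<tau> \<mu> T)"

definition rho :: "(nat \<Rightarrow> complex) \<Rightarrow> nat \<Rightarrow> nat set \<Rightarrow> (nat \<Rightarrow> nat \<Rightarrow> falg set \<Rightarrow> coeff) \<Rightarrow>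
    nat \<Rightarrow> falg set \<Rightarrow> coeff" where
  "rho \<xi> d S \<tau> n x =
     (\<Sum>\<mu> \<in> {\<mu> \<in> compositions d n. \<forall>a \<in> {1..d}. \<mu> a \<noteq> 0 \<longleftrightarrow> a \<in> S}.
        tensor_trace n S \<tau> \<mu>
          (\<Oplus>\<^bsub>Y 1 n\<^esub>\<chi>\<in>{\<chi> \<in> Irr d n. Comp \<xi> d n \<chi> = \<mu>}. Psi \<xi> d n x \<chi> \<chi>))"

section \<open>Braids and links\<close>

text \<open>A letter \<open>(i, True)\<close> is \<open>\<sigma>\<^sub>i\<close> and \<open>(i, False)\<close> is its inverse. With \<open>k = 0\<close> the letters
  \<open>\<sigma>\<^sub>k, \<dots>, \<sigma>\<^sub>n\<^sub>-\<^sub>1\<close> generate the affine braid group on \<open>n\<close> strands, with \<open>k = 1\<close> the classical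
  one.\<close>

type_synonym bword = "(nat \<times> bool) list"

definition bwords :: "nat \<Rightarrow> nat \<Rightarrow> bword set" where
  "bwords k n = lists ({k..<n} \<times> UNIV)"

definition binv :: "bword \<Rightarrow> bword" where
  "binv w = rev (map (\<lambda>(i, b). (i, \<not> b)) w)"

text \<open>Equality in the (affine or classical) braid group.\<close>

inductive braid_eq :: "nat \<Rightarrow> nat \<Rightarrow> bword \<Rightarrow> bword \<Rightarrow> bool" for k n :: nat where
  refl: "w \<in> bwords k n \<Longrightarrow> braid_eq k n w w"
| sym: "braid_eq k n w w' \<Longrightarrow> braid_eq k n w' w"
| trans: "\<lbrakk>braid_eq k n w w'; braid_eq k n w' w''\<rbrakk> \<Longrightarrow> braid_eq k n w w''"
| cong: "\<lbrakk>braid_eq k n w w'; x \<in> bwords k n; y \<in> bwords k n\<rbrakk> \<Longrightarrow>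
    braid_eq k n (x @ w @ y) (x @ w' @ y)"
| cancel: "i \<in> {k..<n} \<Longrightarrow> braid_eq k n [(i, b), (i, \<not> b)] []"
| comm: "\<lbrakk>i \<in> {k..<n}; j \<in> {k..<n}; i + 1 < j\<rbrakk> \<Longrightarrow>
    braid_eq k n [(i, True), (j, True)] [(j, True), (i, True)]"
| braid3: "\<lbrakk>1 \<le> i; i \<in> {k..<n}; i + 1 \<in> {k..<n}\<rbrakk> \<Longrightarrow>
    braid_eq k n [(i, True), (i + 1, True), (i, True)] [(i + 1, True), (i, True), (i + 1, True)]"
| braid4: "\<lbrakk>0 \<in> {k..<n}; 1 \<in> {k..<n}\<rbrakk> \<Longrightarrow>
    braid_eq k n [(0, True), (1, True), (0, True), (1, True)]
                 [(1, True), (0, True), (1, True), (0, True)]"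

definition braids :: "nat \<Rightarrow> (nat \<times> bword) set" where
  "braids k = {(n, w). 1 \<le> n \<and> w \<in> bwords k n}"

text \<open>By Markov's theorem (for \<open>k = 0\<close>, its version for the solid torus), this is the relation of
  having isotopic closures.\<close>

inductive same_closure :: "nat \<Rightarrow> nat \<times> bword \<Rightarrow> nat \<times> bword \<Rightarrow> bool" for k :: nat where
  braid: "\<lbrakk>1 \<le> n; braid_eq k n w w'\<rbrakk> \<Longrightarrow> same_closure k (n, w) (n, w')"
| conj: "\<lbrakk>1 \<le> n; w \<in> bwords k n; x \<in> bwords k n\<rbrakk> \<Longrightarrow>
    same_closure k (n, w) (n, x @ w @ binv x)"
| stab: "\<lbrakk>1 \<le> n; w \<in> bwords k n\<rbrakk> \<Longrightarrow> same_closure k (n, w) (n + 1, w @ [(n, b)])"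
| sym: "same_closure k \<beta> \<beta>' \<Longrightarrow> same_closure k \<beta>' \<beta>"
| trans: "\<lbrakk>same_closure k \<beta> \<beta>'; same_closure k \<beta>' \<beta>''\<rbrakk> \<Longrightarrow> same_closure k \<beta> \<beta>''"

text \<open>A link, up to isotopy, is given by the set of all braids closing to it.\<close>

definition links :: "nat \<Rightarrow> (nat \<times> bword) set set" where
  "links k = braids k // {(\<beta>, \<beta>'). same_closure k \<beta> \<beta>'}"

definition solid_torus_links :: "(nat \<times> bword) set set" where
  "solid_torus_links = links 0"

definition classical_links :: "(nat \<times> bword) set set" where
  "classical_links = links 1"

section \<open>Link invariants\<close>

definition delta_gen :: "nat \<Rightarrow> nat \<Rightarrow> nat \<Rightarrow> falg set" where
  "delta_gen d n i = (if i = 0 then cls d n (fvar Xp)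
     else cls d n ((fscal (gampow 1) + fscal (1 - gampow 1) * e_elt d i) * fvar (Gg i)))"

text \<open>The restriction of \<open>\<delta>\<close> to the affine braid group, evaluated on braid words.\<close>

definition delta :: "nat \<Rightarrow> nat \<Rightarrow> bword \<Rightarrow> falg set" where
  "delta d n w = lprod (Y d n)
     (map (\<lambda>(i, b). if b then delta_gen d n i else inv\<^bsub>Y d n\<^esub> (delta_gen d n i)) w)"

text \<open>The value of \<open>\<rho>(\<delta>(\<beta>))\<close> common to all braids \<open>\<beta>\<close> closing to \<open>L\<close>.\<close>

definition link_inv :: "(nat \<Rightarrow> complex) \<Rightarrow> nat \<Rightarrow> nat set \<Rightarrow>
    (nat \<Rightarrow> nat \<Rightarrow> falg set \<Rightarrow> coeff) \<Rightarrow> (nat \<times> bword) set \<Rightarrow> coeff" where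
  "link_inv \<xi> d S \<tau> L = (THE p. \<forall>(n, w) \<in> L. rho \<xi> d S \<tau> n (delta d n w) = p)"

end

theory Submission
  imports Defs
begin

text \<open>The equality holds braid by braid: for every braid word \<open>w\<close> on \<open>n\<close> strands the two values of
  \<open>\<rho>(\<delta>(w))\<close> coincide (\<open>rho_delta_recolour\<close>). The reason is that the matrix of a braid under
  \<open>\<Psi>\<close> does not see the colours themselves, only which strands have equal colours and in which
  order the colours come. Indeed \<open>e\<^sub>i\<close> acts on the row of a character \<open>\<chi>\<close> as \<open>1\<close> or \<open>0\<close>, according to
  whether \<open>\<chi>(t\<^sub>i) = \<chi>(t\<^sub>i\<^sub>+\<^sub>1)\<close> or not. So the row of \<open>\<chi>\<close> in the matrix of \<open>\<delta>(\<sigma>\<^sub>i)\<close> has the single entry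
  \<open>g\<^sub>a\<close>, on the diagonal, with \<open>a = \<pi>\<^sub>\<chi>\<^sup>-\<^sup>1(i)\<close>, in the case of equal colours, and the single entry \<open>\<gamma> u\<close>,
  in the column of \<open>s\<^sub>i(\<chi>)\<close>, in the case of different colours (\<open>row_delta_gen\<close>). The row of
  \<open>\<chi>\<close> for \<open>\<sigma>\<^sub>0\<close> has the diagonal entry \<open>X\<^sub>a\<close> with \<open>a = \<pi>\<^sub>\<chi>\<^sup>-\<^sup>1(1)\<close>. Replacing the colours \<open>1, \<dots>, d'\<close> by
  \<open>i\<^sub>1 < \<dots> < i\<^sub>d\<^sub>'\<close> keeps equality and order of colours, hence it keeps \<open>\<pi>\<^sub>\<chi>\<close> and all entries
  (\<open>Psi_delta_lift\<close>). It maps the \<open>d'\<close>-compositions without zero parts onto the \<open>d\<close>-compositions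
  with support \<open>S\<close>, with the same blocks of positions, so that the conditions that characterize the two
  tensor products of traces are the same (\<open>is_tensor_trace_up\<close>).

  For this to be an argument about \<open>\<Psi>\<close>, a homomorphism with the prescribed values on the elements
  \<open>E\<^sub>\<chi> X\<^sup>\<lambda> g\<^sub>w\<close> has to exist, and these values have to determine it on the generators. Existence
  (\<open>is_Psi_Psi0\<close>): the letters of the presentation are sent to matrices with one entry in each row;
  the defining relations then reduce to relations in the affine Hecke algebra by distinguishing which of
  the colours involved are equal (\<open>yideal_subset_ker\<close>). The value on \<open>E\<^sub>\<chi> X\<^sup>\<lambda> g\<^sub>w\<close> is found by following
  a reduced word of \<open>w\<close>: the letters that exchange equal colours form a reduced word of
  \<open>\<pi>\<^sub>\<chi>\<^sup>-\<^sup>1 w \<pi>\<^sub>w\<^sub>(\<^sub>\<chi>\<^sub>)\<close> (\<open>cls_wval_reduced_word\<close>), and products over reduced words do not depend on the word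
  by Matsumoto's theorem (\<open>reduced_words_equal_products\<close>). Uniqueness follows from
  \<open>\<Sum>\<^sub>\<chi> E\<^sub>\<chi> = 1\<close> and \<open>t\<^sub>j = \<Sum>\<^sub>\<chi> \<chi>(t\<^sub>j) E\<^sub>\<chi>\<close>.\<close>

section \<open>Presentations by the free algebra\<close>

lemma falg_sum_singles:
  fixes f :: "'a \<Rightarrow>\<^sub>0 'b::comm_monoid_add"
  shows "f = (\<Sum>w\<in>Poly_Mapping.keys f. Poly_Mapping.single w (Poly_Mapping.lookup f w))"
  by (rule poly_mapping_eqI)
    (auto simp: lookup_sum lookup_single when_def sum.delta' in_keys_iff)

text \<open>Scalars are central because the coefficients commute with each other and the empty word commutes
  with every word.\<close>

lemma fscal_commute: "fscal c * f = f * fscal c"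
proof -
  have "fscal c * Poly_Mapping.single w b = Poly_Mapping.single w b * fscal c" for w b
    by (simp add: fscal_def mult_single plus_list_def mult.commute)
  then show ?thesis
    by (subst (1 2) falg_sum_singles[of f]) (simp add: sum_distrib_left sum_distrib_right)
qed

lemma fscal_simps [simp]: "fscal 0 = 0" "fscal 1 = 1"
  by (simp_all add: fscal_def one_poly_mapping.abs_eq single.abs_eq zero_list_def when_def)
    (metis single_one zero_list_def)

lemma fscal_add: "fscal (a + b) = fscal a + fscal b"
  and fscal_mult: "fscal (a * b) = fscal a * fscal b"
  and fscal_diff: "fscal (a - b) = fscal a - fscal b"
  and fscal_uminus: "fscal (- a) = - fscal a"
  by (simp_all add: fscal_def single_add mult_single plus_list_def single_diff single_uminus)

lemma cconst_simps [simp]: "cconst 0 = 0" "cconst 1 = 1"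
  by (simp_all add: cconst_def)

lemma cconst_add: "cconst (a + b) = cconst a + cconst b"
  and cconst_mult: "cconst (a * b) = cconst a * cconst b"
  by (simp_all add: cconst_def single_add mult_single)

lemma upow_add: "upow (a + b) = upow a * upow b"
  by (simp add: upow_def mult_single)

lemma upow_0 [simp]: "upow 0 = 1"
  by (simp add: upow_def flip: single_one zero_prod_def)

lemma gampow_add: "gampow (a + b) = gampow a * gampow b"
  by (simp add: gampow_def mult_single)

lemma gampow_0 [simp]: "gampow 0 = 1"
  by (simp add: gampow_def flip: single_one zero_prod_def)

lemma word_Nil: "(Poly_Mapping.single [] 1 :: falg) = 1"
  by (metis fscal_def fscal_simps(2))

lemma word_Cons: "(Poly_Mapping.single (a # w) 1 :: falg) = fvar a * Poly_Mapping.single w 1"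
  by (simp add: fvar_def mult_single plus_list_def)

lemma free_alg_sel [simp]:
  "mult (free_alg n) = (*)" "one (free_alg n) = 1" "zero (free_alg n) = 0" "add (free_alg n) = (+)"
  by (simp_all add: free_alg_def)

lemma free_alg_carrier_iff: "f \<in> carrier (free_alg n) \<longleftrightarrow> Poly_Mapping.keys f \<subseteq> lists (gens n)"
  by (simp add: free_alg_def)

lemma fcar_basic [simp]:
  "0 \<in> carrier (free_alg n)" "1 \<in> carrier (free_alg n)" "fscal c \<in> carrier (free_alg n)"
  by (auto simp: free_alg_carrier_iff fscal_def zero_list_def)

lemma fcar_fvar [simp]: "a \<in> gens n \<Longrightarrow> fvar a \<in> carrier (free_alg n)"
  by (auto simp: free_alg_carrier_iff fvar_def)

lemma fcar_word [simp]:
  "w \<in> lists (gens n) \<Longrightarrow> Poly_Mapping.single w c \<in> carrier (free_alg n)"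
  by (auto simp: free_alg_carrier_iff)

lemma fcar_add [simp]:
  "\<lbrakk>f \<in> carrier (free_alg n); g \<in> carrier (free_alg n)\<rbrakk> \<Longrightarrow> f + g \<in> carrier (free_alg n)"
  using keys_add[of f g] by (auto simp: free_alg_carrier_iff)

lemma fcar_diff [simp]:
  "\<lbrakk>f \<in> carrier (free_alg n); g \<in> carrier (free_alg n)\<rbrakk> \<Longrightarrow> f - g \<in> carrier (free_alg n)"
  unfolding free_alg_carrier_iff subset_iff in_keys_iff lookup_minus
  by (metis diff_self)

lemma fcar_mult [simp]:
  "\<lbrakk>f \<in> carrier (free_alg n); g \<in> carrier (free_alg n)\<rbrakk> \<Longrightarrow> f * g \<in> carrier (free_alg n)"
  using keys_mult[of f g] by (fastforce simp: free_alg_carrier_iff plus_list_def)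

lemma fcar_uminus [simp]: "f \<in> carrier (free_alg n) \<Longrightarrow> - f \<in> carrier (free_alg n)"
  using fcar_diff[of 0 n f] by simp

lemma fcar_power [simp]: "f \<in> carrier (free_alg n) \<Longrightarrow> f ^ k \<in> carrier (free_alg n)"
  by (induct k) auto

lemma fcar_of_nat [simp]: "of_nat k \<in> carrier (free_alg n)"
  by (induct k) auto

lemma fcar_sum [simp]:
  "(\<And>x. x \<in> A \<Longrightarrow> f x \<in> carrier (free_alg n)) \<Longrightarrow> sum f A \<in> carrier (free_alg n)"
  by (induct A rule: infinite_finite_induct) auto

lemma fcar_prod_list [simp]:
  "(\<And>x. x \<in> set xs \<Longrightarrow> x \<in> carrier (free_alg n)) \<Longrightarrow> prod_list xs \<in> carrier (free_alg n)"
  by (induct xs) auto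

lemma gens_iff [simp]:
  "Gg i \<in> gens n \<longleftrightarrow> 1 \<le> i \<and> i < n" "Xp \<in> gens n" "Xm \<in> gens n"
  "Tt j \<in> gens n \<longleftrightarrow> 1 \<le> j \<and> j \<le> n"
  by (auto simp: gens_def)

lemma fcar_e_elt [simp]: "\<lbrakk>1 \<le> i; i < n\<rbrakk> \<Longrightarrow> e_elt d i \<in> carrier (free_alg n)"
  by (simp add: e_elt_def)

lemma fcar_E_elt [simp]: "E_elt d n \<chi> \<in> carrier (free_alg n)"
  unfolding E_elt_def by (rule fcar_prod_list) auto

lemma fcar_X_elt [simp]: "\<lbrakk>1 \<le> j; j \<le> n\<rbrakk> \<Longrightarrow> X_elt j \<in> carrier (free_alg n)"
  by (induct j rule: X_elt.induct) auto

lemma ring_free_alg: "ring (free_alg n)"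
proof (rule ringI)
  show "abelian_group (free_alg n)"
  proof (rule abelian_groupI)
    fix x assume "x \<in> carrier (free_alg n)"
    then show "\<exists>y\<in>carrier (free_alg n). y \<oplus>\<^bsub>free_alg n\<^esub> x = \<zero>\<^bsub>free_alg n\<^esub>"
      by (intro bexI[of _ "- x"]) auto
  qed (auto simp: add.assoc add.commute)
  show "Group.monoid (free_alg n)"
    by (rule monoidI) (auto simp: mult.assoc)
qed (auto simp: distrib_left distrib_right)

interpretation Fr: ring "free_alg n" for n
  by (rule ring_free_alg)

lemma free_alg_a_inv [simp]: "f \<in> carrier (free_alg n) \<Longrightarrow> \<ominus>\<^bsub>free_alg n\<^esub> f = - f"
  using Fr.minus_equality[of n "- f" f] by simp

lemma free_alg_minus [simp]:
  "\<lbrakk>f \<in> carrier (free_alg n); g \<in> carrier (free_alg n)\<rbrakk> \<Longrightarrow> f \<ominus>\<^bsub>free_alg n\<^esub> g = f - g"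
  by (simp add: a_minus_def)

lemma yrels_carrier: "yrels d n \<subseteq> carrier (free_alg n)"
proof
  fix x assume "x \<in> yrels d n"
  then show "x \<in> carrier (free_alg n)"
    by (induct rule: yrels.induct)
      (auto simp: Transposition.transpose_def intro!: fcar_diff fcar_add fcar_mult fcar_power)
qed

lemma yideal: "ideal (yideal d n) (free_alg n)"
  unfolding yideal_def by (rule Fr.genideal_ideal) (rule yrels_carrier)

lemma ring_Y: "ring (Y d n)"
  unfolding Y_def by (rule ideal.quotient_is_ring) (rule yideal)

interpretation Yr: ring "Y d n" for d n
  by (rule ring_Y)

lemma cls_hom: "cls d n \<in> ring_hom (free_alg n) (Y d n)"
proof -
  have "cls d n = (+>\<^bsub>free_alg n\<^esub>) (yideal d n)" by (auto simp: cls_def)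
  then show ?thesis
    unfolding Y_def using ideal.rcos_ring_hom[OF yideal] by metis
qed

lemma cls_closed [simp]: "f \<in> carrier (free_alg n) \<Longrightarrow> cls d n f \<in> carrier (Y d n)"
  using cls_hom[of d n] by (rule ring_hom_closed)

lemma cls_add: "\<lbrakk>f \<in> carrier (free_alg n); g \<in> carrier (free_alg n)\<rbrakk> \<Longrightarrow>
    cls d n (f + g) = cls d n f \<oplus>\<^bsub>Y d n\<^esub> cls d n g"
  using ring_hom_add[OF cls_hom, of f n g d] by simp

lemma cls_mult: "\<lbrakk>f \<in> carrier (free_alg n); g \<in> carrier (free_alg n)\<rbrakk> \<Longrightarrow>
    cls d n (f * g) = cls d n f \<otimes>\<^bsub>Y d n\<^esub> cls d n g"
  using ring_hom_mult[OF cls_hom, of f n g d] by simp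

lemma cls_one [simp]: "cls d n 1 = \<one>\<^bsub>Y d n\<^esub>"
  using ring_hom_one[OF cls_hom] by simp

lemma cls_zero [simp]: "cls d n 0 = \<zero>\<^bsub>Y d n\<^esub>"
  using ring_hom_zero[OF cls_hom ring_free_alg ring_Y] by simp

lemma cls_surj: "x \<in> carrier (Y d n) \<Longrightarrow> \<exists>f \<in> carrier (free_alg n). x = cls d n f"
  unfolding Y_def cls_def FactRing_def A_RCOSETS_def' by auto

lemma cls_eq_iff: 
  assumes f: "f \<in> carrier (free_alg n)" and g: "g \<in> carrier (free_alg n)"
  shows "cls d n f = cls d n g \<longleftrightarrow> f - g \<in> yideal d n"
proof -
  interpret ideal "yideal d n" "free_alg n" by (rule yideal)
  show ?thesis
    using Fr.quotient_eq_iff_same_a_r_cos[OF yideal f g] f g by (simp add: cls_def)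
qed

lemma cls_rel: "l - r \<in> yrels d n \<Longrightarrow> l \<in> carrier (free_alg n) \<Longrightarrow> r \<in> carrier (free_alg n) \<Longrightarrow>
    cls d n l = cls d n r"
  using Fr.genideal_self[OF yrels_carrier] by (auto simp: cls_eq_iff yideal_def)

lemma cls_uminus: "f \<in> carrier (free_alg n) \<Longrightarrow> cls d n (- f) = \<ominus>\<^bsub>Y d n\<^esub> cls d n f"
  using Yr.minus_equality[of d n "cls d n (- f)" "cls d n f"] cls_add[of "- f" n f d] by simp

lemma cls_diff: "\<lbrakk>f \<in> carrier (free_alg n); g \<in> carrier (free_alg n)\<rbrakk> \<Longrightarrow>
    cls d n (f - g) = cls d n f \<ominus>\<^bsub>Y d n\<^esub> cls d n g"
  using cls_add[of f n "- g" d] by (simp add: a_minus_def cls_uminus)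

lemma cls_power: "f \<in> carrier (free_alg n) \<Longrightarrow> cls d n (f ^ k) = cls d n f [^]\<^bsub>Y d n\<^esub> k"
  by (induct k) (simp_all add: cls_mult power_Suc2 del: power_Suc)

lemma cls_sum:
  assumes "finite A" "\<And>x. x \<in> A \<Longrightarrow> f x \<in> carrier (free_alg n)"
  shows "cls d n (sum f A) = (\<Oplus>\<^bsub>Y d n\<^esub>x\<in>A. cls d n (f x))"
  using assms by (induct A rule: finite_induct) (simp_all add: cls_add)

lemma scal_closed [simp]: "scal d n c \<in> carrier (Y d n)"
  by (simp add: scal_def)

lemma scal_commute: "x \<in> carrier (Y d n) \<Longrightarrow> scal d n c \<otimes>\<^bsub>Y d n\<^esub> x = x \<otimes>\<^bsub>Y d n\<^esub> scal d n c"
  using cls_surj[of x d n] by (auto simp: scal_def fscal_commute simp flip: cls_mult)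

lemma scal_mult: "scal d n (a * b) = scal d n a \<otimes>\<^bsub>Y d n\<^esub> scal d n b"
  by (simp add: scal_def fscal_mult cls_mult)

lemma scal_simps [simp]: "scal d n 0 = \<zero>\<^bsub>Y d n\<^esub>" "scal d n 1 = \<one>\<^bsub>Y d n\<^esub>"
  by (simp_all add: scal_def)

lemma gY_closed [simp]: "\<lbrakk>1 \<le> i; i < n\<rbrakk> \<Longrightarrow> gY d n i \<in> carrier (Y d n)"
  by (simp add: gY_def)

lemma XY_closed [simp]: "\<lbrakk>1 \<le> i; i \<le> n\<rbrakk> \<Longrightarrow> XY d n i \<in> carrier (Y d n)"
  by (simp add: XY_def)

definition tY :: "nat \<Rightarrow> nat \<Rightarrow> nat \<Rightarrow> falg set" where
  "tY d n j = cls d n (fvar (Tt j))"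

definition eY :: "nat \<Rightarrow> nat \<Rightarrow> nat \<Rightarrow> falg set" where
  "eY d n i = cls d n (e_elt d i)"

lemma tY_closed [simp]: "\<lbrakk>1 \<le> i; i \<le> n\<rbrakk> \<Longrightarrow> tY d n i \<in> carrier (Y d n)"
  by (simp add: tY_def)

lemma eY_closed [simp]: "\<lbrakk>1 \<le> i; i < n\<rbrakk> \<Longrightarrow> eY d n i \<in> carrier (Y d n)"
  by (simp add: eY_def)

lemma gY_comm:
  assumes "1 \<le> i" "i < n" "1 \<le> j" "j < n" "Suc i < j \<or> Suc j < i"
  shows "gY d n i \<otimes>\<^bsub>Y d n\<^esub> gY d n j = gY d n j \<otimes>\<^bsub>Y d n\<^esub> gY d n i"
  using cls_rel[OF yrels.g_comm[of i n j d]] assms by (simp add: gY_def flip: cls_mult)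

lemma gY_braid:
  assumes "1 \<le> i" "Suc i < n"
  shows "gY d n i \<otimes>\<^bsub>Y d n\<^esub> gY d n (Suc i) \<otimes>\<^bsub>Y d n\<^esub> gY d n i =
    gY d n (Suc i) \<otimes>\<^bsub>Y d n\<^esub> gY d n i \<otimes>\<^bsub>Y d n\<^esub> gY d n (Suc i)"
  using cls_rel[OF yrels.g_braid[of i n d]] assms by (simp add: gY_def flip: cls_mult)

lemma XY_1: "XY d n 1 = cls d n (fvar Xp)"
  by (simp add: XY_def)

lemma XY_gY_braid:
  assumes "1 < n"
  shows "XY d n 1 \<otimes>\<^bsub>Y d n\<^esub> gY d n 1 \<otimes>\<^bsub>Y d n\<^esub> XY d n 1 \<otimes>\<^bsub>Y d n\<^esub> gY d n 1 =
    gY d n 1 \<otimes>\<^bsub>Y d n\<^esub> XY d n 1 \<otimes>\<^bsub>Y d n\<^esub> gY d n 1 \<otimes>\<^bsub>Y d n\<^esub> XY d n 1"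
  unfolding XY_1 using cls_rel[OF yrels.Xg_braid[of n d]] assms
  by (simp add: gY_def flip: cls_mult)

lemma XY1_gY_comm:
  assumes "2 \<le> i" "i < n"
  shows "XY d n 1 \<otimes>\<^bsub>Y d n\<^esub> gY d n i = gY d n i \<otimes>\<^bsub>Y d n\<^esub> XY d n 1"
  unfolding XY_1 using cls_rel[OF yrels.Xg_comm[of i n d]] assms
  by (simp add: gY_def flip: cls_mult)

lemma gY_quad:
  assumes "1 \<le> i" "i < n"
  shows "gY d n i \<otimes>\<^bsub>Y d n\<^esub> gY d n i =
    scal d n (upow 2) \<oplus>\<^bsub>Y d n\<^esub> scal d n (vpow 1) \<otimes>\<^bsub>Y d n\<^esub> eY d n i \<otimes>\<^bsub>Y d n\<^esub> gY d n i"
  using cls_rel[OF yrels.g_quad[of i n d]] assms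
  by (simp add: gY_def scal_def eY_def power2_eq_square flip: cls_mult cls_add)

lemma gY_tY:
  assumes "1 \<le> i" "i < n" "1 \<le> j" "j \<le> n"
  shows "gY d n i \<otimes>\<^bsub>Y d n\<^esub> tY d n j = tY d n (transpose i (i + 1) j) \<otimes>\<^bsub>Y d n\<^esub> gY d n i"
  using cls_rel[OF yrels.gt_comm[of i n j d]] assms
  by (simp add: gY_def tY_def Transposition.transpose_def flip: cls_mult split: if_splits)

lemma tY_comm:
  assumes "1 \<le> i" "i \<le> n" "1 \<le> j" "j \<le> n"
  shows "tY d n i \<otimes>\<^bsub>Y d n\<^esub> tY d n j = tY d n j \<otimes>\<^bsub>Y d n\<^esub> tY d n i"
  using cls_rel[OF yrels.t_comm[of i n j d]] assms by (simp add: tY_def flip: cls_mult)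

lemma tY_pow: "\<lbrakk>1 \<le> j; j \<le> n\<rbrakk> \<Longrightarrow> tY d n j [^]\<^bsub>Y d n\<^esub> d = \<one>\<^bsub>Y d n\<^esub>"
  using cls_rel[OF yrels.t_pow[of j n d]] by (simp add: tY_def flip: cls_power)

lemma XY1_Unit: "XY d n 1 \<in> Units (Y d n)"
proof -
  have "cls d n (fvar Xp) \<otimes>\<^bsub>Y d n\<^esub> cls d n (fvar Xm) = \<one>\<^bsub>Y d n\<^esub>"
    "cls d n (fvar Xm) \<otimes>\<^bsub>Y d n\<^esub> cls d n (fvar Xp) = \<one>\<^bsub>Y d n\<^esub>"
    using cls_rel[OF yrels.X_inv_r[of d n]] cls_rel[OF yrels.X_inv_l[of d n]]
    by (simp_all flip: cls_mult)
  then show ?thesis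
    unfolding XY_1 Units_def by (auto intro!: bexI[of _ "cls d n (fvar Xm)"])
qed

lemma XY_Suc:
  assumes "1 \<le> j" "j < n"
  shows "XY d n (Suc j) = scal d n (upow (- 2)) \<otimes>\<^bsub>Y d n\<^esub> gY d n j \<otimes>\<^bsub>Y d n\<^esub> XY d n j \<otimes>\<^bsub>Y d n\<^esub> gY d n j"
  using assms by (cases j) (auto simp: XY_def scal_def gY_def simp flip: cls_mult)

section \<open>Reduced words in the symmetric group\<close>

definition st :: "nat \<Rightarrow> nat \<Rightarrow> nat" where
  "st i = transpose i (Suc i)"

lemma perm_of_simps: "perm_of [] = id" "perm_of (i # is) = st i \<circ> perm_of is"
  by (simp_all add: perm_of_def st_def)

lemma st_permutes: "\<lbrakk>1 \<le> i; i < n\<rbrakk> \<Longrightarrow> st i permutes {1..n}"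
  unfolding st_def by (rule permutes_swap_id) auto

text \<open>The ranges \<open>{1..n}\<close> and the index \<open>1\<close> are kept in this form by the simplifier.\<close>

declare One_nat_def [simp del]

lemma st_st [simp]: "st i (st i x) = x"
  by (simp add: st_def)

lemma st_st_comp: "st i \<circ> (st i \<circ> f) = f"
  by (simp add: fun_eq_iff)

lemma bij_st: "bij (st i)"
  by (rule involuntory_imp_bij) simp

lemma st_apply: "st i x = (if x = i then Suc i else if x = Suc i then i else x)"
  by (simp add: st_def Transposition.transpose_def)

lemma st_comp_permutes:
  "w permutes {1..n} \<Longrightarrow> 1 \<le> i \<Longrightarrow> i < n \<Longrightarrow> st i \<circ> w permutes {1..n}"
  by (rule permutes_compose[OF _ st_permutes])

lemma perm_of_permutes: "set is \<subseteq> {1..<n} \<Longrightarrow> perm_of is permutes {1..n}"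
proof (induct "is")
  case (Cons i "is")
  then have "perm_of is permutes {1..n}" "1 \<le> i" "i < n" by auto
  then show ?case unfolding perm_of_simps by (rule st_comp_permutes)
qed (simp only: perm_of_simps permutes_id)

abbreviation pinv :: "(nat \<Rightarrow> nat) \<Rightarrow> nat \<Rightarrow> nat" where
  "pinv \<equiv> Hilbert_Choice.inv"

text \<open>The number of inversions, which is the length of a permutation by \<open>len_eq_ninv\<close> below.\<close>

definition ninv :: "nat \<Rightarrow> (nat \<Rightarrow> nat) \<Rightarrow> nat" where
  "ninv n w = card {(j, k). j \<in> {1..n} \<and> k \<in> {1..n} \<and> j < k \<and> w k < w j}"

lemma ninv_finite: "finite {(j, k). j \<in> {1..n::nat} \<and> k \<in> {1..n} \<and> j < k \<and> (w k :: nat) < w j}"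
  by (rule finite_subset[of _ "{1..n} \<times> {1..n}"]) auto

lemma st_less_iff: "x \<noteq> y \<Longrightarrow> {x, y} \<noteq> {i, Suc i} \<Longrightarrow> st i x < st i y \<longleftrightarrow> x < y"
  by (auto simp: st_apply)

lemma pinv_st_comp:
  assumes "w permutes {1..n}"
  shows "pinv (st i \<circ> w) = pinv w \<circ> st i"
proof -
  have "pinv (st i) = st i" by (rule inv_unique_comp) (auto simp: fun_eq_iff)
  then show ?thesis using o_inv_distrib[of "st i" w] permutes_bij[OF assms] bij_st by simp
qed

text \<open>Exchanging the values \<open>i\<close> and \<open>i + 1\<close> changes the order of the values at one pair of positions only,
  namely at the two positions where these values are taken.\<close>

lemma ninv_up:
  assumes w: "w permutes {1..n}" and i: "1 \<le> i" "i < n" and lt: "pinv w i < pinv w (Suc i)"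
  shows "ninv n (st i \<circ> w) = Suc (ninv n w)"
proof -
  let ?I = "\<lambda>w. {(j, k). j \<in> {1..n} \<and> k \<in> {1..n} \<and> j < k \<and> (w k :: nat) < w j}"
  let ?a = "pinv w i" and ?b = "pinv w (Suc i)"
  have ab: "?a \<in> {1..n}" "?b \<in> {1..n}" "w ?a = i" "w ?b = Suc i"
    using permutes_in_image[OF permutes_inv[OF w]] i permutes_inverses(1)[OF w] by auto
  have "(j, k) \<in> ?I (st i \<circ> w) \<longleftrightarrow> (j, k) \<in> insert (?a, ?b) (?I w)" for j k
  proof (cases "j < k \<and> {w j, w k} = {i, Suc i}")
    case True
    then have "(j = ?a \<and> k = ?b) \<or> (j = ?b \<and> k = ?a)"
      using ab permutes_inj[OF w] by (metis doubleton_eq_iff permutes_inverses(2) w)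
    then have jk: "j = ?a" "k = ?b" using True lt by auto
    show ?thesis unfolding jk using ab lt by (simp add: st_apply)
  next
    case False
    have "st i (w k) < st i (w j) \<longleftrightarrow> w k < w j" if "j < k"
    proof (rule st_less_iff)
      show "w k \<noteq> w j" using inj_eq[OF permutes_inj[OF w], of k j] that by simp
      show "{w k, w j} \<noteq> {i, Suc i}" using False that by (simp add: insert_commute)
    qed
    moreover have "(j, k) \<noteq> (?a, ?b)" using False ab lt by auto
    ultimately show ?thesis by auto
  qed
  then have "?I (st i \<circ> w) = insert (?a, ?b) (?I w)" by (intro subset_antisym subrelI) blast+
  moreover have "(?a, ?b) \<notin> ?I w" using ab by auto
  ultimately show ?thesis
    unfolding ninv_def by (simp only: card_insert_disjoint[OF ninv_finite] not_False_eq_True)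
qed

lemma ninv_down:
  assumes w: "w permutes {1..n}" and i: "1 \<le> i" "i < n" and lt: "pinv w (Suc i) < pinv w i"
  shows "ninv n w = Suc (ninv n (st i \<circ> w))"
proof -
  have "ninv n (st i \<circ> (st i \<circ> w)) = Suc (ninv n (st i \<circ> w))"
    by (rule ninv_up) (use assms in \<open>auto simp: pinv_st_comp st_comp_permutes st_apply\<close>)
  then show ?thesis by (simp only: st_st_comp)
qed

lemma pinv_adjacent_neq:
  assumes "w permutes {1..n}"
  shows "pinv w i \<noteq> pinv w (Suc i)"
  using inj_eq[OF permutes_inj[OF permutes_inv[OF assms]], of i "Suc i"] by simp

lemma ninv_word_le: "set is \<subseteq> {1..<n} \<Longrightarrow> ninv n (perm_of is) \<le> length is"
proof (induct "is")
  case Nil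
  have "{(j, k). j \<in> {1..n} \<and> k \<in> {1..n} \<and> j < k \<and> id k < id j} = ({} :: (nat \<times> nat) set)"
    by auto
  then have "ninv n (perm_of []) = 0" by (simp only: ninv_def perm_of_simps card.empty)
  then show ?case by (simp only: le0)
next
  case (Cons i "is")
  then have p: "perm_of is permutes {1..n}" and i: "1 \<le> i" "i < n" and
    IH: "ninv n (perm_of is) \<le> length is" by (auto intro: perm_of_permutes)
  show ?case
  proof (cases "pinv (perm_of is) i < pinv (perm_of is) (Suc i)")
    case True
    then show ?thesis unfolding perm_of_simps using ninv_up[OF p i] IH by (simp del: comp_apply)
  next
    case False
    then have "pinv (perm_of is) (Suc i) < pinv (perm_of is) i"
      using pinv_adjacent_neq[OF p, of i] by linarith
    then show ?thesis unfolding perm_of_simps using ninv_down[OF p i] IH by (simp del: comp_apply)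
  qed
qed

lemma increasing_permutation_id:
  assumes p: "p permutes {1..n}" and inc: "\<And>i. 1 \<le> i \<Longrightarrow> i < n \<Longrightarrow> p i < p (Suc i :: nat)"
  shows "p = id"
proof
  fix i
  show "p i = id i"
  proof (cases "i \<in> {1..n}")
    case True
    have lo: "j \<le> p j" if "1 \<le> j" "j \<le> n" for j
      using that
    proof (induct j)
      case (Suc j)
      then show ?case using inc[of j] permutes_in_image[OF p, of 1] by (cases "j = 0") (auto simp: One_nat_def)
    qed simp
    have "p i + k \<le> p (i + k)" if "i + k \<le> n" for k
      using that
    proof (induct k)
      case (Suc k)
      then show ?case using inc[of "i + k"] True by (simp add: One_nat_def)
    qed simp
    from this[of "n - i"] have "p i + (n - i) \<le> p n" using True by simp
    moreover have "p n \<le> n" using permutes_in_image[OF p, of n] True by auto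
    ultimately show ?thesis using lo[of i] True by auto
  qed (simp add: permutes_not_in[OF p])
qed

text \<open>A permutation other than the identity has a descent in its inverse, and removing it lowers the number
  of inversions by one.\<close>

lemma ex_word:
  assumes "w permutes {1..n}"
  shows "\<exists>is. set is \<subseteq> {1..<n} \<and> perm_of is = w \<and> length is = ninv n w"
  using assms
proof (induct "ninv n w" arbitrary: w rule: less_induct)
  case less
  show ?case
  proof (cases "\<exists>i. 1 \<le> i \<and> i < n \<and> pinv w (Suc i) < pinv w i")
    case True
    then obtain i where i: "1 \<le> i" "i < n" and d: "pinv w (Suc i) < pinv w i" by auto
    note dn = ninv_down[OF less.prems i d]
    obtain "is" where "set is \<subseteq> {1..<n}" "perm_of is = st i \<circ> w" "length is = ninv n (st i \<circ> w)"
      using less.hyps[of "st i \<circ> w"] dn permutes_compose[OF less.prems st_permutes[OF i]] by auto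
    then show ?thesis using i dn by (intro exI[of _ "i # is"]) (auto simp: perm_of_simps st_st_comp)
  next
    case False
    then have "pinv w = id"
      using pinv_adjacent_neq[OF less.prems]
      by (intro increasing_permutation_id[OF permutes_inv[OF less.prems]]) (meson linorder_neqE_nat)
    then have "w = id" using permutes_inv_inv[OF less.prems] by (metis inv_id)
    then show ?thesis using ninv_word_le[of "[]" n] by (intro exI[of _ "[]"]) (auto simp: perm_of_simps)
  qed
qed

lemma len_eq_ninv:
  assumes "w permutes {1..n}"
  shows "len n w = ninv n w"
  unfolding len_def
proof (rule Least_equality)
  show "\<exists>is. set is \<subseteq> {1..<n} \<and> perm_of is = w \<and> length is = ninv n w"
    by (rule ex_word[OF assms])
  fix r assume "\<exists>is. set is \<subseteq> {1..<n} \<and> perm_of is = w \<and> length is = r"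
  then obtain "is" where "set is \<subseteq> {1..<n}" "perm_of is = w" "length is = r" by blast
  then show "ninv n w \<le> r" using ninv_word_le[of "is" n] by simp
qed

lemma reduced_word_iff:
  assumes "w permutes {1..n}"
  shows "reduced_word n w is \<longleftrightarrow> set is \<subseteq> {1..<n} \<and> perm_of is = w \<and> length is = ninv n w"
  by (simp add: reduced_word_def len_eq_ninv[OF assms])

lemma reduced_word_ex: "w permutes {1..n} \<Longrightarrow> reduced_word n w (SOME is. reduced_word n w is)"
  by (rule someI_ex) (simp add: reduced_word_iff ex_word)

lemma reduced_word_Cons:
  assumes r: "reduced_word n (perm_of (i # is)) (i # is)"
  shows "1 \<le> i" "i < n" "reduced_word n (perm_of is) is"
    "pinv (perm_of is) i < pinv (perm_of is) (Suc i)"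
proof -
  have s: "set (i # is) \<subseteq> {1..<n}" using r unfolding reduced_word_def by blast
  then have p: "perm_of is permutes {1..n}" "perm_of (i # is) permutes {1..n}"
    by (intro perm_of_permutes; simp)+
  show i: "1 \<le> i" "i < n" using s by auto
  have l: "ninv n (st i \<circ> perm_of is) = Suc (length is)" using r
    unfolding reduced_word_iff[OF p(2)] by (simp add: perm_of_simps del: comp_apply)
  have le: "ninv n (perm_of is) \<le> length is" using ninv_word_le[of "is" n] s by simp
  show lt: "pinv (perm_of is) i < pinv (perm_of is) (Suc i)"
    using l le ninv_down[OF p(1) i] pinv_adjacent_neq[OF p(1), of i] by linarith
  show "reduced_word n (perm_of is) is"
    using l ninv_up[OF p(1) i lt] s reduced_word_iff[OF p(1)] by (simp del: comp_apply)
qed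

lemma lprod_simps [simp]:
  "lprod M [] = \<one>\<^bsub>M\<^esub>" "lprod M (x # xs) = x \<otimes>\<^bsub>M\<^esub> lprod M xs"
  by (simp_all add: lprod_def)

lemma (in Group.monoid) lprod_closed [simp]: "set xs \<subseteq> carrier G \<Longrightarrow> lprod G xs \<in> carrier G"
  by (induct xs) auto

text \<open>Matsumoto's theorem for the symmetric group. Two reduced words with different first letters
  \<open>i\<close> and \<open>j\<close> are compared, through the induction hypothesis, with reduced words that begin with
  the longest element of the subgroup generated by the two transpositions; both of its reduced words are
  related by one braid relation.\<close>

lemma (in Group.monoid) reduced_words_equal_products:
  fixes g :: "nat \<Rightarrow> 'a"
  assumes g: "\<And>i. 1 \<le> i \<Longrightarrow> i < n \<Longrightarrow> g i \<in> carrier G"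
    and comm: "\<And>i j. 1 \<le> i \<Longrightarrow> Suc i < j \<Longrightarrow> j < n \<Longrightarrow> g i \<otimes> g j = g j \<otimes> g i"
    and braid: "\<And>i. 1 \<le> i \<Longrightarrow> Suc i < n \<Longrightarrow>
      g i \<otimes> g (Suc i) \<otimes> g i = g (Suc i) \<otimes> g i \<otimes> g (Suc i)"
  shows "reduced_word n w is \<Longrightarrow> reduced_word n w js \<Longrightarrow> lprod G (map g is) = lprod G (map g js)"
proof (induct "length is" arbitrary: w "is" js rule: less_induct)
  case less
  have eqlen: "length is = length js" and pis: "perm_of is = w" and pjs: "perm_of js = w"
    and sis: "set is \<subseteq> {1..<n}" and sjs: "set js \<subseteq> {1..<n}"
    using less.prems by (auto simp: reduced_word_def)
  have w: "w permutes {1..n}" using perm_of_permutes[OF sis] pis by simp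
  have G: "lprod G (map g ks) \<in> carrier G" if "set ks \<subseteq> {1..<n}" for ks
    using that g by (intro lprod_closed) auto
  show ?case
  proof (cases "is")
    case Nil
    then show ?thesis using eqlen by simp
  next
    case (Cons i is')
    then obtain j js' where js: "js = j # js'" using eqlen by (cases js) auto
    have i: "1 \<le> i" "i < n" and j: "1 \<le> j" "j < n" using sis sjs Cons js by auto
    have ri: "reduced_word n (st i \<circ> w) is'" 
      using reduced_word_Cons(3)[of n i is'] less.prems(1) pis Cons
      by (simp add: perm_of_simps flip: pis) (metis st_st_comp)
    have rj: "reduced_word n (st j \<circ> w) js'" 
      using reduced_word_Cons(3)[of n j js'] less.prems(2) pjs js
      by (simp add: perm_of_simps flip: pjs) (metis st_st_comp)
    have di: "pinv w (Suc i) < pinv w i"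
    proof -
      have "pinv w = pinv (perm_of is') \<circ> st i"
        using pis Cons perm_of_permutes[of is' n] sis pinv_st_comp by (auto simp: perm_of_simps)
      then show ?thesis using reduced_word_Cons(4)[of n i is'] less.prems(1) pis Cons by (simp add: st_apply)
    qed
    have dj: "pinv w (Suc j) < pinv w j"
    proof -
      have "pinv w = pinv (perm_of js') \<circ> st j"
        using pjs js perm_of_permutes[of js' n] sjs pinv_st_comp by (auto simp: perm_of_simps)
      then show ?thesis using reduced_word_Cons(4)[of n j js'] less.prems(2) pjs js by (simp add: st_apply)
    qed
    \<comment> \<open>When the first letters differ, a common left factor of \<open>w\<close> of length two or three
      starts with either of them.\<close>
    have far: "lprod G (map g (a # as)) = lprod G (map g (b # bs))"
      if a: "1 \<le> a" and ab: "Suc a < b" and b: "b < n"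
        and ra: "reduced_word n (st a \<circ> w) as" and rb: "reduced_word n (st b \<circ> w) bs"
        and la: "length as < length is" and lb: "length bs < length is"
        and da: "pinv w (Suc a) < pinv w a" and db: "pinv w (Suc b) < pinv w b" for a b as bs
    proof -
      define v where "v = st b \<circ> (st a \<circ> w)"
      have c: "st b \<circ> (st a \<circ> w) = st a \<circ> (st b \<circ> w)"
        using ab by (auto simp: fun_eq_iff st_apply)
      have P: "st a \<circ> w permutes {1..n}" "st b \<circ> w permutes {1..n}" "v permutes {1..n}"
        using a b ab w unfolding v_def by (auto intro!: st_comp_permutes)
      have "ninv n (st a \<circ> w) = Suc (ninv n v)" unfolding v_def
        using ab a b da db by (intro ninv_down P) (auto simp: pinv_st_comp[OF w] st_apply)
      moreover have "ninv n (st b \<circ> w) = Suc (ninv n v)" unfolding v_def c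
        using ab a b da db by (intro ninv_down P) (auto simp: pinv_st_comp[OF w] st_apply)
      moreover obtain ks where ks: "set ks \<subseteq> {1..<n}" "perm_of ks = v" "length ks = ninv n v"
        using ex_word[OF P(3)] by auto
      moreover have "st a \<circ> v = st b \<circ> w" "st b \<circ> v = st a \<circ> w"
        unfolding v_def by (simp_all only: c st_st_comp) (simp_all only: flip: c add: st_st_comp)
      ultimately have "reduced_word n (st a \<circ> w) (b # ks)" "reduced_word n (st b \<circ> w) (a # ks)"
        using a b ab by (auto simp: reduced_word_iff[OF P(1)] reduced_word_iff[OF P(2)] perm_of_simps)
      then have "lprod G (map g as) = g b \<otimes> lprod G (map g ks)"
        "lprod G (map g bs) = g a \<otimes> lprod G (map g ks)"
        using less.hyps[OF la ra] less.hyps[OF lb rb] by auto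
      then show ?thesis
        using comm[OF a ab b] g a b ab G[OF ks(1)] by (simp flip: m_assoc)
    qed
    have near: "lprod G (map g (a # as)) = lprod G (map g ((Suc a) # bs))"
      if a: "1 \<le> a" and b: "Suc a < n"
        and ra: "reduced_word n (st a \<circ> w) as" and rb: "reduced_word n (st (Suc a) \<circ> w) bs"
        and la: "length as < length is" and lb: "length bs < length is"
        and da: "pinv w (Suc a) < pinv w a" and db: "pinv w (Suc (Suc a)) < pinv w (Suc a)" for a as bs
    proof -
      define v1 v2 v where "v1 = st (Suc a) \<circ> (st a \<circ> w)" and "v2 = st a \<circ> (st (Suc a) \<circ> w)"
        and "v = st a \<circ> v1"
      have c: "v = st (Suc a) \<circ> v2"
        unfolding v_def v1_def v2_def by (auto simp: fun_eq_iff st_apply)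
      have P: "st a \<circ> w permutes {1..n}" "st (Suc a) \<circ> w permutes {1..n}" 
        "v1 permutes {1..n}" "v2 permutes {1..n}" "v permutes {1..n}"
        using a b w unfolding v_def v1_def v2_def
        by (auto intro!: st_comp_permutes)
      have t: "st a (Suc (Suc a)) = Suc (Suc a)" "st a (Suc a) = a" "st (Suc a) a = a"
        "st (Suc a) (Suc a) = Suc (Suc a)" "st a a = Suc a" "st (Suc a) (Suc (Suc a)) = Suc a"
        by (auto simp: st_apply)
      have "ninv n (st a \<circ> w) = Suc (ninv n v1)" unfolding v1_def
        using a b da db by (intro ninv_down P) (auto simp: pinv_st_comp[OF w] t )
      moreover have "ninv n v1 = Suc (ninv n v)" unfolding v_def
        by (intro ninv_down P)
          (use a b da db in \<open>auto simp: v1_def pinv_st_comp[OF P(1)] pinv_st_comp[OF w] t \<close>)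
      moreover have "ninv n (st (Suc a) \<circ> w) = Suc (ninv n v2)" unfolding v2_def
        using a b da db by (intro ninv_down P) (auto simp: pinv_st_comp[OF w] t )
      moreover have "ninv n v2 = Suc (ninv n v)" unfolding c
        by (intro ninv_down P)
          (use a b da db in \<open>auto simp: v2_def pinv_st_comp[OF P(2)] pinv_st_comp[OF w] t \<close>)
      moreover obtain ks where ks: "set ks \<subseteq> {1..<n}" "perm_of ks = v" "length ks = ninv n v"
        using ex_word[OF P(5)] by auto
      moreover have "st (Suc a) \<circ> (st a \<circ> v) = st a \<circ> w"
        unfolding v_def v1_def by (simp only: st_st_comp)
      moreover have "st a \<circ> (st (Suc a) \<circ> v) = st (Suc a) \<circ> w"
        unfolding c v2_def by (simp only: st_st_comp)
      ultimately have "reduced_word n (st a \<circ> w) ((Suc a) # a # ks)"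
        "reduced_word n (st (Suc a) \<circ> w) (a # (Suc a) # ks)"
        using a b by (simp_all add: reduced_word_iff[OF P(1)] reduced_word_iff[OF P(2)] perm_of_simps)
      then have "lprod G (map g as) = g (Suc a) \<otimes> (g a \<otimes> lprod G (map g ks))"
        "lprod G (map g bs) = g a \<otimes> (g (Suc a) \<otimes> lprod G (map g ks))"
        using less.hyps[OF la ra] less.hyps[OF lb rb] by auto
      then show ?thesis
        using braid[OF a b] g[of a] g[of "Suc a"] a b G[OF ks(1)] by (simp flip: m_assoc)
    qed
    have l: "length is' < length is" "length js' < length is" using Cons js eqlen by auto
    consider "i = j" | "Suc i < j" | "Suc j < i" | "j = Suc i" | "i = Suc j" by linarith
    then show ?thesis
    proof cases
      case 1
      then show ?thesis using less.hyps[OF l(1) ri] rj Cons js by simp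
    next
      case 2
      show ?thesis unfolding Cons js by (rule far[OF i(1) 2 j(2) ri rj l di dj])
    next
      case 3
      show ?thesis unfolding Cons js by (rule far[OF j(1) 3 i(2) rj ri l(2,1) dj di, symmetric])
    next
      case 4
      show ?thesis unfolding Cons js 4 by (rule near[OF i(1) _ ri _ l di]) (use j rj dj 4 in auto)
    next
      case 5
      show ?thesis unfolding Cons js 5
        by (rule near[OF j(1) _ rj _ l(2,1) dj, symmetric]) (use i ri di 5 in auto)
    qed
  qed
qed

section \<open>Standardization of words of colours\<close>

text \<open>The place of the position \<open>j\<close> when all positions are sorted by colour, with the order kept among positions of
  equal colour.\<close>

definition std :: "nat \<Rightarrow> (nat \<Rightarrow> nat) \<Rightarrow> nat \<Rightarrow> nat" where
  "std n c j = (if j \<in> {1..n}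
     then card {k \<in> {1..n}. c k < c j \<or> c k = c j \<and> k \<le> j} else j)"

lemma std_eq: "j \<in> {1..n} \<Longrightarrow> std n c j = card {k \<in> {1..n}. c k < c j \<or> c k = c j \<and> k \<le> j}"
  by (simp add: std_def)

lemma std_mono:
  assumes "j \<in> {1..n}" "k \<in> {1..n}" "c j < c k \<or> c j = c k \<and> j < k"
  shows "std n c j < std n c k"
  unfolding std_eq[OF assms(1)] std_eq[OF assms(2)]
proof (rule psubset_card_mono)
  have "k \<notin> {m \<in> {1..n}. c m < c j \<or> c m = c j \<and> m \<le> j}" using assms by auto
  moreover have "k \<in> {m \<in> {1..n}. c m < c k \<or> c m = c k \<and> m \<le> k}" using assms by auto
  moreover have "{m \<in> {1..n}. c m < c j \<or> c m = c j \<and> m \<le> j} \<subseteq> {m \<in> {1..n}. c m < c k \<or> c m = c k \<and> m \<le> k}"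
    using assms by auto
  ultimately show "{m \<in> {1..n}. c m < c j \<or> c m = c j \<and> m \<le> j} \<subset> {m \<in> {1..n}. c m < c k \<or> c m = c k \<and> m \<le> k}"
    by blast
qed simp

lemma std_range: "j \<in> {1..n} \<Longrightarrow> std n c j \<in> {1..n}"
proof -
  assume j: "j \<in> {1..n}"
  have "card {k \<in> {1..n}. c k < c j \<or> c k = c j \<and> k \<le> j} \<le> card {1..n}" by (rule card_mono) auto
  moreover have "card {j} \<le> card {k \<in> {1..n}. c k < c j \<or> c k = c j \<and> k \<le> j}"
    using j by (intro card_mono) auto
  ultimately show ?thesis using j by (simp add: std_eq)
qed

lemma std_permutes: "std n c permutes {1..n}"
proof (rule bij_imp_permutes)
  have inj: "inj_on (std n c) {1..n}"
  proof (rule inj_onI, rule ccontr)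
    fix j k assume jk: "j \<in> {1..n}" "k \<in> {1..n}" "std n c j = std n c k" "j \<noteq> k"
    then have "(c j < c k \<or> c j = c k \<and> j < k) \<or> (c k < c j \<or> c k = c j \<and> k < j)" by linarith
    then show False using std_mono[of j n k c] std_mono[of k n j c] jk by auto
  qed
  moreover have "std n c ` {1..n} = {1..n}"
    by (rule endo_inj_surj) (use inj std_range in auto)
  ultimately show "bij_betw (std n c) {1..n} {1..n}" by (simp add: bij_betw_def)
qed (simp only: std_def if_False)

lemma std_Suc:
  assumes "1 \<le> i" "i < n" "c i = c (Suc i)"
  shows "std n c (Suc i) = Suc (std n c i)"
proof -
  have "{k \<in> {1..n}. c k < c (Suc i) \<or> c k = c (Suc i) \<and> k \<le> Suc i} =
      insert (Suc i) {k \<in> {1..n}. c k < c i \<or> c k = c i \<and> k \<le> i}"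
    using assms by (auto simp: le_Suc_eq)
  then show ?thesis using assms by (simp add: std_eq)
qed

text \<open>The place of a position is the number of positions that come before or at it in the order by colour
  and then by position, and an increasing bijection preserves this number.\<close>

lemma std_unique:
  assumes p: "p permutes {1..n}"
    and inc: "\<And>j k. j \<in> {1..n} \<Longrightarrow> k \<in> {1..n} \<Longrightarrow> c j < c k \<or> c j = c k \<and> j < k \<Longrightarrow> p j < p k"
  shows "p = std n c"
proof
  fix j
  show "p j = std n c j"
  proof (cases "j \<in> {1..n}")
    case True
    have eq: "c k < c j \<or> c k = c j \<and> k \<le> j \<longleftrightarrow> p k \<le> p j" if "k \<in> {1..n}" for k
    proof -
      consider "k = j" | "c k < c j \<or> c k = c j \<and> k < j" | "c j < c k \<or> c j = c k \<and> j < k"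
        by linarith
      then show ?thesis
      proof cases
        case 1
        then show ?thesis by simp
      next
        case 2
        have "p k < p j" by (rule inc[OF that True 2])
        with 2 show ?thesis by linarith
      next
        case 3
        have "p j < p k" by (rule inc[OF True that 3])
        with 3 show ?thesis by linarith
      qed
    qed
    have "p ` {k \<in> {1..n}. c k < c j \<or> c k = c j \<and> k \<le> j} = {1..p j}"
    proof
      show "p ` {k \<in> {1..n}. c k < c j \<or> c k = c j \<and> k \<le> j} \<subseteq> {1..p j}"
      proof (rule image_subsetI)
        fix k assume k: "k \<in> {k \<in> {1..n}. c k < c j \<or> c k = c j \<and> k \<le> j}"
        then have "p k \<le> p j" using eq[of k] by blast
        moreover have "p k \<in> {1..n}" using permutes_in_image[OF p, of k] k by blast
        ultimately show "p k \<in> {1..p j}" by simp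
      qed
      show "{1..p j} \<subseteq> p ` {k \<in> {1..n}. c k < c j \<or> c k = c j \<and> k \<le> j}"
      proof
        fix m assume m: "m \<in> {1..p j}"
        then have mn: "m \<in> {1..n}" using permutes_in_image[OF p, of j] True by auto
        have "pinv p m \<in> {1..n}" using permutes_in_image[OF permutes_inv[OF p]] mn by blast
        moreover have "p (pinv p m) = m" by (rule permutes_inverses(1)[OF p])
        ultimately show "m \<in> p ` {k \<in> {1..n}. c k < c j \<or> c k = c j \<and> k \<le> j}"
          using eq[of "pinv p m"] m by (intro image_eqI[of _ _ "pinv p m"]) auto
      qed
    qed
    then have "card {1..p j} = card {k \<in> {1..n}. c k < c j \<or> c k = c j \<and> k \<le> j}"
      using card_image[OF inj_on_subset[OF permutes_inj[OF p]], of "{k \<in> {1..n}. c k < c j \<or> c k = c j \<and> k \<le> j}"]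
      by simp
    then show ?thesis using True by (simp add: std_eq)
  qed (simp only: std_def permutes_not_in[OF p] if_False not_False_eq_True)
qed

lemma st_in_range: "1 \<le> i \<Longrightarrow> i < n \<Longrightarrow> st i j \<in> {1..n} \<longleftrightarrow> j \<in> {1..n}"
  by (auto simp: st_apply)

text \<open>Exchanging two neighbours of different colours does not change the order among the positions
  of any one colour.\<close>

lemma std_st_neq:
  assumes i: "1 \<le> i" "i < n" and c: "c i \<noteq> c (Suc i)"
  shows "std n (c \<circ> st i) = std n c \<circ> st i"
proof (rule std_unique[symmetric])
  show "std n c \<circ> st i permutes {1..n}"
    by (rule permutes_compose[OF st_permutes[OF i] std_permutes])
  fix j k
  assume jk: "j \<in> {1..n}" "k \<in> {1..n}" "(c \<circ> st i) j < (c \<circ> st i) k \<or> (c \<circ> st i) j = (c \<circ> st i) k \<and> j < k"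
  have "st i j < st i k" if "c (st i j) = c (st i k)" "j < k"
  proof (subst st_less_iff)
    show "{j, k} \<noteq> {i, Suc i}" using that c by (auto simp: doubleton_eq_iff st_apply)
  qed (use that in auto)
  then show "(std n c \<circ> st i) j < (std n c \<circ> st i) k"
    using jk std_mono[of "st i j" n "st i k" c] st_in_range[OF i] by auto
qed

text \<open>In the order by colour and then by position no other position comes between two neighbours of equal
  colour.\<close>

lemma std_st_eq:
  assumes i: "1 \<le> i" "i < n" and c: "c i = c (Suc i)"
  shows "std n c \<circ> st i = st (std n c i) \<circ> std n c"
proof
  fix x
  have inj: "std n c x = std n c y \<longleftrightarrow> x = y" for y
    by (rule inj_eq[OF permutes_inj[OF std_permutes]])
  consider "x = i" | "x = Suc i" | "x \<noteq> i" "x \<noteq> Suc i" by blast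
  then have "std n c (st i x) = st (std n c i) (std n c x)"
  proof cases
    case 3
    then have "std n c x \<noteq> std n c i" "std n c x \<noteq> Suc (std n c i)"
      unfolding std_Suc[OF i c, symmetric] inj by auto
    then show ?thesis using 3 by (simp only: st_apply if_False)
  qed (simp_all only: st_apply std_Suc[OF i c] if_True if_False simp_thms n_not_Suc_n Suc_n_not_n)
  then show "(std n c \<circ> st i) x = (st (std n c i) \<circ> std n c) x"
    by (simp only: comp_apply)
qed

text \<open>The positions of colour at most \<open>a\<close> are sorted onto an initial segment, whose length is the sum of the
  first \<open>a\<close> parts of \<open>\<mu>\<close>.\<close>

lemma block_std:
  assumes c: "\<And>k. k \<in> {1..n} \<Longrightarrow> c k \<in> {1..d}" and j: "j \<in> {1..n}"
    and \<mu>: "\<And>a. \<mu> a = card {k \<in> {1..n}. c k = a}"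
  shows "block \<mu> (std n c j) = c j"
proof -
  have sum: "(\<Sum>b = 1..a. \<mu> b) = card {k \<in> {1..n}. c k \<le> a}" for a
  proof -
    have "{k \<in> {1..n}. c k \<le> a} = (\<Union>b\<in>{1..a}. {k \<in> {1..n}. c k = b})"
      using c by fastforce
    then show ?thesis
      by (simp only: \<mu>) (subst card_UN_disjoint', auto simp: disjoint_family_on_def)
  qed
  have "std n c j \<le> (\<Sum>b = 1..a. \<mu> b) \<longleftrightarrow> c j \<le> a" for a
  proof
    assume "c j \<le> a"
    then show "std n c j \<le> (\<Sum>b = 1..a. \<mu> b)"
      unfolding sum std_eq[OF j] by (intro card_mono) auto
  next
    assume le: "std n c j \<le> (\<Sum>b = 1..a. \<mu> b)"
    show "c j \<le> a"
    proof (rule ccontr)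
      assume "\<not> c j \<le> a"
      then have "{k \<in> {1..n}. c k \<le> a} \<subset> {k \<in> {1..n}. c k < c j \<or> c k = c j \<and> k \<le> j}" using j by auto
      then have "card {k \<in> {1..n}. c k \<le> a} < std n c j"
        unfolding std_eq[OF j] by (intro psubset_card_mono) auto
      then show False using le sum by simp
    qed
  qed
  then show ?thesis unfolding block_def by (simp add: Least_equality)
qed

section \<open>The minimal permutation that sorts a character\<close>

text \<open>The colour of a root of unity, that is, its number in the enumeration \<open>\<xi>\<close>.\<close>

definition rank :: "(nat \<Rightarrow> complex) \<Rightarrow> nat \<Rightarrow> complex \<Rightarrow> nat" where
  "rank \<xi> d = inv_into {1..d} \<xi>"

lemma rank:
  assumes "roots_enum d \<xi>" "\<chi> \<in> Irr d n" "k \<in> {1..n}"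
  shows "rank \<xi> d (\<chi> k) \<in> {1..d}" "\<xi> (rank \<xi> d (\<chi> k)) = \<chi> k"
proof -
  have "\<chi> k \<in> \<xi> ` {1..d}"
    using assms by (auto simp: Irr_def roots_enum_def bij_betw_def PiE_iff)
  then show "rank \<xi> d (\<chi> k) \<in> {1..d}" "\<xi> (rank \<xi> d (\<chi> k)) = \<chi> k"
    unfolding rank_def by (rule inv_into_into, rule f_inv_into_f)
qed

lemma rank_\<xi>: "roots_enum d \<xi> \<Longrightarrow> a \<in> {1..d} \<Longrightarrow> rank \<xi> d (\<xi> a) = a"
  unfolding rank_def roots_enum_def bij_betw_def by (auto intro: inv_into_f_f)

lemma Comp_rank:
  assumes "roots_enum d \<xi>" "\<chi> \<in> Irr d n"
  shows "Comp \<xi> d n \<chi> a = card {k \<in> {1..n}. (rank \<xi> d \<circ> \<chi>) k = a}"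
proof (cases "a \<in> {1..d}")
  case True
  then have "\<chi> k = \<xi> a \<longleftrightarrow> rank \<xi> d (\<chi> k) = a" if "k \<in> {1..n}" for k
    using rank[OF assms that] rank_\<xi>[OF assms(1) True] by auto
  then have "{k \<in> {1..n}. \<chi> k = \<xi> a} = {k \<in> {1..n}. (rank \<xi> d \<circ> \<chi>) k = a}" by auto
  then show ?thesis using True by (simp add: Comp_def)
next
  case False
  then have "{k \<in> {1..n}. (rank \<xi> d \<circ> \<chi>) k = a} = {}" using rank[OF assms] by fastforce
  then show ?thesis using False by (simp only: Comp_def if_False card.empty)
qed

lemma block_rank:
  assumes "roots_enum d \<xi>" "\<chi> \<in> Irr d n" "j \<in> {1..n}"
  shows "block (Comp \<xi> d n \<chi>) (std n (rank \<xi> d \<circ> \<chi>) j) = rank \<xi> d (\<chi> j)"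
  using block_std[of n "rank \<xi> d \<circ> \<chi>" d j "Comp \<xi> d n \<chi>"] rank[OF assms(1,2)] assms
  by (simp add: Comp_rank[OF assms(1,2)])

lemma block_mono:
  assumes "j \<le> k" "k \<le> (\<Sum>b = 1..a. \<mu> b)"
  shows "block \<mu> j \<le> block \<mu> k"
  unfolding block_def
proof (rule Least_le)
  have "k \<le> (\<Sum>b = 1..(LEAST a. k \<le> (\<Sum>b = 1..a. \<mu> b)). \<mu> b)"
    by (rule LeastI[where P="\<lambda>a. k \<le> (\<Sum>b = 1..a. \<mu> b)"]) (rule assms(2))
  then show "j \<le> (\<Sum>b = 1..(LEAST a. k \<le> (\<Sum>b = 1..a. \<mu> b)). \<mu> b)" using assms(1) by linarith
qed

lemma ninv_pinv:
  assumes w: "w permutes {1..n}"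
  shows "ninv n (pinv w) = ninv n w"
proof -
  let ?I = "\<lambda>w. {(j, k). j \<in> {1..n} \<and> k \<in> {1..n} \<and> j < k \<and> (w k :: nat) < w j}"
  have "bij_betw (\<lambda>(j, k). (w k, w j)) (?I w) (?I (pinv w))"
    by (rule bij_betw_byWitness[where f' = "\<lambda>(j, k). (pinv w k, pinv w j)"])
      (use permutes_in_image[OF w] permutes_in_image[OF permutes_inv[OF w]] in
        \<open>auto simp: permutes_inverses[OF w]\<close>)
  then show ?thesis unfolding ninv_def by (simp add: bij_betw_same_card)
qed

text \<open>Minimality of the length forces \<open>\<pi>\<^sub>\<chi>\<close> to be increasing on every block, and its inverse is then increasing
  for the order by colour and then by position, which is only true of the standardization.\<close>

lemma pi_chi_std:
  assumes \<xi>: "roots_enum d \<xi>" and \<chi>: "\<chi> \<in> Irr d n"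
  shows "pi_chi \<xi> d n \<chi> permutes {1..n}" "pinv (pi_chi \<xi> d n \<chi>) = std n (rank \<xi> d \<circ> \<chi>)"
proof -
  let ?c = "rank \<xi> d \<circ> \<chi>" and ?\<mu> = "Comp \<xi> d n \<chi>"
  let ?s = "std n ?c"
  let ?P = "\<lambda>w. w permutes {1..n} \<and> act w (chi0 \<xi> n ?\<mu>) = \<chi>"
  define \<pi> where "\<pi> = pi_chi \<xi> d n \<chi>"
  have s: "?s permutes {1..n}" by (rule std_permutes)
  have "?P (pinv ?s)"
  proof
    show "pinv ?s permutes {1..n}" by (rule permutes_inv[OF s])
    show "act (pinv ?s) (chi0 \<xi> n ?\<mu>) = \<chi>"
    proof
      fix j
      show "act (pinv ?s) (chi0 \<xi> n ?\<mu>) j = \<chi> j"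
      proof (cases "j \<in> {1..n}")
        case True
        then show ?thesis
          using block_rank[OF \<xi> \<chi> True] rank[OF \<xi> \<chi> True] permutes_in_image[OF s, of j]
          by (simp add: act_def chi0_def inv_inv_eq[OF permutes_bij[OF s]])
      next
        case False
        then have "\<chi> j = undefined" using \<chi> unfolding Irr_def by (rule PiE_arb[rotated])
        then show ?thesis
          using False permutes_not_in[OF s False]
          by (auto simp: act_def chi0_def inv_inv_eq[OF permutes_bij[OF s]])
      qed
    qed
  qed
  from arg_min_nat_lemma[of ?P, OF this, of "len n"]
  have \<pi>: "\<pi> permutes {1..n}" and act\<pi>: "act \<pi> (chi0 \<xi> n ?\<mu>) = \<chi>"
    and min: "\<And>w. ?P w \<Longrightarrow> len n \<pi> \<le> len n w"
    unfolding \<pi>_def pi_chi_def by auto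
  have p: "pinv \<pi> permutes {1..n}" by (rule permutes_inv[OF \<pi>])
  have bl: "block ?\<mu> (?s j) = ?c j" if "j \<in> {1..n}" for j
    using block_rank[OF \<xi> \<chi> that] by simp
  have blk: "block ?\<mu> m \<in> {1..d}" if "m \<in> {1..n}" for m
  proof -
    have "pinv ?s m \<in> {1..n}" using permutes_in_image[OF permutes_inv[OF s]] that by blast
    then show ?thesis using bl[of "pinv ?s m"] rank(1)[OF \<xi> \<chi>, of "pinv ?s m"] permutes_inverses(1)[OF s] by auto
  qed
  have blp: "block ?\<mu> (pinv \<pi> j) = ?c j" if j: "j \<in> {1..n}" for j
  proof -
    have m: "pinv \<pi> j \<in> {1..n}" using permutes_in_image[OF p] j by blast
    have "\<xi> (block ?\<mu> (pinv \<pi> j)) = \<chi> j"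
      using fun_cong[OF act\<pi>, of j] m by (simp add: act_def chi0_def)
    then show ?thesis using rank_\<xi>[OF \<xi> blk[OF m]] by simp
  qed
  have bmono: "block ?\<mu> m \<le> block ?\<mu> m'" if "m \<le> m'" "m' \<in> {1..n}" for m m'
  proof -
    have "m' \<le> (\<Sum>b = 1..d. ?\<mu> b)"
    proof -
      have "(\<Sum>b = 1..d. ?\<mu> b) = card (\<Union>b\<in>{1..d}. {k \<in> {1..n}. ?c k = b})"
        by (subst card_UN_disjoint') (auto simp: Comp_rank[OF \<xi> \<chi>] disjoint_family_on_def)
      also have "(\<Union>b\<in>{1..d}. {k \<in> {1..n}. ?c k = b}) = {1..n}" using rank(1)[OF \<xi> \<chi>] by auto
      finally show ?thesis using that by simp
    qed
    then show ?thesis using that by (intro block_mono)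
  qed
  \<comment> \<open>A descent of \<open>\<pi>\<close> inside a block would allow a shorter choice.\<close>
  have adj: "\<pi> m < \<pi> (Suc m)" if m: "1 \<le> m" "m < n" and eq: "block ?\<mu> m = block ?\<mu> (Suc m)" for m
  proof (rule ccontr)
    assume "\<not> \<pi> m < \<pi> (Suc m)"
    then have lt: "\<pi> (Suc m) < \<pi> m"
      using inj_eq[OF permutes_inj[OF \<pi>], of m "Suc m"] by simp
    let ?w = "\<pi> \<circ> st m"
    have w: "?w permutes {1..n}" by (rule permutes_compose[OF st_permutes[OF m] \<pi>])
    have wi: "pinv ?w = st m \<circ> pinv \<pi>"
    proof -
      have "pinv (st m) = st m" by (rule inv_unique_comp) (auto simp: fun_eq_iff)
      then show ?thesis using o_inv_distrib[OF permutes_bij[OF \<pi>] bij_st, of m] by simp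
    qed
    have "act ?w (chi0 \<xi> n ?\<mu>) = act \<pi> (chi0 \<xi> n ?\<mu>)"
    proof
      fix j
      have "chi0 \<xi> n ?\<mu> (st m x) = chi0 \<xi> n ?\<mu> x" for x
        using m eq by (auto simp: chi0_def st_apply)
      then show "act ?w (chi0 \<xi> n ?\<mu>) j = act \<pi> (chi0 \<xi> n ?\<mu>) j" by (simp add: act_def wi)
    qed
    then have "len n \<pi> \<le> len n ?w" using min[of ?w] w act\<pi> by simp
    moreover have "ninv n (pinv \<pi>) = Suc (ninv n (st m \<circ> pinv \<pi>))"
      using lt by (intro ninv_down p m) (simp add: inv_inv_eq[OF permutes_bij[OF \<pi>]])
    ultimately show False
      using len_eq_ninv[OF \<pi>] len_eq_ninv[OF w] ninv_pinv[OF \<pi>] ninv_pinv[OF w] wi by simp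
  qed
  have "pinv \<pi> = std n ?c"
  proof (rule std_unique[OF p])
    fix j k
    assume jk: "j \<in> {1..n}" "k \<in> {1..n}" and o: "?c j < ?c k \<or> ?c j = ?c k \<and> j < k"
    have P: "pinv \<pi> j \<in> {1..n}" "pinv \<pi> k \<in> {1..n}" using permutes_in_image[OF p] jk by blast+
    show "pinv \<pi> j < pinv \<pi> k"
    proof (rule ccontr)
      assume "\<not> pinv \<pi> j < pinv \<pi> k"
      then have le: "pinv \<pi> k \<le> pinv \<pi> j" by simp
      then have "?c k \<le> ?c j" using bmono[OF le P(1)] blp jk by simp
      then have eq: "?c j = ?c k" "j < k" using o by auto
      have "\<pi> (pinv \<pi> k) \<le> \<pi> (pinv \<pi> k + r)" if "pinv \<pi> k + r \<le> pinv \<pi> j" for r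
        using that
      proof (induct r)
        case (Suc r)
        let ?m = "pinv \<pi> k + r"
        have "block ?\<mu> (pinv \<pi> k) \<le> block ?\<mu> ?m" "block ?\<mu> ?m \<le> block ?\<mu> (Suc ?m)"
          "block ?\<mu> (Suc ?m) \<le> block ?\<mu> (pinv \<pi> j)"
          using P Suc.prems by (auto intro!: bmono)
        then have "block ?\<mu> ?m = block ?\<mu> (Suc ?m)" using blp jk eq by simp
        then have "\<pi> ?m < \<pi> (Suc ?m)" using P Suc.prems by (intro adj) auto
        then show ?case using Suc by simp
      qed simp
      from this[of "pinv \<pi> j - pinv \<pi> k"] have "k \<le> j"
        using le permutes_inverses(1)[OF \<pi>] by simp
      then show False using eq by simp
    qed
  qed
  with \<pi> show "pi_chi \<xi> d n \<chi> permutes {1..n}" "pinv (pi_chi \<xi> d n \<chi>) = std n ?c"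
    by (simp_all add: \<pi>_def)
qed

section \<open>Relations in the affine Yokonuma--Hecke algebra\<close>

lemma monoid_Y: "Group.monoid (Y d n)"
  by (rule Yr.monoid_axioms)

lemma gw_reduced_word:
  assumes w: "w permutes {1..n}" and r: "reduced_word n w is"
  shows "gw d n w = lprod (Y d n) (map (gY d n) is)"
  unfolding gw_def
proof (rule monoid.reduced_words_equal_products[OF monoid_Y _ _ _ _ r])
  show "reduced_word n w (SOME is. reduced_word n w is)" by (rule reduced_word_ex[OF w])
  show "gY d n i \<otimes>\<^bsub>Y d n\<^esub> gY d n j = gY d n j \<otimes>\<^bsub>Y d n\<^esub> gY d n i"
    if "1 \<le> i" "Suc i < j" "j < n" for i j
    using that by (intro gY_comm) auto
  show "gY d n i \<otimes>\<^bsub>Y d n\<^esub> gY d n (Suc i) \<otimes>\<^bsub>Y d n\<^esub> gY d n i =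
      gY d n (Suc i) \<otimes>\<^bsub>Y d n\<^esub> gY d n i \<otimes>\<^bsub>Y d n\<^esub> gY d n (Suc i)"
    if "1 \<le> i" "Suc i < n" for i
    by (rule gY_braid[OF that])
qed simp

lemma gw_closed:
  assumes "w permutes {1..n}"
  shows "gw d n w \<in> carrier (Y d n)"
proof -
  have "set (SOME is. reduced_word n w is) \<subseteq> {1..<n}"
    using reduced_word_ex[OF assms] unfolding reduced_word_def by blast
  then show ?thesis
    unfolding gw_def by (intro monoid.lprod_closed[OF monoid_Y]) auto
qed

lemma gw_id: "gw d n id = \<one>\<^bsub>Y d n\<^esub>"
proof -
  have "reduced_word n id []"
    using ninv_word_le[of "[]" n] by (simp add: reduced_word_iff permutes_id perm_of_simps)
  then show ?thesis using gw_reduced_word[OF permutes_id, of n "[]" d] by simp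
qed

lemma gw_st_comp:
  assumes w: "w permutes {1..n}" and i: "1 \<le> i" "i < n" and lt: "pinv w i < pinv w (Suc i)"
  shows "gw d n (st i \<circ> w) = gY d n i \<otimes>\<^bsub>Y d n\<^esub> gw d n w"
proof -
  define "is" where "is = (SOME is. reduced_word n w is)"
  have r: "reduced_word n w is" unfolding is_def by (rule reduced_word_ex[OF w])
  have sw: "st i \<circ> w permutes {1..n}" by (rule st_comp_permutes[OF w i])
  have "reduced_word n (st i \<circ> w) (i # is)"
    using r i ninv_up[OF w i lt] unfolding reduced_word_iff[OF w] reduced_word_iff[OF sw]
    by (auto simp: perm_of_simps)
  then show ?thesis
    using gw_reduced_word[OF sw, of "i # is" d] gw_reduced_word[OF w r, of d] by simp
qed

lemma gw_st:
  assumes i: "1 \<le> i" "i < n"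
  shows "gw d n (st i) = gY d n i"
  using gw_st_comp[OF permutes_id i, of d] i by (simp add: gw_id)

lemma (in Group.monoid) commute_mult:
  assumes "a \<in> carrier G" "b \<in> carrier G" "c \<in> carrier G" "a \<otimes> b = b \<otimes> a" "a \<otimes> c = c \<otimes> a"
  shows "a \<otimes> (b \<otimes> c) = b \<otimes> c \<otimes> a"
  by (metis assms m_assoc)

text \<open>Induction on \<open>j\<close> through \<open>X\<^sub>j = u\<^sup>-\<^sup>2 g\<^sub>j\<^sub>-\<^sub>1 X\<^sub>j\<^sub>-\<^sub>1 g\<^sub>j\<^sub>-\<^sub>1\<close>. The one case that does not follow factor by factor is
  \<open>j = i + 2\<close>: there \<open>g\<^sub>i\<close> is moved through \<open>g\<^sub>i\<^sub>+\<^sub>1 g\<^sub>i X\<^sub>i g\<^sub>i g\<^sub>i\<^sub>+\<^sub>1\<close> with the help of two braid relations.\<close>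

lemma gY_XY_comm:
  assumes "1 \<le> i" "i < n" "1 \<le> j" "j \<le> n" "i \<noteq> j" "Suc i \<noteq> j"
  shows "gY d n i \<otimes>\<^bsub>Y d n\<^esub> XY d n j = XY d n j \<otimes>\<^bsub>Y d n\<^esub> gY d n i"
  using assms
proof (induct j arbitrary: i rule: less_induct)
  case (less j)
  let ?Y = "Y d n"
  note comm = monoid.commute_mult[OF monoid_Y[of d n]]
  show ?case
  proof (cases "j = 1")
    case True
    then show ?thesis using XY1_gY_comm[of i n d] less.prems by simp
  next
    case False
    then obtain k where j: "j = Suc k" and k: "1 \<le> k" "k < n" using less.prems by (cases j) auto
    have c: "gY d n i \<in> carrier ?Y" "gY d n k \<in> carrier ?Y" "XY d n k \<in> carrier ?Y"
      using k less.prems by auto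
    have s: "gY d n i \<otimes>\<^bsub>?Y\<^esub> scal d n a = scal d n a \<otimes>\<^bsub>?Y\<^esub> gY d n i" for a
      using scal_commute[OF c(1)] by simp
    show ?thesis
    proof (cases "Suc i = k")
      case False
      have "gY d n i \<otimes>\<^bsub>?Y\<^esub> gY d n k = gY d n k \<otimes>\<^bsub>?Y\<^esub> gY d n i"
        using less.prems False j k by (intro gY_comm) auto
      moreover have "gY d n i \<otimes>\<^bsub>?Y\<^esub> XY d n k = XY d n k \<otimes>\<^bsub>?Y\<^esub> gY d n i"
        using less.prems False j k by (intro less.hyps) auto
      ultimately show ?thesis
        unfolding j XY_Suc[OF k] using c s by (intro comm) auto
    next
      case True
      have i: "1 \<le> i" "i < n" using less.prems by auto
      have ci: "XY d n i \<in> carrier ?Y" using i by auto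
      have ih: "gY d n k \<otimes>\<^bsub>?Y\<^esub> XY d n i = XY d n i \<otimes>\<^bsub>?Y\<^esub> gY d n k"
        using k i True j by (intro less.hyps) auto
      have br: "gY d n i \<otimes>\<^bsub>?Y\<^esub> (gY d n k \<otimes>\<^bsub>?Y\<^esub> gY d n i) =
          gY d n k \<otimes>\<^bsub>?Y\<^esub> (gY d n i \<otimes>\<^bsub>?Y\<^esub> gY d n k)"
        using gY_braid[of i n d] i k True c by (simp add: Yr.m_assoc)
      let ?P = "gY d n k \<otimes>\<^bsub>?Y\<^esub> gY d n i \<otimes>\<^bsub>?Y\<^esub> XY d n i \<otimes>\<^bsub>?Y\<^esub> gY d n i \<otimes>\<^bsub>?Y\<^esub> gY d n k"
      have "gY d n i \<otimes>\<^bsub>?Y\<^esub> ?P =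
          (gY d n i \<otimes>\<^bsub>?Y\<^esub> (gY d n k \<otimes>\<^bsub>?Y\<^esub> gY d n i)) \<otimes>\<^bsub>?Y\<^esub> XY d n i \<otimes>\<^bsub>?Y\<^esub> gY d n i \<otimes>\<^bsub>?Y\<^esub> gY d n k"
        using c ci by (simp add: Yr.m_assoc)
      also have "\<dots> = gY d n k \<otimes>\<^bsub>?Y\<^esub> gY d n i \<otimes>\<^bsub>?Y\<^esub> (gY d n k \<otimes>\<^bsub>?Y\<^esub> XY d n i) \<otimes>\<^bsub>?Y\<^esub> gY d n i \<otimes>\<^bsub>?Y\<^esub> gY d n k"
        unfolding br using c ci by (simp add: Yr.m_assoc)
      also have "\<dots> = gY d n k \<otimes>\<^bsub>?Y\<^esub> gY d n i \<otimes>\<^bsub>?Y\<^esub> XY d n i \<otimes>\<^bsub>?Y\<^esub> (gY d n k \<otimes>\<^bsub>?Y\<^esub> (gY d n i \<otimes>\<^bsub>?Y\<^esub> gY d n k))"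
        unfolding ih using c ci by (simp add: Yr.m_assoc)
      also have "\<dots> = ?P \<otimes>\<^bsub>?Y\<^esub> gY d n i"
        unfolding br[symmetric] using c ci by (simp add: Yr.m_assoc)
      finally have P: "gY d n i \<otimes>\<^bsub>?Y\<^esub> ?P = ?P \<otimes>\<^bsub>?Y\<^esub> gY d n i" .
      have "XY d n k = scal d n (upow (- 2)) \<otimes>\<^bsub>?Y\<^esub> gY d n i \<otimes>\<^bsub>?Y\<^esub> XY d n i \<otimes>\<^bsub>?Y\<^esub> gY d n i"
        using XY_Suc[OF i, of d] True by simp
      then have "XY d n j = scal d n (upow (- 2)) \<otimes>\<^bsub>?Y\<^esub> (scal d n (upow (- 2)) \<otimes>\<^bsub>?Y\<^esub> ?P)"
        unfolding j XY_Suc[OF k]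
        using c ci scal_commute[OF c(2), of "upow (- 2)"]
        by (simp add: Yr.m_assoc) (simp flip: Yr.m_assoc)
      moreover have "gY d n i \<otimes>\<^bsub>?Y\<^esub> (scal d n (upow (- 2)) \<otimes>\<^bsub>?Y\<^esub> ?P) = scal d n (upow (- 2)) \<otimes>\<^bsub>?Y\<^esub> ?P \<otimes>\<^bsub>?Y\<^esub> gY d n i"
        by (rule comm) (use c ci s P in simp_all)
      ultimately show ?thesis
        by (simp only:) (rule comm, use c ci s in simp_all)
    qed
  qed
qed

text \<open>For \<open>i < j - 1\<close> the factors of \<open>X\<^sub>j = u\<^sup>-\<^sup>2 g\<^sub>j\<^sub>-\<^sub>1 X\<^sub>j\<^sub>-\<^sub>1 g\<^sub>j\<^sub>-\<^sub>1\<close> commute with \<open>X\<^sub>i\<close>; for \<open>i = j - 1\<close> the element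
  \<open>X\<^sub>i\<close> is expanded instead, down to the defining relation for \<open>i = 1\<close>.\<close>

lemma XY_XY_comm:
  assumes "1 \<le> i" "i < j" "j \<le> n"
  shows "XY d n i \<otimes>\<^bsub>Y d n\<^esub> XY d n j = XY d n j \<otimes>\<^bsub>Y d n\<^esub> XY d n i"
  using assms
proof (induct j arbitrary: i rule: less_induct)
  case (less j)
  let ?Y = "Y d n"
  note comm = monoid.commute_mult[OF monoid_Y[of d n]]
  obtain k where j: "j = Suc k" and k: "1 \<le> k" "k < n" using less.prems by (cases j) auto
  have c: "gY d n k \<in> carrier ?Y" "XY d n k \<in> carrier ?Y"
    using k by auto
  have s: "XY d n i \<otimes>\<^bsub>?Y\<^esub> scal d n a = scal d n a \<otimes>\<^bsub>?Y\<^esub> XY d n i" if "1 \<le> i" "i \<le> n" for i a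
    using scal_commute[of "XY d n i" d n a] that by simp
  have low: "XY d n i \<otimes>\<^bsub>?Y\<^esub> XY d n j = XY d n j \<otimes>\<^bsub>?Y\<^esub> XY d n i" if i: "1 \<le> i" "i < k" for i
  proof -
    have "XY d n i \<otimes>\<^bsub>?Y\<^esub> XY d n k = XY d n k \<otimes>\<^bsub>?Y\<^esub> XY d n i"
      using i k j by (intro less.hyps) auto
    moreover have "XY d n i \<otimes>\<^bsub>?Y\<^esub> gY d n k = gY d n k \<otimes>\<^bsub>?Y\<^esub> XY d n i"
      using gY_XY_comm[of k n i d] i k by simp
    ultimately show ?thesis
      unfolding j XY_Suc[OF k] using c i k s by (intro comm) auto
  qed
  show ?case
  proof (cases "i < k")
    case True
    then show ?thesis using low less.prems by simp
  next
    case False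
    then have ik: "i = k" using less.prems j by simp
    show ?thesis
    proof (cases "k = 1")
      case True
      have P: "XY d n k \<otimes>\<^bsub>?Y\<^esub> (gY d n k \<otimes>\<^bsub>?Y\<^esub> XY d n k \<otimes>\<^bsub>?Y\<^esub> gY d n k) = gY d n k \<otimes>\<^bsub>?Y\<^esub> XY d n k \<otimes>\<^bsub>?Y\<^esub> gY d n k \<otimes>\<^bsub>?Y\<^esub> XY d n k"
        using XY_gY_braid[of n d] True k c by (simp add: Yr.m_assoc)
      have "XY d n j = scal d n (upow (- 2)) \<otimes>\<^bsub>?Y\<^esub> (gY d n k \<otimes>\<^bsub>?Y\<^esub> XY d n k \<otimes>\<^bsub>?Y\<^esub> gY d n k)"
        unfolding j XY_Suc[OF k] using c by (simp add: Yr.m_assoc)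
      then show ?thesis unfolding ik by (simp only:) (rule comm, use c s[of k] k P in simp_all)
    next
      case False
      then obtain m where m: "k = Suc m" "1 \<le> m" "m < n" using k by (cases k) auto
      have c: "gY d n m \<in> carrier ?Y" "XY d n m \<in> carrier ?Y" "XY d n j \<in> carrier ?Y"
        using m less.prems by auto
      have "XY d n j \<otimes>\<^bsub>?Y\<^esub> XY d n m = XY d n m \<otimes>\<^bsub>?Y\<^esub> XY d n j"
        using low[of m] m by simp
      moreover have "XY d n j \<otimes>\<^bsub>?Y\<^esub> gY d n m = gY d n m \<otimes>\<^bsub>?Y\<^esub> XY d n j"
        using gY_XY_comm[of m n j d] m j less.prems by simp
      ultimately have "XY d n j \<otimes>\<^bsub>?Y\<^esub> XY d n k = XY d n k \<otimes>\<^bsub>?Y\<^esub> XY d n j"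
        unfolding m(1) XY_Suc[OF m(2,3)] using c s[of j] less.prems by (intro comm) auto
      then show ?thesis unfolding ik by simp
    qed
  qed
qed

lemma XY_comm:
  assumes "1 \<le> i" "i \<le> n" "1 \<le> j" "j \<le> n"
  shows "XY d n i \<otimes>\<^bsub>Y d n\<^esub> XY d n j = XY d n j \<otimes>\<^bsub>Y d n\<^esub> XY d n i"
  using XY_XY_comm[of i j n d] XY_XY_comm[of j i n d] assms by (cases i j rule: linorder_cases) auto

subsection \<open>The elements \<open>e\<^sub>i\<close> and invertibility\<close>

lemma cls_mult_cong:
  assumes "f \<in> carrier (free_alg n)" "f' \<in> carrier (free_alg n)" "h \<in> carrier (free_alg n)"
    "h' \<in> carrier (free_alg n)" "cls d n f = cls d n f'" "cls d n h = cls d n h'"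
  shows "cls d n (f * h) = cls d n (f' * h')"
  using assms by (simp add: cls_mult)

lemma cls_sum_cong:
  assumes "\<And>x. x \<in> A \<Longrightarrow> f x \<in> carrier (free_alg n)" "\<And>x. x \<in> A \<Longrightarrow> h x \<in> carrier (free_alg n)"
    "\<And>x. x \<in> A \<Longrightarrow> cls d n (f x) = cls d n (h x)"
  shows "cls d n (sum f A) = cls d n (sum h A)"
  using assms by (induct A rule: infinite_finite_induct) (auto simp: cls_add)

lemma cls_t_pow: "\<lbrakk>1 \<le> j; j \<le> n\<rbrakk> \<Longrightarrow> cls d n (fvar (Tt j) ^ d) = \<one>\<^bsub>Y d n\<^esub>"
  using tY_pow[of j n d] by (simp add: tY_def cls_power)

lemma cls_t_power_comm:
  assumes "1 \<le> i" "i \<le> n" "1 \<le> j" "j \<le> n"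
  shows "cls d n (fvar (Tt i) ^ a * fvar (Tt j) ^ b) = cls d n (fvar (Tt j) ^ b * fvar (Tt i) ^ a)"
proof -
  have "tY d n i [^]\<^bsub>Y d n\<^esub> a \<otimes>\<^bsub>Y d n\<^esub> tY d n j [^]\<^bsub>Y d n\<^esub> b = tY d n j [^]\<^bsub>Y d n\<^esub> b \<otimes>\<^bsub>Y d n\<^esub> tY d n i [^]\<^bsub>Y d n\<^esub> a"
  proof -
    have 1: "tY d n i [^]\<^bsub>Y d n\<^esub> a \<otimes>\<^bsub>Y d n\<^esub> tY d n j = tY d n j \<otimes>\<^bsub>Y d n\<^esub> tY d n i [^]\<^bsub>Y d n\<^esub> a"
      by (rule Yr.group_commutes_pow) (use assms tY_comm[of i n j d] in auto)
    show ?thesis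
      by (rule Yr.group_commutes_pow[symmetric]) (use assms 1 in auto)
  qed
  then show ?thesis using assms by (simp add: cls_mult cls_power tY_def)
qed

text \<open>Multiplication by \<open>t\<^sub>i t\<^sub>i\<^sub>+\<^sub>1\<^sup>-\<^sup>1\<close> permutes the terms of \<open>e\<^sub>i\<close> cyclically.\<close>

lemma eY_absorb:
  assumes d: "1 \<le> d" and i: "1 \<le> i" "i < n"
  shows "tY d n i \<otimes>\<^bsub>Y d n\<^esub> eY d n i = tY d n (Suc i) \<otimes>\<^bsub>Y d n\<^esub> eY d n i"
proof -
  let ?a = "fvar (Tt i)" and ?b = "fvar (Tt (Suc i))"
  let ?c = "fscal (cconst (1 / of_nat d))"
  define F where "F s = ?a ^ s * ?b ^ (Suc d - s)" for s
  have F: "F s \<in> carrier (free_alg n)" for s using i by (simp add: F_def)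
  have "(\<Sum>s = 1..m. F (Suc s)) + F 1 = (\<Sum>s = 1..m. F s) + F (Suc m)" for m
    by (induct m) (simp_all add: ac_simps One_nat_def)
  note sum = this[of d]
  have "cls d n (F 1) = cls d n (F (Suc d))"
    using i d by (simp add: F_def cls_mult cls_t_pow One_nat_def)
  then have eq: "cls d n (\<Sum>s = 1..d. F (Suc s)) = cls d n (\<Sum>s = 1..d. F s)"
    using arg_cong[OF sum, of "cls d n"] F i
    by (simp add: cls_add)
  have "cls d n (?b * (?a ^ s * ?b ^ (d - s))) = cls d n (F s)" if "s \<in> {1..d}" for s
  proof -
    have "cls d n (?b * (?a ^ s * ?b ^ (d - s))) = cls d n ((?b ^ 1 * ?a ^ s) * ?b ^ (d - s))"
      by (simp add: mult.assoc)
    also have "\<dots> = cls d n ((?a ^ s * ?b ^ 1) * ?b ^ (d - s))"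
      using i by (intro cls_mult_cong cls_t_power_comm) auto
    also have "(?a ^ s * ?b ^ 1) * ?b ^ (d - s) = F s"
      using that by (simp add: F_def mult.assoc Suc_diff_le)
    finally show ?thesis .
  qed
  then have "cls d n (\<Sum>s = 1..d. ?b * (?a ^ s * ?b ^ (d - s))) = cls d n (\<Sum>s = 1..d. F s)"
    using F i by (intro cls_sum_cong) auto
  then have b: "cls d n (?c * (?b * (\<Sum>s = 1..d. ?a ^ s * ?b ^ (d - s)))) = cls d n (?c * (\<Sum>s = 1..d. F s))"
    using F i by - (rule cls_mult_cong; simp add: sum_distrib_left)
  have "?a * (\<Sum>s = 1..d. ?a ^ s * ?b ^ (d - s)) = (\<Sum>s = 1..d. F (Suc s))"
    by (simp add: F_def sum_distrib_left mult.assoc)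
  then have a: "cls d n (?c * (?a * (\<Sum>s = 1..d. ?a ^ s * ?b ^ (d - s)))) = cls d n (?c * (\<Sum>s = 1..d. F s))"
    using F i eq by - (rule cls_mult_cong; simp)
  have "tY d n k \<otimes>\<^bsub>Y d n\<^esub> eY d n i = cls d n (?c * (fvar (Tt k) * (\<Sum>s = 1..d. ?a ^ s * ?b ^ (d - s))))"
    if "k = i \<or> k = Suc i" for k
  proof -
    have "fvar (Tt k) * e_elt d i = ?c * (fvar (Tt k) * (\<Sum>s = 1..d. ?a ^ s * ?b ^ (d - s)))"
      by (simp only: e_elt_def mult.assoc[symmetric] fscal_commute[of _ "fvar (Tt k)"] Suc_eq_plus1)
    moreover have "1 \<le> k" "k \<le> n" using i that by auto
    ultimately show ?thesis using i by (simp add: tY_def eY_def flip: cls_mult)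
  qed
  then show ?thesis using a b by simp
qed

lemma eY_idem:
  assumes d: "1 \<le> d" and i: "1 \<le> i" "i < n"
  shows "eY d n i \<otimes>\<^bsub>Y d n\<^esub> eY d n i = eY d n i"
proof -
  let ?a = "fvar (Tt i)" and ?b = "fvar (Tt (Suc i))" and ?e = "e_elt d i"
  let ?c = "cconst (1 / of_nat d)"
  have absorb: "cls d n (?a ^ s * ?b ^ m * ?e) = cls d n (?b ^ (m + s) * ?e)" for s m
  proof (induct s arbitrary: m)
    case (Suc s)
    have "cls d n (?a ^ Suc s * ?b ^ m * ?e) = cls d n (?a ^ s * (?a ^ 1 * ?b ^ m) * ?e)"
      by (simp add: mult.assoc power_Suc2 del: power_Suc)
    also have "\<dots> = cls d n (?a ^ s * (?b ^ m * ?a ^ 1) * ?e)"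
      using i by (intro cls_mult_cong cls_t_power_comm refl) auto
    also have "\<dots> = cls d n (?a ^ s * ?b ^ m * (?a * ?e))"
      by (simp add: mult.assoc)
    also have "\<dots> = cls d n (?a ^ s * ?b ^ m * (?b * ?e))"
      using i eY_absorb[OF d i] by - (rule cls_mult_cong; simp add: tY_def eY_def flip: cls_mult)
    also have "\<dots> = cls d n (?a ^ s * ?b ^ Suc m * ?e)"
      by (simp add: mult.assoc power_Suc2 del: power_Suc)
    finally show ?case using Suc[of "Suc m"] by simp
  qed simp
  have "cls d n (?a ^ s * ?b ^ (d - s) * ?e) = cls d n ?e" if "s \<in> {1..d}" for s
    using absorb[of s "d - s"] that i by (simp add: cls_mult cls_t_pow)
  then have "cls d n (\<Sum>s = 1..d. ?a ^ s * ?b ^ (d - s) * ?e) = cls d n (\<Sum>s = 1..d. ?e)"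
    using i by (intro cls_sum_cong) auto
  then have "cls d n (fscal ?c * (\<Sum>s = 1..d. ?a ^ s * ?b ^ (d - s) * ?e)) =
      cls d n (fscal ?c * (\<Sum>s = 1..d. ?e))"
    using i by - (rule cls_mult_cong; simp)
  moreover have "?e * ?e = fscal ?c * (\<Sum>s = 1..d. ?a ^ s * ?b ^ (d - s) * ?e)"
    by (subst (1) e_elt_def) (simp add: sum_distrib_right mult.assoc One_nat_def)
  moreover have "fscal ?c * (\<Sum>s = 1..d. ?e) = ?e"
  proof -
    have "(of_nat d :: falg) = fscal (cconst (of_nat d))"
      by (induct d) (simp_all add: fscal_add cconst_add)
    then have "fscal ?c * (\<Sum>s = 1..d. ?e) = fscal (?c * cconst (of_nat d)) * ?e"
      by (simp add: fscal_mult mult.assoc)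
    also have "?c * cconst (of_nat d) = 1" using d by (simp flip: cconst_mult)
    finally show ?thesis by simp
  qed
  ultimately show ?thesis using i by (simp add: eY_def flip: cls_mult)
qed

lemma gY_eY_comm:
  assumes d: "1 \<le> d" and i: "1 \<le> i" "i < n"
  shows "gY d n i \<otimes>\<^bsub>Y d n\<^esub> eY d n i = eY d n i \<otimes>\<^bsub>Y d n\<^esub> gY d n i"
proof -
  let ?a = "fvar (Tt i)" and ?b = "fvar (Tt (Suc i))" and ?g = "fvar (Gg i)"
  let ?c = "fscal (cconst (1 / of_nat d))"
  have ga: "cls d n (?g * ?a ^ s) = cls d n (?b ^ s * ?g)" for s
  proof (induct s)
    case (Suc s)
    have "cls d n (?g * ?a ^ Suc s) = cls d n (?g * ?a ^ s * ?a)"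
      by (simp add: mult.assoc power_Suc2 del: power_Suc)
    also have "\<dots> = cls d n (?b ^ s * ?g * ?a)" using Suc i by - (rule cls_mult_cong; simp)
    also have "\<dots> = cls d n (?b ^ s * (?g * ?a))" by (simp add: mult.assoc)
    also have "\<dots> = cls d n (?b ^ s * (?b * ?g))"
      using gY_tY[of i n i d] i
      by - (rule cls_mult_cong; simp add: gY_def tY_def One_nat_def flip: cls_mult)
    finally show ?case by (simp add: mult.assoc power_Suc2 del: power_Suc)
  qed simp
  have gb: "cls d n (?g * ?b ^ s) = cls d n (?a ^ s * ?g)" for s
  proof (induct s)
    case (Suc s)
    have "cls d n (?g * ?b ^ Suc s) = cls d n (?g * ?b ^ s * ?b)"
      by (simp add: mult.assoc power_Suc2 del: power_Suc)
    also have "\<dots> = cls d n (?a ^ s * ?g * ?b)" using Suc i by - (rule cls_mult_cong; simp)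
    also have "\<dots> = cls d n (?a ^ s * (?g * ?b))" by (simp add: mult.assoc)
    also have "\<dots> = cls d n (?a ^ s * (?a * ?g))"
      using gY_tY[of i n "Suc i" d] i
      by - (rule cls_mult_cong; simp add: gY_def tY_def One_nat_def flip: cls_mult)
    finally show ?case by (simp add: mult.assoc power_Suc2 del: power_Suc)
  qed simp
  define S where "S = (\<Sum>s = 1..d. ?a ^ s * ?b ^ (d - s))"
  have S: "S \<in> carrier (free_alg n)" using i by (simp add: S_def)
  have "cls d n (\<Sum>s = 1..d. ?g * (?a ^ s * ?b ^ (d - s))) = cls d n (\<Sum>s = 1..d. ?b ^ s * ?a ^ (d - s) * ?g)"
  proof (rule cls_sum_cong)
    fix s
    have "cls d n (?g * (?a ^ s * ?b ^ (d - s))) = cls d n (?g * ?a ^ s * ?b ^ (d - s))"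
      by (simp add: mult.assoc)
    also have "\<dots> = cls d n (?b ^ s * ?g * ?b ^ (d - s))"
      using ga i by - (rule cls_mult_cong; simp)
    also have "\<dots> = cls d n (?b ^ s * (?g * ?b ^ (d - s)))" by (simp add: mult.assoc)
    also have "\<dots> = cls d n (?b ^ s * (?a ^ (d - s) * ?g))"
      using gb i by - (rule cls_mult_cong; simp)
    finally show "cls d n (?g * (?a ^ s * ?b ^ (d - s))) = cls d n (?b ^ s * ?a ^ (d - s) * ?g)"
      by (simp add: mult.assoc)
  qed (use i in auto)
  moreover have "cls d n (\<Sum>s = 1..d. ?b ^ s * ?a ^ (d - s)) = cls d n S"
  proof -
    have sp: "(\<Sum>s = 1..d. H s) = (\<Sum>s = 1..<d. H s) + H d" for H :: "nat \<Rightarrow> falg"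
      using d by (cases d) (auto simp: atLeastLessThanSuc_atLeastAtMost)
    have "(\<Sum>s = 1..<d. ?b ^ s * ?a ^ (d - s)) = (\<Sum>s = 1..<d. ?b ^ (d - s) * ?a ^ s)"
      by (rule sum.reindex_bij_witness[of _ "\<lambda>s. d - s" "\<lambda>s. d - s"]) auto
    moreover have "cls d n (\<Sum>s = 1..<d. ?b ^ (d - s) * ?a ^ s) = cls d n (\<Sum>s = 1..<d. ?a ^ s * ?b ^ (d - s))"
      using i by (intro cls_sum_cong cls_t_power_comm) auto
    ultimately show ?thesis
      unfolding S_def sp using i by (simp add: cls_add cls_t_pow)
  qed
  ultimately have *: "cls d n (?g * S) = cls d n (S * ?g)"
    using i S by (simp add: S_def sum_distrib_left cls_mult flip: sum_distrib_right)
  have e: "e_elt d i = ?c * S" by (simp add: One_nat_def e_elt_def S_def)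
  have "cls d n (?g * e_elt d i) = cls d n (?c * (?g * S))"
    unfolding e by (simp only: mult.assoc[symmetric] fscal_commute[of _ ?g])
  also have "\<dots> = cls d n (?c * (S * ?g))" using * i S by - (rule cls_mult_cong; simp)
  also have "\<dots> = cls d n (e_elt d i * ?g)" unfolding e by (simp add: mult.assoc)
  finally show ?thesis using i by (simp add: gY_def eY_def flip: cls_mult)
qed

lemma scal_Unit:
  assumes "a * b = 1"
  shows "scal d n a \<in> Units (Y d n)"
proof -
  have "scal d n a \<otimes>\<^bsub>Y d n\<^esub> scal d n b = \<one>\<^bsub>Y d n\<^esub>" "scal d n b \<otimes>\<^bsub>Y d n\<^esub> scal d n a = \<one>\<^bsub>Y d n\<^esub>"
    using assms by (simp_all flip: scal_mult add: mult.commute)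
  then show ?thesis unfolding Units_def by auto
qed

lemma upow_inverse: "upow a * upow (- a) = 1" "upow (- a) * upow a = 1"
  by (simp_all flip: upow_add)

lemma gampow_inverse: "gampow a * gampow (- a) = 1"
  by (simp flip: gampow_add)

text \<open>The quadratic relation reads \<open>g\<^sub>i (g\<^sub>i - v e\<^sub>i) = u\<^sup>2\<close> since \<open>g\<^sub>i\<close> and \<open>e\<^sub>i\<close> commute.\<close>

lemma gY_Unit:
  assumes d: "1 \<le> d" and i: "1 \<le> i" "i < n"
  shows "gY d n i \<in> Units (Y d n)"
proof -
  let ?g = "gY d n i" and ?e = "eY d n i" and ?v = "scal d n (vpow 1)" and ?Y = "Y d n"
  have c: "?g \<in> carrier ?Y" "?e \<in> carrier ?Y" "?v \<in> carrier ?Y" using i by auto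
  have ge: "?g \<otimes>\<^bsub>?Y\<^esub> (?v \<otimes>\<^bsub>?Y\<^esub> ?e) = ?v \<otimes>\<^bsub>?Y\<^esub> ?e \<otimes>\<^bsub>?Y\<^esub> ?g"
    using monoid.commute_mult[OF monoid_Y c(1,3,2)] scal_commute[OF c(1)] gY_eY_comm[OF d i] by simp
  let ?h = "?g \<ominus>\<^bsub>?Y\<^esub> ?v \<otimes>\<^bsub>?Y\<^esub> ?e"
  have "?g \<otimes>\<^bsub>?Y\<^esub> ?h = scal d n (upow 2)" "?h \<otimes>\<^bsub>?Y\<^esub> ?g = scal d n (upow 2)"
    using c gY_quad[OF i, of d] ge
    by (simp_all add: a_minus_def Yr.r_distr Yr.l_distr Yr.r_minus Yr.l_minus Yr.a_assoc Yr.r_neg)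
  moreover have "?h \<in> carrier ?Y" using c by simp
  moreover have k: "scal d n (upow (-2)) \<otimes>\<^bsub>?Y\<^esub> scal d n (upow 2) = \<one>\<^bsub>?Y\<^esub>"
    by (simp add: upow_inverse flip: scal_mult)
  ultimately have "?g \<otimes>\<^bsub>?Y\<^esub> (scal d n (upow (-2)) \<otimes>\<^bsub>?Y\<^esub> ?h) = \<one>\<^bsub>?Y\<^esub>"
    "(scal d n (upow (-2)) \<otimes>\<^bsub>?Y\<^esub> ?h) \<otimes>\<^bsub>?Y\<^esub> ?g = \<one>\<^bsub>?Y\<^esub>"
    "scal d n (upow (-2)) \<otimes>\<^bsub>?Y\<^esub> ?h \<in> carrier ?Y"
    using c scal_commute[OF c(1), of "upow (-2)"]
    by (simp_all add: Yr.m_assoc) (metis Yr.m_assoc \<open>?h \<in> carrier ?Y\<close> scal_closed)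
  then show ?thesis unfolding Units_def using c by blast
qed

lemma XY_Unit:
  assumes d: "1 \<le> d"
  shows "1 \<le> j \<Longrightarrow> j \<le> n \<Longrightarrow> XY d n j \<in> Units (Y d n)"
proof (induct j)
  case (Suc j)
  show ?case
  proof (cases "j = 0")
    case True
    then show ?thesis using XY1_Unit[of d n] by (simp add: One_nat_def)
  next
    case False
    then have j: "1 \<le> j" "j < n" using Suc.prems by auto
    have "scal d n (upow (-2)) \<in> Units (Y d n)" by (rule scal_Unit[OF upow_inverse(2)])
    then show ?thesis
      unfolding XY_Suc[OF j] using Suc.hyps j gY_Unit[OF d j] by (intro Yr.Units_m_closed) auto
  qed
qed simp

text \<open>As \<open>e\<^sub>i\<close> is an idempotent, \<open>\<gamma> + (1 - \<gamma>) e\<^sub>i\<close> has the inverse \<open>\<gamma>\<^sup>-\<^sup>1 + (1 - \<gamma>\<^sup>-\<^sup>1) e\<^sub>i\<close>.\<close>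

lemma delta_gen_Unit:
  assumes d: "1 \<le> d" and i: "i < n"
  shows "delta_gen d n i \<in> Units (Y d n)"
proof (cases "i = 0")
  case True
  then show ?thesis using XY1_Unit[of d n] by (simp add: delta_gen_def XY_1)
next
  case False
  then have i: "1 \<le> i" "i < n" using i by auto
  let ?e = "e_elt d i"
  let ?G = "gampow 1" and ?H = "gampow (- 1)"
  let ?x = "fscal ?G + fscal (1 - ?G) * ?e" and ?y = "fscal ?H + fscal (1 - ?H) * ?e"
  have GH: "fscal ?G * fscal ?H = 1" "fscal ?H * fscal ?G = 1"
    using gampow_inverse[of 1] by (simp_all flip: fscal_mult add: mult.commute)
  have key: "cls d n ((fscal a + fscal (1 - a) * ?e) * (fscal b + fscal (1 - b) * ?e)) = \<one>\<^bsub>Y d n\<^esub>"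
    if ab: "a * b = 1" for a b
  proof -
    have c: "?e * fscal x = fscal x * ?e" "?e * (fscal x * y) = fscal x * (?e * y)" for x y
      by (simp_all only: fscal_commute[of x ?e] flip: mult.assoc)
    define K where "K = (1 - a) * (1 - b)"
    have "a * (1 - b) + (1 - a) * b = - K" using ab by (simp add: K_def algebra_simps)
    then have k: "fscal (a * (1 - b)) + fscal ((1 - a) * b) = - fscal K"
      by (simp only: flip: fscal_add fscal_uminus)
    have "(fscal a + fscal (1 - a) * ?e) * (fscal b + fscal (1 - b) * ?e) = fscal (a * b) +
        (fscal (a * (1 - b)) + fscal ((1 - a) * b)) * ?e + fscal K * (?e * ?e)"
      by (simp only: K_def distrib_left distrib_right fscal_mult c mult.assoc add.assoc add.commute add.left_commute)
    also have "\<dots> = 1 + fscal K * (?e * ?e - ?e)"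
      unfolding k ab by (simp add: algebra_simps)
    finally have "cls d n ((fscal a + fscal (1 - a) * ?e) * (fscal b + fscal (1 - b) * ?e)) =
       cls d n (1 + fscal K * (?e * ?e - ?e))" by (rule arg_cong)
    also have "\<dots> = \<one>\<^bsub>Y d n\<^esub>"
    proof -
      have "cls d n (?e * ?e - ?e) = \<zero>\<^bsub>Y d n\<^esub>"
        using eY_idem[OF d i] i by (simp add: cls_diff eY_def cls_mult)
      then show ?thesis using i by (simp add: cls_add cls_mult)
    qed
    finally show ?thesis .
  qed
  have "cls d n ?x \<in> Units (Y d n)"
  proof -
    have "cls d n ?x \<otimes>\<^bsub>Y d n\<^esub> cls d n ?y = \<one>\<^bsub>Y d n\<^esub>" "cls d n ?y \<otimes>\<^bsub>Y d n\<^esub> cls d n ?x = \<one>\<^bsub>Y d n\<^esub>"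
      using key[of ?G ?H] key[of ?H ?G] gampow_inverse[of 1] i by (simp_all flip: cls_mult add: mult.commute)
    moreover have "cls d n ?x \<in> carrier (Y d n)" "cls d n ?y \<in> carrier (Y d n)" using i by auto
    ultimately show ?thesis unfolding Units_def by blast
  qed
  moreover have "delta_gen d n i = cls d n ?x \<otimes>\<^bsub>Y d n\<^esub> gY d n i"
    using i by (simp add: delta_gen_def gY_def cls_mult)
  ultimately show ?thesis using gY_Unit[OF d i] by simp
qed

section \<open>Monomial matrices over the free algebra\<close>

lemma eY_1: "\<lbrakk>1 \<le> i; i < n\<rbrakk> \<Longrightarrow> eY 1 n i = \<one>\<^bsub>Y 1 n\<^esub>"
  using cls_t_pow[of i n 1] by (simp add: eY_def e_elt_def)

text \<open>Up to the factor \<open>u\<^sup>2\<close>, this says that \<open>X\<^sub>a\<close> and \<open>X\<^sub>a\<^sub>+\<^sub>1\<close> commute.\<close>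

lemma XY_gY_braid_general:
  assumes "1 \<le> a" "a < n"
  shows "XY d n a \<otimes>\<^bsub>Y d n\<^esub> (gY d n a \<otimes>\<^bsub>Y d n\<^esub> (XY d n a \<otimes>\<^bsub>Y d n\<^esub> gY d n a)) =
    gY d n a \<otimes>\<^bsub>Y d n\<^esub> (XY d n a \<otimes>\<^bsub>Y d n\<^esub> (gY d n a \<otimes>\<^bsub>Y d n\<^esub> XY d n a))"
proof -
  let ?Y = "Y d n" and ?s = "scal d n (upow (- 2))"
  let ?P = "gY d n a \<otimes>\<^bsub>?Y\<^esub> XY d n a \<otimes>\<^bsub>?Y\<^esub> gY d n a"
  have c: "gY d n a \<in> carrier ?Y" "XY d n a \<in> carrier ?Y" using assms by auto
  have X: "XY d n (Suc a) = ?s \<otimes>\<^bsub>?Y\<^esub> ?P"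
    using XY_Suc[OF assms, of d] c by (simp add: Yr.m_assoc)
  have "XY d n a \<otimes>\<^bsub>?Y\<^esub> (?s \<otimes>\<^bsub>?Y\<^esub> ?P) = ?s \<otimes>\<^bsub>?Y\<^esub> ?P \<otimes>\<^bsub>?Y\<^esub> XY d n a"
    using XY_comm[of a n "Suc a" d] assms X by simp
  moreover have "XY d n a \<otimes>\<^bsub>?Y\<^esub> (?s \<otimes>\<^bsub>?Y\<^esub> ?P) = ?s \<otimes>\<^bsub>?Y\<^esub> (XY d n a \<otimes>\<^bsub>?Y\<^esub> ?P)"
    using c scal_commute[of "XY d n a" d n "upow (- 2)"] by (simp flip: Yr.m_assoc)
  ultimately have "?s \<otimes>\<^bsub>?Y\<^esub> (XY d n a \<otimes>\<^bsub>?Y\<^esub> ?P) = ?s \<otimes>\<^bsub>?Y\<^esub> (?P \<otimes>\<^bsub>?Y\<^esub> XY d n a)"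
    using c by (simp add: Yr.m_assoc)
  then have "XY d n a \<otimes>\<^bsub>?Y\<^esub> ?P = ?P \<otimes>\<^bsub>?Y\<^esub> XY d n a"
    using scal_Unit[OF upow_inverse(2)[of 2], of d n] c by (simp add: Yr.Units_l_cancel)
  then show ?thesis using c by (simp add: Yr.m_assoc)
qed

text \<open>In the matrix of a letter, the row of \<open>\<chi>\<close> has one entry that may differ from zero. Its column is given here,
  its value by \<open>lval\<close> below.\<close>

definition lcol :: "gen \<Rightarrow> chr \<Rightarrow> chr" where
  "lcol a \<chi> = (case a of Gg i \<Rightarrow> \<chi> \<circ> st i | _ \<Rightarrow> \<chi>)"

lemma lcol_simps [simp]: "lcol (Gg i) \<chi> = \<chi> \<circ> st i" "lcol Xp \<chi> = \<chi>" "lcol Xm \<chi> = \<chi>" "lcol (Tt j) \<chi> = \<chi>"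
  by (simp_all add: lcol_def)

fun wcol :: "gen list \<Rightarrow> chr \<Rightarrow> chr" where
  "wcol [] \<chi> = \<chi>"
| "wcol (a # w) \<chi> = wcol w (lcol a \<chi>)"

lemma wcol_append: "wcol (v @ w) \<chi> = wcol w (wcol v \<chi>)"
  by (induct v arbitrary: \<chi>) auto

lemma finite_Irr: "1 \<le> d \<Longrightarrow> finite (Irr d n)"
  unfolding Irr_def by (intro finite_PiE) (auto intro: finite_roots_unity)

text \<open>The matrices have entries in the free algebra that presents the affine Hecke algebra. The free algebra on the
  letters has a homomorphism to such matrices for any choice of the images of the letters, and the relations of the
  affine Hecke algebra enter only when the entries are passed to the quotient.\<close>

locale numbered_roots =
  fixes \<xi> :: "nat \<Rightarrow> complex" and d n :: nat
  assumes d: "1 \<le> d" and n: "1 \<le> n" and \<xi>: "roots_enum d \<xi>"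
begin

text \<open>The permutation \<open>\<pi>\<^sub>\<chi>\<^sup>-\<^sup>1\<close>, by \<open>pi_chi_std\<close>.\<close>

definition pos :: "chr \<Rightarrow> nat \<Rightarrow> nat" where
  "pos \<chi> = std n (rank \<xi> d \<circ> \<chi>)"

text \<open>For \<open>Xm\<close> any representative of the inverse of the value for \<open>Xp\<close> will do.\<close>

definition lval :: "gen \<Rightarrow> chr \<Rightarrow> falg" where
  "lval a \<chi> = (case a of
     Gg i \<Rightarrow> if \<chi> i = \<chi> (Suc i) then fvar (Gg (pos \<chi> i)) else fscal (upow 1)
   | Xp \<Rightarrow> X_elt (pos \<chi> 1)
   | Xm \<Rightarrow> (SOME f. f \<in> carrier (free_alg n) \<and> cls 1 n f = inv\<^bsub>Y 1 n\<^esub> (XY 1 n (pos \<chi> 1)))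
   | Tt j \<Rightarrow> fscal (cconst (\<chi> j)))"

fun wval :: "gen list \<Rightarrow> chr \<Rightarrow> falg" where
  "wval [] \<chi> = 1"
| "wval (a # w) \<chi> = lval a \<chi> * wval w (lcol a \<chi>)"

text \<open>The linear extension of the multiplicative extension to words.\<close>

definition Phi :: "falg \<Rightarrow> chr \<Rightarrow> chr \<Rightarrow> falg" where
  "Phi f \<chi> \<chi>' = (\<Sum>w\<in>Poly_Mapping.keys f.
     fscal (Poly_Mapping.lookup f w) * (if wcol w \<chi> = \<chi>' then wval w \<chi> else 0))"

lemma pos_permutes: "pos \<chi> permutes {1..n}"
  unfolding pos_def by (rule std_permutes)

lemma pos_range: "1 \<le> j \<Longrightarrow> j \<le> n \<Longrightarrow> 1 \<le> pos \<chi> j \<and> pos \<chi> j \<le> n"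
  unfolding pos_def using std_range[of j n] by auto

lemma pos_inj [simp]: "pos \<chi> j = pos \<chi> k \<longleftrightarrow> j = k"
  by (rule inj_eq[OF permutes_inj[OF pos_permutes]])

lemma rank_eq_iff:
  assumes "\<chi> \<in> Irr d n" "j \<in> {1..n}" "k \<in> {1..n}"
  shows "rank \<xi> d (\<chi> j) = rank \<xi> d (\<chi> k) \<longleftrightarrow> \<chi> j = \<chi> k"
  using rank(2)[OF \<xi> assms(1)] assms(2,3) by metis

lemma pos_Suc:
  assumes "\<chi> i = \<chi> (Suc i)" "1 \<le> i" "i < n"
  shows "pos \<chi> (Suc i) = Suc (pos \<chi> i)" "pos \<chi> i < n"
proof -
  show e: "pos \<chi> (Suc i) = Suc (pos \<chi> i)"
    unfolding pos_def using assms by (intro std_Suc) auto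
  show "pos \<chi> i < n" using pos_range[of "Suc i" \<chi>] assms e by simp
qed

lemma pos_st:
  assumes "\<chi> \<in> Irr d n" "\<chi> i \<noteq> \<chi> (Suc i)" "1 \<le> i" "i < n"
  shows "pos (\<chi> \<circ> st i) = pos \<chi> \<circ> st i"
  using std_st_neq[of i n "rank \<xi> d \<circ> \<chi>"] rank_eq_iff[of \<chi> i "Suc i"] assms
  by (simp add: pos_def comp_assoc)

lemma pos_st_conj:
  assumes "\<chi> i = \<chi> (Suc i)" "1 \<le> i" "i < n"
  shows "pos \<chi> \<circ> st i = st (pos \<chi> i) \<circ> pos \<chi>"
  using std_st_eq[of i n "rank \<xi> d \<circ> \<chi>"] assms by (simp add: pos_def)

lemma comp_st_fixed: "\<chi> i = \<chi> (Suc i) \<Longrightarrow> \<chi> \<circ> st i = \<chi>"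
  by (auto simp: fun_eq_iff st_apply)

lemma Irr_st:
  assumes "\<chi> \<in> Irr d n" "1 \<le> i" "i < n"
  shows "\<chi> \<circ> st i \<in> Irr d n"
  using assms by (auto simp: Irr_def PiE_iff extensional_def st_apply)

lemma Irr_lcol: "\<chi> \<in> Irr d n \<Longrightarrow> a \<in> gens n \<Longrightarrow> lcol a \<chi> \<in> Irr d n"
  by (cases a) (auto intro: Irr_st)

lemma Irr_wcol: "\<chi> \<in> Irr d n \<Longrightarrow> w \<in> lists (gens n) \<Longrightarrow> wcol w \<chi> \<in> Irr d n"
  by (induct w arbitrary: \<chi>) (auto simp: Irr_lcol)

lemma Comp_st:
  assumes "1 \<le> i" "i < n"
  shows "Comp \<xi> d n (\<chi> \<circ> st i) = Comp \<xi> d n \<chi>"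
proof -
  have "card {j \<in> {1..n}. \<chi> (st i j) = z} = card {j \<in> {1..n}. \<chi> j = z}" for z
  proof (rule bij_betw_same_card[of "st i"])
    show "bij_betw (st i) {j \<in> {1..n}. \<chi> (st i j) = z} {j \<in> {1..n}. \<chi> j = z}"
      by (rule bij_betw_byWitness[where f' = "st i"])
        (simp_all only: st_st image_subset_iff ball_simps mem_Collect_eq st_in_range[OF assms] simp_thms)
  qed
  then show ?thesis by (simp only: Comp_def comp_apply)
qed

lemma Comp_wcol: "w \<in> lists (gens n) \<Longrightarrow> Comp \<xi> d n (wcol w \<chi>) = Comp \<xi> d n \<chi>"
proof (induct w arbitrary: \<chi>)
  case (Cons a w)
  then show ?case by (cases a) (auto simp: Comp_st)
qed simp

lemma lval_Xm:
  "lval Xm \<chi> \<in> carrier (free_alg n)"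
  "cls 1 n (lval Xm \<chi>) = inv\<^bsub>Y 1 n\<^esub> (XY 1 n (pos \<chi> 1))"
proof -
  have "XY 1 n (pos \<chi> 1) \<in> Units (Y 1 n)" using pos_range[of 1 \<chi>] n by (intro XY_Unit) auto
  then have "\<exists>f. f \<in> carrier (free_alg n) \<and> cls 1 n f = inv\<^bsub>Y 1 n\<^esub> (XY 1 n (pos \<chi> 1))"
    using cls_surj[of "inv\<^bsub>Y 1 n\<^esub> (XY 1 n (pos \<chi> 1))" 1 n] by auto
  from someI_ex[OF this] show "lval Xm \<chi> \<in> carrier (free_alg n)"
    "cls 1 n (lval Xm \<chi>) = inv\<^bsub>Y 1 n\<^esub> (XY 1 n (pos \<chi> 1))"
    by (auto simp: lval_def)
qed

lemma lval_closed: "a \<in> gens n \<Longrightarrow> lval a \<chi> \<in> carrier (free_alg n)"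
proof (cases a)
  case (Gg i)
  assume "a \<in> gens n"
  then show ?thesis using Gg pos_range[of i \<chi>] pos_Suc(2)[of \<chi> i] by (auto simp: lval_def)
next
  case Xp
  then show ?thesis using pos_range[of 1 \<chi>] n by (auto simp: lval_def)
next
  case Xm
  then show ?thesis using lval_Xm by simp
qed (simp add: lval_def)

lemma wval_closed: "w \<in> lists (gens n) \<Longrightarrow> wval w \<chi> \<in> carrier (free_alg n)"
  by (induct w arbitrary: \<chi>) (auto simp: lval_closed)

lemma wval_append: "wval (v @ w) \<chi> = wval v \<chi> * wval w (wcol v \<chi>)"
  by (induct v arbitrary: \<chi>) (auto simp: mult.assoc)

lemma Phi_add: "Phi (f + h) \<chi> \<chi>' = Phi f \<chi> \<chi>' + Phi h \<chi> \<chi>'"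
  unfolding Phi_def
  by (rule setsum_keys_plus_distrib) (auto simp: fscal_add distrib_right)

lemma Phi_word: "Phi (Poly_Mapping.single w c) \<chi> \<chi>' = fscal c * (if wcol w \<chi> = \<chi>' then wval w \<chi> else 0)"
  by (simp add: Phi_def)

lemma Phi_zero [simp]: "Phi 0 \<chi> \<chi>' = 0"
  by (simp add: Phi_def)

lemma Phi_diff: "Phi (f - h) \<chi> \<chi>' = Phi f \<chi> \<chi>' - Phi h \<chi> \<chi>'"
  using Phi_add[of "f - h" h] by simp

lemma Phi_sum: "Phi (sum F A) \<chi> \<chi>' = (\<Sum>x\<in>A. Phi (F x) \<chi> \<chi>')"
  by (induct A rule: infinite_finite_induct) (auto simp: Phi_add)

lemma Phi_mult:
  assumes f: "f \<in> carrier (free_alg n)" and \<chi>: "\<chi> \<in> Irr d n"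
  shows "Phi (f * h) \<chi> \<chi>' = (\<Sum>\<kappa>\<in>Irr d n. Phi f \<chi> \<kappa> * Phi h \<kappa> \<chi>')"
proof -
  have word: "Phi (Poly_Mapping.single v a * Poly_Mapping.single w b) \<chi> \<chi>' =
      (\<Sum>\<kappa>\<in>Irr d n. Phi (Poly_Mapping.single v a) \<chi> \<kappa> * Phi (Poly_Mapping.single w b) \<kappa> \<chi>')"
    if v: "v \<in> lists (gens n)" for v w a b
  proof -
    have c: "wval v \<chi> * (fscal b * x) = fscal b * (wval v \<chi> * x)" for x
      by (simp only: fscal_commute[of b "wval v \<chi>"] flip: mult.assoc)
    have "(\<Sum>\<kappa>\<in>Irr d n. Phi (Poly_Mapping.single v a) \<chi> \<kappa> * Phi (Poly_Mapping.single w b) \<kappa> \<chi>') =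
        (\<Sum>\<kappa>\<in>Irr d n. if wcol v \<chi> = \<kappa> then fscal a * wval v \<chi> * Phi (Poly_Mapping.single w b) \<kappa> \<chi>' else 0)"
      by (intro sum.cong) (auto simp: Phi_word)
    also have "\<dots> = fscal a * wval v \<chi> * Phi (Poly_Mapping.single w b) (wcol v \<chi>) \<chi>'"
      using Irr_wcol[OF \<chi> v] finite_Irr[OF d, of n] by (simp add: sum.delta')
    also have "\<dots> = Phi (Poly_Mapping.single v a * Poly_Mapping.single w b) \<chi> \<chi>'"
      by (simp add: mult_single Phi_word plus_list_def wcol_append wval_append fscal_mult mult.assoc c)
    finally show ?thesis by simp
  qed
  let ?F = "\<lambda>w. Poly_Mapping.single w (Poly_Mapping.lookup f w)"
  let ?H = "\<lambda>w. Poly_Mapping.single w (Poly_Mapping.lookup h w)"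
  have "Phi (f * h) \<chi> \<chi>' = (\<Sum>v\<in>Poly_Mapping.keys f. \<Sum>w\<in>Poly_Mapping.keys h. Phi (?F v * ?H w) \<chi> \<chi>')"
  proof -
    have fh: "f * h = (\<Sum>v\<in>Poly_Mapping.keys f. ?F v) * (\<Sum>w\<in>Poly_Mapping.keys h. ?H w)"
      by (rule arg_cong2[where f = "(*)", OF falg_sum_singles falg_sum_singles])
    show ?thesis unfolding fh sum_product Phi_sum ..
  qed
  also have "\<dots> = (\<Sum>v\<in>Poly_Mapping.keys f. \<Sum>w\<in>Poly_Mapping.keys h.
      \<Sum>\<kappa>\<in>Irr d n. Phi (?F v) \<chi> \<kappa> * Phi (?H w) \<kappa> \<chi>')"
    using f unfolding free_alg_carrier_iff by (intro sum.cong[OF HOL.refl] word) auto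
  also have "\<dots> = (\<Sum>v\<in>Poly_Mapping.keys f. \<Sum>\<kappa>\<in>Irr d n. \<Sum>w\<in>Poly_Mapping.keys h.
      Phi (?F v) \<chi> \<kappa> * Phi (?H w) \<kappa> \<chi>')"
    by (intro sum.cong HOL.refl sum.swap)
  also have "\<dots> = (\<Sum>\<kappa>\<in>Irr d n. \<Sum>v\<in>Poly_Mapping.keys f. \<Sum>w\<in>Poly_Mapping.keys h.
      Phi (?F v) \<chi> \<kappa> * Phi (?H w) \<kappa> \<chi>')"
    by (rule sum.swap)
  also have "\<dots> = (\<Sum>\<kappa>\<in>Irr d n. Phi (\<Sum>v\<in>Poly_Mapping.keys f. ?F v) \<chi> \<kappa> * Phi (\<Sum>w\<in>Poly_Mapping.keys h. ?H w) \<kappa> \<chi>')"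
    by (simp only: Phi_sum sum_product)
  finally show ?thesis by (simp only: falg_sum_singles[symmetric])
qed

lemma Phi_closed:
  assumes f: "f \<in> carrier (free_alg n)" and "\<chi> \<in> Irr d n"
  shows "Phi f \<chi> \<chi>' \<in> carrier (free_alg n)"
proof -
  have "w \<in> lists (gens n)" if "w \<in> Poly_Mapping.keys f" for w
    using f that by (auto simp: free_alg_carrier_iff)
  then show ?thesis unfolding Phi_def by (intro fcar_sum fcar_mult) (auto intro: wval_closed)
qed

text \<open>The letters permute the values of a character, so they preserve its composition.\<close>

lemma Phi_zero_outside:
  assumes f: "f \<in> carrier (free_alg n)" and "\<chi> \<in> Irr d n"
    and "\<chi>' \<notin> Irr d n \<or> Comp \<xi> d n \<chi>' \<noteq> Comp \<xi> d n \<chi>"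
  shows "Phi f \<chi> \<chi>' = 0"
proof -
  have "w \<in> lists (gens n)" if "w \<in> Poly_Mapping.keys f" for w
    using f that by (auto simp: free_alg_carrier_iff)
  then have "wcol w \<chi> \<noteq> \<chi>'" if "w \<in> Poly_Mapping.keys f" for w
    using Irr_wcol[of \<chi> w] Comp_wcol[of w \<chi>] assms that by auto
  then show ?thesis unfolding Phi_def by (intro sum.neutral) auto
qed

definition monomial :: "falg \<Rightarrow> (chr \<Rightarrow> chr) \<Rightarrow> (chr \<Rightarrow> falg) \<Rightarrow> bool" where
  "monomial f \<sigma> a \<longleftrightarrow> (\<forall>\<chi>\<in>Irr d n. \<forall>\<chi>'. Phi f \<chi> \<chi>' = (if \<sigma> \<chi> = \<chi>' then a \<chi> else 0))"

lemma monomial_word: "monomial (Poly_Mapping.single w 1) (wcol w) (wval w)"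
  by (simp add: monomial_def Phi_word)

lemma monomial_mult:
  assumes f: "f \<in> carrier (free_alg n)" and mf: "monomial f \<sigma> a" and mh: "monomial h \<tau> b"
    and \<sigma>: "\<And>\<chi>. \<chi> \<in> Irr d n \<Longrightarrow> \<sigma> \<chi> \<in> Irr d n"
  shows "monomial (f * h) (\<lambda>\<chi>. \<tau> (\<sigma> \<chi>)) (\<lambda>\<chi>. a \<chi> * b (\<sigma> \<chi>))"
  unfolding monomial_def
proof (intro ballI allI)
  fix \<chi> \<chi>' assume \<chi>: "\<chi> \<in> Irr d n"
  have "Phi (f * h) \<chi> \<chi>' = (\<Sum>\<kappa>\<in>Irr d n. if \<sigma> \<chi> = \<kappa> then a \<chi> * Phi h \<kappa> \<chi>' else 0)"
    unfolding Phi_mult[OF f \<chi>] using mf \<chi> by (intro sum.cong) (auto simp: monomial_def)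
  then show "Phi (f * h) \<chi> \<chi>' = (if \<tau> (\<sigma> \<chi>) = \<chi>' then a \<chi> * b (\<sigma> \<chi>) else 0)"
    using \<sigma>[OF \<chi>] finite_Irr[OF d, of n] mh by (simp add: sum.delta' monomial_def)
qed

lemma monomial_fvar: "monomial (fvar a) (lcol a) (lval a)"
  using monomial_word[of "[a]"] by (simp add: fvar_def monomial_def)

subsection \<open>Diagonal matrices of scalars\<close>

text \<open>The form of the matrices of polynomials in the \<open>t\<^sub>j\<close>, such as \<open>e\<^sub>i\<close> and \<open>E\<^sub>\<chi>\<close>.\<close>

definition tdiag :: "falg \<Rightarrow> (chr \<Rightarrow> complex) \<Rightarrow> bool" where
  "tdiag f a \<longleftrightarrow> f \<in> carrier (free_alg n) \<and> monomial f (\<lambda>\<chi>. \<chi>) (\<lambda>\<chi>. fscal (cconst (a \<chi>)))"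

lemma tdiag_mult: "tdiag f a \<Longrightarrow> tdiag h b \<Longrightarrow> tdiag (f * h) (\<lambda>\<chi>. a \<chi> * b \<chi>)"
  unfolding tdiag_def using monomial_mult[of f "\<lambda>\<chi>. \<chi>" "\<lambda>\<chi>. fscal (cconst (a \<chi>))" h "\<lambda>\<chi>. \<chi>" "\<lambda>\<chi>. fscal (cconst (b \<chi>))"]
  by (simp add: cconst_mult fscal_mult)

lemma tdiag_add: "tdiag f a \<Longrightarrow> tdiag h b \<Longrightarrow> tdiag (f + h) (\<lambda>\<chi>. a \<chi> + b \<chi>)"
  unfolding tdiag_def monomial_def by (simp add: Phi_add cconst_add fscal_add)

lemma tdiag_const: "tdiag (fscal (cconst z)) (\<lambda>\<chi>. z)"
  using Phi_word[of "[]" "cconst z"] by (simp add: tdiag_def monomial_def) (simp add: fscal_def)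

lemma tdiag_sum: "(\<And>x. x \<in> A \<Longrightarrow> tdiag (F x) (a x)) \<Longrightarrow> tdiag (sum F A) (\<lambda>\<chi>. \<Sum>x\<in>A. a x \<chi>)"
proof (induct A rule: infinite_finite_induct)
  case (insert x A)
  then show ?case using tdiag_add[of "F x" "a x" "sum F A"] by simp
qed (use tdiag_const[of 0] in simp_all)

lemma tdiag_power: "tdiag f a \<Longrightarrow> tdiag (f ^ k) (\<lambda>\<chi>. a \<chi> ^ k)"
proof (induct k)
  case (Suc k)
  then show ?case using tdiag_mult[of f a "f ^ k"] by simp
qed (use tdiag_const[of 1] in simp)

lemma tdiag_t: "1 \<le> j \<Longrightarrow> j \<le> n \<Longrightarrow> tdiag (fvar (Tt j)) (\<lambda>\<chi>. \<chi> j)"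
  using monomial_fvar[of "Tt j"] by (simp add: tdiag_def monomial_def lval_def)

lemma tdiag_cong: "tdiag f a \<Longrightarrow> (\<And>\<chi>. \<chi> \<in> Irr d n \<Longrightarrow> a \<chi> = b \<chi>) \<Longrightarrow> tdiag f b"
  by (simp add: tdiag_def monomial_def)

lemma Irr_root: "\<chi> \<in> Irr d n \<Longrightarrow> 1 \<le> j \<Longrightarrow> j \<le> n \<Longrightarrow> \<chi> j ^ d = 1"
  by (auto simp: Irr_def PiE_iff)

lemma sum_root_powers:
  fixes z :: complex
  assumes "z ^ d = 1"
  shows "(\<Sum>s<d. z ^ s) = (if z = 1 then of_nat d else 0)"
proof (cases "z = 1")
  case False
  then show ?thesis using assms geometric_sum[OF False, of d] by simp
qed simp

lemma tdiag_e:
  assumes i: "1 \<le> i" "i < n"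
  shows "tdiag (e_elt d i) (\<lambda>\<chi>. if \<chi> i = \<chi> (Suc i) then 1 else 0)"
proof (rule tdiag_cong)
  show "tdiag (e_elt d i) (\<lambda>\<chi>. 1 / of_nat d * (\<Sum>s = 1..d. \<chi> i ^ s * \<chi> (Suc i) ^ (d - s)))"
    unfolding e_elt_def Suc_eq_plus1[symmetric]
    by (intro tdiag_mult tdiag_const tdiag_sum tdiag_power tdiag_t) (use i in auto)
  fix \<chi> assume \<chi>: "\<chi> \<in> Irr d n"
  let ?a = "\<chi> i" and ?b = "\<chi> (Suc i)"
  have r: "?a ^ d = 1" "?b ^ d = 1" using Irr_root[OF \<chi>] i by auto
  then have b: "?b \<noteq> 0" using d by (auto simp: power_0_left)
  have z: "(?a / ?b) ^ d = 1" using r by (simp add: power_divide)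
  have "(\<Sum>s = 1..d. ?a ^ s * ?b ^ (d - s)) = (\<Sum>s = 1..d. (?a / ?b) ^ s)"
    using b r by (intro sum.cong) (auto simp: power_diff power_divide)
  also have "\<dots> = (\<Sum>s<d. (?a / ?b) ^ Suc s)"
    by (rule sum.reindex_bij_witness[of _ Suc "\<lambda>s. s - 1"]) auto
  also have "\<dots> = (?a / ?b) * (\<Sum>s<d. (?a / ?b) ^ s)" by (simp add: sum_distrib_left)
  also have "\<dots> = (if ?a = ?b then of_nat d else 0)"
    using sum_root_powers[OF z] b by auto
  finally show "1 / of_nat d * (\<Sum>s = 1..d. ?a ^ s * ?b ^ (d - s)) = (if ?a = ?b then 1 else 0)"
    using d by simp
qed

lemma tdiag_E:
  assumes \<chi>0: "\<chi>0 \<in> Irr d n"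
  shows "tdiag (E_elt d n \<chi>0) (\<lambda>\<chi>. if \<chi> = \<chi>0 then 1 else 0)"
proof -
  have one: "tdiag (fscal (cconst (1 / of_nat d)) * (\<Sum>s<d. fscal (cconst (inverse (\<chi>0 j) ^ s)) * fvar (Tt j) ^ s))
      (\<lambda>\<chi>. if \<chi> j = \<chi>0 j then 1 else 0)" if j: "1 \<le> j" "j \<le> n" for j
  proof (rule tdiag_cong)
    show "tdiag (fscal (cconst (1 / of_nat d)) * (\<Sum>s<d. fscal (cconst (inverse (\<chi>0 j) ^ s)) * fvar (Tt j) ^ s))
        (\<lambda>\<chi>. 1 / of_nat d * (\<Sum>s<d. inverse (\<chi>0 j) ^ s * \<chi> j ^ s))"
      by (intro tdiag_mult tdiag_const tdiag_sum tdiag_power tdiag_t) (use j in auto)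
    fix \<chi> assume \<chi>: "\<chi> \<in> Irr d n"
    have r: "\<chi> j ^ d = 1" "\<chi>0 j ^ d = 1" using Irr_root[OF \<chi>] Irr_root[OF \<chi>0] j by auto
    then have b: "\<chi>0 j \<noteq> 0" using d by (auto simp: power_0_left)
    have z: "(\<chi> j / \<chi>0 j) ^ d = 1" using r by (simp add: power_divide)
    have "(\<Sum>s<d. inverse (\<chi>0 j) ^ s * \<chi> j ^ s) = (\<Sum>s<d. (\<chi> j / \<chi>0 j) ^ s)"
      by (intro sum.cong) (auto simp: power_divide power_inverse field_simps)
    also have "\<dots> = (if \<chi> j = \<chi>0 j then of_nat d else 0)" using sum_root_powers[OF z] b by auto
    finally show "1 / of_nat d * (\<Sum>s<d. inverse (\<chi>0 j) ^ s * \<chi> j ^ s) = (if \<chi> j = \<chi>0 j then 1 else 0)"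
      using d by simp
  qed
  have "tdiag (prod_list (map (\<lambda>j. fscal (cconst (1 / of_nat d)) *
      (\<Sum>s<d. fscal (cconst (inverse (\<chi>0 j) ^ s)) * fvar (Tt j) ^ s)) js))
      (\<lambda>\<chi>. if \<forall>j\<in>set js. \<chi> j = \<chi>0 j then 1 else 0)" if "set js \<subseteq> {1..n}" for js
    using that
  proof (induct js)
    case (Cons j js)
    then have "tdiag (prod_list (map (\<lambda>j. fscal (cconst (1 / of_nat d)) *
      (\<Sum>s<d. fscal (cconst (inverse (\<chi>0 j) ^ s)) * fvar (Tt j) ^ s)) (j # js)))
      (\<lambda>\<chi>. (if \<chi> j = \<chi>0 j then 1 else 0) * (if \<forall>j\<in>set js. \<chi> j = \<chi>0 j then 1 else 0))"
      unfolding list.map prod_list.Cons by (intro tdiag_mult one) auto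
    then show ?case by (rule tdiag_cong) auto
  qed (use tdiag_const[of 1] in simp)
  from this[of "[1..<n + 1]"] show ?thesis
    unfolding E_elt_def
  proof (rule tdiag_cong)
    fix \<chi> assume \<chi>: "\<chi> \<in> Irr d n"
    have "(\<forall>j\<in>set [1..<n + 1]. \<chi> j = \<chi>0 j) \<longleftrightarrow> \<chi> = \<chi>0"
    proof
      assume "\<forall>j\<in>set [1..<n + 1]. \<chi> j = \<chi>0 j"
      then show "\<chi> = \<chi>0" using \<chi> \<chi>0 unfolding Irr_def by (intro PiE_ext) auto
    qed simp
    then show "(if \<forall>j\<in>set [1..<n + 1]. \<chi> j = \<chi>0 j then 1 else 0) = (if \<chi> = \<chi>0 then 1 else 0)"
      by simp
  qed auto
qed

end

section \<open>The defining relations hold for the matrices\<close>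

lemma cls_sum_zero:
  assumes "\<And>x. x \<in> A \<Longrightarrow> f x \<in> carrier (free_alg n)" "\<And>x. x \<in> A \<Longrightarrow> cls d n (f x) = \<zero>\<^bsub>Y d n\<^esub>"
  shows "cls d n (sum f A) = \<zero>\<^bsub>Y d n\<^esub>"
  using assms by (induct A rule: infinite_finite_induct) (simp_all add: cls_add)

context numbered_roots begin

lemma cls_lval_Gg: "cls 1 n (lval (Gg i) \<chi>) =
    (if \<chi> i = \<chi> (Suc i) then gY 1 n (pos \<chi> i) else scal 1 n (upow 1))"
  by (simp add: lval_def gY_def scal_def)

lemma cls_lval_Xp: "cls 1 n (lval Xp \<chi>) = XY 1 n (pos \<chi> 1)"
  by (simp add: lval_def XY_def)

lemma cls_lval_Tt: "cls 1 n (lval (Tt j) \<chi>) = scal 1 n (cconst (\<chi> j))"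
  by (simp add: lval_def scal_def)

lemma cls_lval_closed: "a \<in> gens n \<Longrightarrow> cls 1 n (lval a \<chi>) \<in> carrier (Y 1 n)"
  by (simp add: lval_closed)

lemma cls_wval_Cons: "a \<in> gens n \<Longrightarrow> w \<in> lists (gens n) \<Longrightarrow>
    cls 1 n (wval (a # w) \<chi>) = cls 1 n (lval a \<chi>) \<otimes>\<^bsub>Y 1 n\<^esub> cls 1 n (wval w (lcol a \<chi>))"
  by (simp add: cls_mult lval_closed wval_closed)

lemma XY_pos_Unit: "1 \<le> j \<Longrightarrow> j \<le> n \<Longrightarrow> XY 1 n (pos \<chi> j) \<in> Units (Y 1 n)"
  using pos_range[of j \<chi>] by (intro XY_Unit) auto

lemma XY_pos_closed [simp]: "1 \<le> j \<Longrightarrow> j \<le> n \<Longrightarrow> XY 1 n (pos \<chi> j) \<in> carrier (Y 1 n)"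
  using pos_range[of j \<chi>] by (intro XY_closed) auto

lemma gY_pos_closed [simp]: "\<chi> i = \<chi> (Suc i) \<Longrightarrow> 1 \<le> i \<Longrightarrow> i < n \<Longrightarrow> gY 1 n (pos \<chi> i) \<in> carrier (Y 1 n)"
  using pos_range[of i \<chi>] pos_Suc(2)[of \<chi> i] by (intro gY_closed) auto

definition ker :: "falg set" where
  "ker = {f \<in> carrier (free_alg n). \<forall>\<chi>\<in>Irr d n. \<forall>\<chi>'. cls 1 n (Phi f \<chi> \<chi>') = \<zero>\<^bsub>Y 1 n\<^esub>}"

lemma ker_ideal: "ideal ker (free_alg n)"
proof (rule idealI[OF ring_free_alg])
  show "subgroup ker (add_monoid (free_alg n))"
  proof (rule Fr.add.subgroupI)
    show "ker \<subseteq> carrier (free_alg n)" by (auto simp: ker_def)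
    have "0 \<in> ker" by (simp add: ker_def)
    then show "ker \<noteq> {}" by blast
    fix f h assume fh: "f \<in> ker" "h \<in> ker"
    have "Phi (- f) \<chi> \<chi>' = - Phi f \<chi> \<chi>'" for \<chi> \<chi>'
      using Phi_diff[of 0 f] by simp
    then show "\<ominus>\<^bsub>free_alg n\<^esub> f \<in> ker"
      using fh(1) by (simp add: ker_def cls_uminus Phi_closed)
    show "f \<oplus>\<^bsub>free_alg n\<^esub> h \<in> ker"
      using fh by (simp add: ker_def Phi_add cls_add Phi_closed)
  qed
  fix f x assume f: "f \<in> ker" and x: "x \<in> carrier (free_alg n)"
  have fc: "f \<in> carrier (free_alg n)" and
    z: "\<And>\<chi> \<chi>'. \<chi> \<in> Irr d n \<Longrightarrow> cls 1 n (Phi f \<chi> \<chi>') = \<zero>\<^bsub>Y 1 n\<^esub>" using f by (auto simp: ker_def)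
  show "x \<otimes>\<^bsub>free_alg n\<^esub> f \<in> ker"
    unfolding ker_def using fc x
    by (simp add: Phi_mult) (intro ballI allI cls_sum_zero; simp add: Phi_closed cls_mult z)
  show "f \<otimes>\<^bsub>free_alg n\<^esub> x \<in> ker"
    unfolding ker_def using fc x
    by (simp add: Phi_mult) (intro ballI allI cls_sum_zero; simp add: Phi_closed cls_mult z)
qed

lemma ker_monomial:
  assumes "l \<in> carrier (free_alg n)" "r \<in> carrier (free_alg n)" "monomial l \<sigma> a" "monomial r \<tau> b"
    and "\<And>\<chi>. \<chi> \<in> Irr d n \<Longrightarrow> \<sigma> \<chi> = \<tau> \<chi>"
    and eq: "\<And>\<chi>. \<chi> \<in> Irr d n \<Longrightarrow> cls 1 n (a \<chi>) = cls 1 n (b \<chi>)"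
  shows "l - r \<in> ker"
proof -
  have "cls 1 n (Phi (l - r) \<chi> \<chi>') = \<zero>\<^bsub>Y 1 n\<^esub>" if \<chi>: "\<chi> \<in> Irr d n" for \<chi> \<chi>'
  proof -
    have "cls 1 n (Phi l \<chi> \<chi>') = cls 1 n (Phi r \<chi> \<chi>')"
      using assms(3-5) eq[OF \<chi>] \<chi> by (simp add: monomial_def)
    then show ?thesis
      using Phi_closed[OF assms(1) \<chi>, of \<chi>'] Phi_closed[OF assms(2) \<chi>, of \<chi>']
      by (simp add: Phi_diff cls_diff)
  qed
  then show ?thesis using assms(1,2) by (simp add: ker_def)
qed

lemma ker_words:
  assumes "v \<in> lists (gens n)" "w \<in> lists (gens n)"
    and "\<And>\<chi>. \<chi> \<in> Irr d n \<Longrightarrow> wcol v \<chi> = wcol w \<chi>"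
    and "\<And>\<chi>. \<chi> \<in> Irr d n \<Longrightarrow> cls 1 n (wval v \<chi>) = cls 1 n (wval w \<chi>)"
  shows "Poly_Mapping.single v 1 - Poly_Mapping.single w 1 \<in> ker"
  by (rule ker_monomial[OF _ _ monomial_word monomial_word]) (use assms in auto)

lemma pos_st_apply:
  assumes "\<chi> \<in> Irr d n" "1 \<le> i" "i < n" "st i j = j" "st i (Suc j) = Suc j"
  shows "pos (\<chi> \<circ> st i) j = pos \<chi> j" "(\<chi> \<circ> st i) j = \<chi> j" "(\<chi> \<circ> st i) (Suc j) = \<chi> (Suc j)"
proof -
  show "pos (\<chi> \<circ> st i) j = pos \<chi> j"
    using pos_st[OF assms(1) _ assms(2,3)] comp_st_fixed[of \<chi> i] assms(4)
    by (cases "\<chi> i = \<chi> (Suc i)") auto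
qed (use assms in auto)

lemma scal_central: "x \<in> carrier (Y e m) \<Longrightarrow> x \<otimes>\<^bsub>Y e m\<^esub> scal e m c = scal e m c \<otimes>\<^bsub>Y e m\<^esub> x"
  "x \<in> carrier (Y e m) \<Longrightarrow> y \<in> carrier (Y e m) \<Longrightarrow>
    x \<otimes>\<^bsub>Y e m\<^esub> (scal e m c \<otimes>\<^bsub>Y e m\<^esub> y) = scal e m c \<otimes>\<^bsub>Y e m\<^esub> (x \<otimes>\<^bsub>Y e m\<^esub> y)"
  using scal_commute[of x e m c] by (simp_all flip: Yr.m_assoc)

text \<open>The exchange of one pair of neighbours changes neither the colours nor the sorted places of a distant pair,
  and distant pairs of equal colours are sorted onto distant pairs.\<close>

lemma ker_g_comm:
  assumes i: "1 \<le> i" "i < n" and j: "1 \<le> j" "j < n" and ij: "Suc i < j \<or> Suc j < i"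
  shows "Poly_Mapping.single [Gg i, Gg j] 1 - Poly_Mapping.single [Gg j, Gg i] 1 \<in> ker"
proof (rule ker_words)
  fix \<chi> assume \<chi>: "\<chi> \<in> Irr d n"
  show "wcol [Gg i, Gg j] \<chi> = wcol [Gg j, Gg i] \<chi>"
    using ij by (auto simp: fun_eq_iff st_apply)
  have s: "st i j = j" "st i (Suc j) = Suc j" "st j i = i" "st j (Suc i) = Suc i"
    using ij by (auto simp: st_apply)
  note P = pos_st_apply[OF \<chi> i s(1,2)] pos_st_apply[OF \<chi> j s(3,4)]
  have V: "cls 1 n (lval (Gg j) (\<chi> \<circ> st i)) = cls 1 n (lval (Gg j) \<chi>)"
    "cls 1 n (lval (Gg i) (\<chi> \<circ> st j)) = cls 1 n (lval (Gg i) \<chi>)"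
    unfolding cls_lval_Gg P by (rule HOL.refl)+
  have "cls 1 n (lval (Gg i) \<chi>) \<otimes>\<^bsub>Y 1 n\<^esub> cls 1 n (lval (Gg j) \<chi>) =
      cls 1 n (lval (Gg j) \<chi>) \<otimes>\<^bsub>Y 1 n\<^esub> cls 1 n (lval (Gg i) \<chi>)"
  proof (cases "\<chi> i = \<chi> (Suc i) \<and> \<chi> j = \<chi> (Suc j)")
    case True
    then have e: "pos \<chi> (Suc i) = Suc (pos \<chi> i)" "pos \<chi> i < n" "pos \<chi> (Suc j) = Suc (pos \<chi> j)" "pos \<chi> j < n"
      using pos_Suc[of \<chi>] i j by auto
    have "pos \<chi> i \<noteq> pos \<chi> j" "pos \<chi> (Suc i) \<noteq> pos \<chi> j" "pos \<chi> (Suc j) \<noteq> pos \<chi> i"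
      using ij by auto
    then have "Suc (pos \<chi> i) < pos \<chi> j \<or> Suc (pos \<chi> j) < pos \<chi> i" using e by linarith
    then show ?thesis
      using True e pos_range[of i \<chi>] pos_range[of j \<chi>] i j
        gY_comm[of "pos \<chi> i" n "pos \<chi> j" 1] by (simp add: cls_lval_Gg)
  next
    case False
    then consider "\<chi> i \<noteq> \<chi> (Suc i)" | "\<chi> i = \<chi> (Suc i)" "\<chi> j \<noteq> \<chi> (Suc j)" by blast
    then show ?thesis
    proof cases
      case 1
      then have "cls 1 n (lval (Gg i) \<chi>) = scal 1 n (upow 1)" by (simp add: cls_lval_Gg)
      then show ?thesis using scal_commute[OF cls_lval_closed[of "Gg j"]] j by simp
    next
      case 2
      then have "cls 1 n (lval (Gg j) \<chi>) = scal 1 n (upow 1)" by (simp add: cls_lval_Gg)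
      then show ?thesis using scal_commute[OF cls_lval_closed[of "Gg i"]] i by simp
    qed
  qed
  then show "cls 1 n (wval [Gg i, Gg j] \<chi>) = cls 1 n (wval [Gg j, Gg i] \<chi>)"
    using i j V lval_closed by (simp add: cls_mult)
qed (use i j in auto)

text \<open>Both sides compare the three pairs of strands, in opposite order. Three equal colours give the braid relation.
  If exactly two colours are equal, both sides are \<open>u\<^sup>2 g\<^sub>a\<close> with the same \<open>a\<close>, because exchanges of different colours
  leave the sorted places of the two strands unchanged. Three different colours give \<open>u\<^sup>3\<close>.\<close>

lemma ker_g_braid:
  assumes i: "1 \<le> i" "Suc i < n"
  shows "Poly_Mapping.single [Gg i, Gg (Suc i), Gg i] 1 -
    Poly_Mapping.single [Gg (Suc i), Gg i, Gg (Suc i)] 1 \<in> ker"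
proof (rule ker_words)
  fix \<chi> assume \<chi>: "\<chi> \<in> Irr d n"
  let ?i = "Suc i"
  let ?V = "\<lambda>i \<chi>. cls 1 n (lval (Gg i) \<chi>)"
  show "wcol [Gg i, Gg ?i, Gg i] \<chi> = wcol [Gg ?i, Gg i, Gg ?i] \<chi>"
    by (auto simp: fun_eq_iff st_apply)
  have I: "\<chi> \<circ> st i \<in> Irr d n" "\<chi> \<circ> st ?i \<in> Irr d n" using Irr_st[OF \<chi>] i by auto
  have in': "1 \<le> i" "i < n" "1 \<le> Suc i" using i by auto
  note P = pos_st[OF \<chi>, of i] pos_st[OF \<chi>, of ?i] pos_st[OF I(1), of i] pos_st[OF I(1), of ?i]
    pos_st[OF I(2), of i] pos_st[OF I(2), of ?i]
  note F = comp_st_fixed[of \<chi> i] comp_st_fixed[of \<chi> ?i] comp_st_fixed[of "\<chi> \<circ> st i" ?i]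
    comp_st_fixed[of "\<chi> \<circ> st ?i" i]
  have "?V i \<chi> \<otimes>\<^bsub>Y 1 n\<^esub> (?V ?i (\<chi> \<circ> st i) \<otimes>\<^bsub>Y 1 n\<^esub> ?V i (\<chi> \<circ> st i \<circ> st ?i)) =
      ?V ?i \<chi> \<otimes>\<^bsub>Y 1 n\<^esub> (?V i (\<chi> \<circ> st ?i) \<otimes>\<^bsub>Y 1 n\<^esub> ?V ?i (\<chi> \<circ> st ?i \<circ> st i))"
  proof (cases "\<chi> i = \<chi> ?i")
    case pq: True
    show ?thesis
    proof (cases "\<chi> ?i = \<chi> (Suc ?i)")
      case True
      have "Suc (pos \<chi> i) < n" using pos_Suc[of \<chi> i] pos_Suc[of \<chi> ?i] pq True i by auto
      then show ?thesis
        using pq True pos_Suc(1)[of \<chi> i] gY_braid[of "pos \<chi> i" n 1] pos_range[of i \<chi>] in' i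
        by (simp add: F cls_lval_Gg Yr.m_assoc)
    next
      case False
      then show ?thesis
        using pq i in' gY_pos_closed[of \<chi> i]
        by (simp add: cls_lval_Gg F P st_apply scal_central[of "gY 1 n (pos \<chi> _)"])
    qed
  next
    case pq: False
    show ?thesis
    proof (cases "\<chi> ?i = \<chi> (Suc ?i)")
      case True
      then show ?thesis
        using pq i in' gY_pos_closed[of \<chi> ?i]
        by (simp add: cls_lval_Gg F P st_apply scal_central[of "gY 1 n (pos \<chi> _)"])
    next
      case qr: False
      show ?thesis
      proof (cases "\<chi> i = \<chi> (Suc ?i)")
        case True
        then show ?thesis
          using pq qr i in' by (simp add: cls_lval_Gg F P st_apply)
      next
        case False
        then show ?thesis
          using pq qr i in' by (simp add: cls_lval_Gg st_apply)
      qed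
    qed
  qed
  then show "cls 1 n (wval [Gg i, Gg ?i, Gg i] \<chi>) = cls 1 n (wval [Gg ?i, Gg i, Gg ?i] \<chi>)"
    using i lval_closed by (simp add: cls_mult)
qed (use i in auto)

text \<open>For different colours both sides are \<open>u\<^sup>2\<close> times the product of the same two commuting elements \<open>X\<^sub>a\<close>.\<close>

lemma ker_Xg_braid:
  assumes n1: "1 < n"
  shows "Poly_Mapping.single [Xp, Gg 1, Xp, Gg 1] 1 - Poly_Mapping.single [Gg 1, Xp, Gg 1, Xp] 1 \<in> ker"
proof (rule ker_words)
  fix \<chi> assume \<chi>: "\<chi> \<in> Irr d n"
  let ?V = "\<lambda>\<chi>. cls 1 n (lval (Gg 1) \<chi>)" and ?X = "\<lambda>\<chi>. cls 1 n (lval Xp \<chi>)"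
  show "wcol [Xp, Gg 1, Xp, Gg 1] \<chi> = wcol [Gg 1, Xp, Gg 1, Xp] \<chi>" by simp
  have ss: "\<chi> \<circ> st 1 \<circ> st 1 = \<chi>" by (simp add: fun_eq_iff)
  have "?X \<chi> \<otimes>\<^bsub>Y 1 n\<^esub> (?V \<chi> \<otimes>\<^bsub>Y 1 n\<^esub> (?X (\<chi> \<circ> st 1) \<otimes>\<^bsub>Y 1 n\<^esub> ?V (\<chi> \<circ> st 1))) =
      ?V \<chi> \<otimes>\<^bsub>Y 1 n\<^esub> (?X (\<chi> \<circ> st 1) \<otimes>\<^bsub>Y 1 n\<^esub> (?V (\<chi> \<circ> st 1) \<otimes>\<^bsub>Y 1 n\<^esub> ?X \<chi>))"
  proof (cases "\<chi> 1 = \<chi> (Suc 1)")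
    case True
    then show ?thesis
      using XY_gY_braid_general[of "pos \<chi> 1" n 1] pos_range[of 1 \<chi>] pos_Suc(2)[of \<chi> 1] n1
      by (simp add: comp_st_fixed cls_lval_Gg cls_lval_Xp)
  next
    case False
    have "XY 1 n (pos \<chi> 1) \<otimes>\<^bsub>Y 1 n\<^esub> XY 1 n (pos \<chi> (Suc 1)) = XY 1 n (pos \<chi> (Suc 1)) \<otimes>\<^bsub>Y 1 n\<^esub> XY 1 n (pos \<chi> 1)"
      using pos_range[of 1 \<chi>] pos_range[of "Suc 1" \<chi>] n1 by (intro XY_comm) auto
    moreover have "pos (\<chi> \<circ> st 1) 1 = pos \<chi> (Suc 1)"
      using pos_st[OF \<chi> False] n1 by (simp add: st_apply)
    ultimately show ?thesis
      using False n1 by (simp add: cls_lval_Gg cls_lval_Xp st_apply scal_central[of "XY 1 n _"])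
  qed
  then show "cls 1 n (wval [Xp, Gg 1, Xp, Gg 1] \<chi>) = cls 1 n (wval [Gg 1, Xp, Gg 1, Xp] \<chi>)"
    using n1 lval_closed ss by (simp add: cls_mult)
qed (use n1 in auto)

lemma ker_Xg_comm:
  assumes i: "2 \<le> i" "i < n"
  shows "Poly_Mapping.single [Xp, Gg i] 1 - Poly_Mapping.single [Gg i, Xp] 1 \<in> ker"
proof (rule ker_words)
  fix \<chi> assume \<chi>: "\<chi> \<in> Irr d n"
  have i1: "1 \<le> i" using i by simp
  have p: "pos (\<chi> \<circ> st i) 1 = pos \<chi> 1"
    using pos_st[OF \<chi> _ i1 i(2)] comp_st_fixed[of \<chi> i] i
    by (cases "\<chi> i = \<chi> (Suc i)") (auto simp: st_apply)
  have "XY 1 n (pos \<chi> 1) \<otimes>\<^bsub>Y 1 n\<^esub> cls 1 n (lval (Gg i) \<chi>) =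
      cls 1 n (lval (Gg i) \<chi>) \<otimes>\<^bsub>Y 1 n\<^esub> XY 1 n (pos \<chi> 1)"
  proof (cases "\<chi> i = \<chi> (Suc i)")
    case True
    have "pos \<chi> i \<noteq> pos \<chi> 1" "pos \<chi> (Suc i) \<noteq> pos \<chi> 1" using i by auto
    then show ?thesis
      using gY_XY_comm[of "pos \<chi> i" n "pos \<chi> 1" 1] pos_Suc[OF True i1 i(2)] pos_range[of i \<chi>]
        pos_range[of 1 \<chi>] i True by (simp add: cls_lval_Gg)
  next
    case False
    then show ?thesis using n by (simp add: cls_lval_Gg scal_central[of "XY 1 n _"])
  qed
  then show "cls 1 n (wval [Xp, Gg i] \<chi>) = cls 1 n (wval [Gg i, Xp] \<chi>)"
    using i lval_closed by (simp add: cls_mult p cls_lval_Xp)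
qed (use i in auto)

text \<open>For different colours \<open>e\<^sub>i\<close> contributes \<open>0\<close> and the product of the two exchanges is \<open>u\<^sup>2\<close>; for equal colours it
  contributes \<open>1\<close> and the relation is the quadratic one of the affine Hecke algebra.\<close>

lemma ker_g_quad:
  assumes i: "1 \<le> i" "i < n"
  shows "fvar (Gg i) ^ 2 - (fscal (upow 2) + fscal (vpow 1) * e_elt d i * fvar (Gg i)) \<in> ker"
proof (rule ker_monomial)
  let ?g = "lval (Gg i)"
  have g: "monomial (fvar (Gg i)) (\<lambda>\<chi>. \<chi> \<circ> st i) ?g"
    using monomial_fvar[of "Gg i"] by (simp add: monomial_def)
  have "monomial (fvar (Gg i) * fvar (Gg i)) (\<lambda>\<chi>. \<chi> \<circ> st i \<circ> st i) (\<lambda>\<chi>. ?g \<chi> * ?g (\<chi> \<circ> st i))"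
    using monomial_mult[OF _ g g] i Irr_st by simp
  then show "monomial (fvar (Gg i) ^ 2) (\<lambda>\<chi>. \<chi> \<circ> st i \<circ> st i) (\<lambda>\<chi>. ?g \<chi> * ?g (\<chi> \<circ> st i))"
    by (simp add: power2_eq_square)
  let ?b = "\<lambda>\<chi>. fscal (upow 2) + (if \<chi> i = \<chi> (Suc i) then fscal (vpow 1) * fvar (Gg (pos \<chi> i)) else 0)"
  show "monomial (fscal (upow 2) + fscal (vpow 1) * e_elt d i * fvar (Gg i)) (\<lambda>\<chi>. \<chi>) ?b"
  proof -
    have sc: "monomial (fscal c) (\<lambda>\<chi>. \<chi>) (\<lambda>\<chi>. fscal c)" for c
      using Phi_word[of "[]" c] by (simp add: monomial_def fscal_def)
    have e: "monomial (e_elt d i) (\<lambda>\<chi>. \<chi>) (\<lambda>\<chi>. fscal (cconst (if \<chi> i = \<chi> (Suc i) then 1 else 0)))"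
      using tdiag_e[OF i] unfolding tdiag_def by simp
    have eg: "monomial (fscal (vpow 1) * e_elt d i * fvar (Gg i)) (\<lambda>\<chi>. \<chi> \<circ> st i)
        (\<lambda>\<chi>. fscal (vpow 1) * fscal (cconst (if \<chi> i = \<chi> (Suc i) then 1 else 0)) * ?g \<chi>)"
      by (rule monomial_mult[OF _ monomial_mult[OF _ sc e] g]) (use i in auto)
    show ?thesis
      unfolding monomial_def
    proof (intro ballI allI)
      fix \<chi> \<chi>' assume \<chi>: "\<chi> \<in> Irr d n"
      have "Phi (fscal (upow 2)) \<chi> \<chi>' = (if \<chi> = \<chi>' then fscal (upow 2) else 0)"
        using sc[of "upow 2"] \<chi> by (simp add: monomial_def)
      moreover have "Phi (fscal (vpow 1) * e_elt d i * fvar (Gg i)) \<chi> \<chi>' =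
         (if \<chi> = \<chi>' \<and> \<chi> i = \<chi> (Suc i) then fscal (vpow 1) * fvar (Gg (pos \<chi> i)) else 0)"
        using eg \<chi> comp_st_fixed[of \<chi> i] by (auto simp: monomial_def lval_def)
      ultimately show "Phi (fscal (upow 2) + fscal (vpow 1) * e_elt d i * fvar (Gg i)) \<chi> \<chi>' =
          (if \<chi> = \<chi>' then ?b \<chi> else 0)"
        by (simp add: Phi_add)
    qed
  qed
  fix \<chi> assume \<chi>: "\<chi> \<in> Irr d n"
  show "\<chi> \<circ> st i \<circ> st i = \<chi>" by (simp add: fun_eq_iff)
  show "cls 1 n (?g \<chi> * ?g (\<chi> \<circ> st i)) = cls 1 n (?b \<chi>)"
  proof (cases "\<chi> i = \<chi> (Suc i)")
    case True
    then have p: "1 \<le> pos \<chi> i" "pos \<chi> i < n" using pos_range[of i \<chi>] pos_Suc(2) i by auto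
    then show ?thesis
      using True gY_quad[OF p, of 1] eY_1[OF p]
      by (simp add: comp_st_fixed lval_def cls_mult cls_add gY_def scal_def)
  next
    case False
    then show ?thesis by (simp add: lval_def st_apply flip: fscal_mult upow_add)
  qed
qed (use i in auto)

lemma ker_t:
  shows "\<lbrakk>1 \<le> i; i \<le> n; 1 \<le> j; j \<le> n\<rbrakk> \<Longrightarrow>
      Poly_Mapping.single [Tt i, Tt j] 1 - Poly_Mapping.single [Tt j, Tt i] 1 \<in> ker"
    and "\<lbrakk>1 \<le> j; j \<le> n\<rbrakk> \<Longrightarrow>
      Poly_Mapping.single [Xp, Tt j] 1 - Poly_Mapping.single [Tt j, Xp] 1 \<in> ker"
    and "\<lbrakk>1 \<le> i; i < n; 1 \<le> j; j \<le> n\<rbrakk> \<Longrightarrow>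
      Poly_Mapping.single [Gg i, Tt j] 1 - Poly_Mapping.single [Tt (st i j), Gg i] 1 \<in> ker"
    and "\<lbrakk>1 \<le> j; j \<le> n\<rbrakk> \<Longrightarrow> fvar (Tt j) ^ d - 1 \<in> ker"
proof -
  assume "1 \<le> i" "i \<le> n" "1 \<le> j" "j \<le> n"
  then show "Poly_Mapping.single [Tt i, Tt j] 1 - Poly_Mapping.single [Tt j, Tt i] 1 \<in> ker"
    by (intro ker_words) (auto simp: lval_def mult.commute simp flip: fscal_mult)
next
  assume j: "1 \<le> j" "j \<le> n"
  have "lval Xp \<chi> * fscal (cconst (\<chi> j)) = fscal (cconst (\<chi> j)) * lval Xp \<chi>" for \<chi>
    by (simp add: fscal_commute)
  then show "Poly_Mapping.single [Xp, Tt j] 1 - Poly_Mapping.single [Tt j, Xp] 1 \<in> ker"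
    using j by (intro ker_words) (simp_all add: lval_def)
next
  assume i: "1 \<le> i" "i < n" and j: "1 \<le> j" "j \<le> n"
  have "lval (Gg i) \<chi> * fscal c = fscal c * lval (Gg i) \<chi>" for \<chi> c
    by (simp add: fscal_commute)
  then have "cls 1 n (wval [Gg i, Tt j] \<chi>) = cls 1 n (wval [Tt (st i j), Gg i] \<chi>)" for \<chi>
    by (simp add: lval_def[of "Tt _"])
  then show "Poly_Mapping.single [Gg i, Tt j] 1 - Poly_Mapping.single [Tt (st i j), Gg i] 1 \<in> ker"
    using i j by (intro ker_words) (auto simp: st_apply)
next
  assume j: "1 \<le> j" "j \<le> n"
  have "tdiag (fvar (Tt j) ^ d) (\<lambda>\<chi>. \<chi> j ^ d)" by (rule tdiag_power[OF tdiag_t[OF j]])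
  moreover have "tdiag 1 (\<lambda>\<chi>. 1)" using tdiag_const[of 1] by simp
  ultimately show "fvar (Tt j) ^ d - 1 \<in> ker"
    unfolding tdiag_def
    by (intro ker_monomial[where a = "\<lambda>\<chi>. fscal (cconst (\<chi> j ^ d))" and b = "\<lambda>\<chi>. 1"
          and \<sigma> = "\<lambda>\<chi>. \<chi>" and \<tau> = "\<lambda>\<chi>. \<chi>"])
      (use Irr_root j in auto)
qed

lemma ker_X_inv:
  "Poly_Mapping.single [Xp, Xm] 1 - Poly_Mapping.single [] 1 \<in> ker"
  "Poly_Mapping.single [Xm, Xp] 1 - Poly_Mapping.single [] 1 \<in> ker"
  by (rule ker_words;
      use n XY_pos_Unit[of 1] lval_Xm lval_closed in \<open>simp add: cls_mult cls_lval_Xp\<close>)+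

lemma yideal_subset_ker: "yideal d n \<subseteq> ker"
  unfolding yideal_def
proof (rule Fr.genideal_minimal[OF ker_ideal], rule subsetI)
  note words = fvar_def mult_single plus_list_def word_Nil[symmetric]
  fix x assume "x \<in> yrels d n"
  then show "x \<in> ker"
  proof cases
    case X_inv_r
    then show ?thesis using ker_X_inv(1) by (simp add: words)
  next
    case X_inv_l
    then show ?thesis using ker_X_inv(2) by (simp add: words)
  next
    case (g_comm i j)
    then show ?thesis using ker_g_comm[of i j] by (simp add: words flip: Suc_eq_plus1)
  next
    case (g_braid i)
    then show ?thesis using ker_g_braid[of i] by (simp add: words flip: Suc_eq_plus1)
  next
    case Xg_braid
    then show ?thesis using ker_Xg_braid by (simp add: words)
  next
    case (Xg_comm i)
    then show ?thesis using ker_Xg_comm[of i] by (simp add: words)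
  next
    case (t_comm i j)
    then show ?thesis using ker_t(1)[of i j] by (simp add: words)
  next
    case (gt_comm i j)
    then show ?thesis using ker_t(3)[of i j] by (simp add: words st_def flip: Suc_eq_plus1)
  next
    case (t_pow j)
    then show ?thesis using ker_t(4)[of j] by simp
  next
    case (Xt_comm j)
    then show ?thesis using ker_t(2)[of j] by (simp add: words)
  next
    case (g_quad i)
    then show ?thesis using ker_g_quad[of i] by simp
  qed
qed

end

section \<open>The homomorphism to matrices over the affine Hecke algebra\<close>

lemma Hmu_gens_closed:
  "range (scal 1 n) \<union> XY 1 n ` {1..n} \<union> (\<lambda>j. inv\<^bsub>Y 1 n\<^esub> (XY 1 n j)) ` {1..n} \<union>
      gY 1 n ` {i \<in> {1..<n}. transpose i (i + 1) \<in> young_subgroup n \<mu>} \<subseteq> carrier (Y 1 n)"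
  using XY_Unit[of 1 _ n] by auto

lemma Hmu_closed: "x \<in> Hmu n \<mu> \<Longrightarrow> x \<in> carrier (Y 1 n)"
  unfolding Hmu_def by (rule Yr.generate_ring_in_carrier[OF Hmu_gens_closed])

lemma Hmu_intros:
  shows "\<zero>\<^bsub>Y 1 n\<^esub> \<in> Hmu n \<mu>"
    and "scal 1 n c \<in> Hmu n \<mu>"
    and "\<lbrakk>1 \<le> j; j \<le> n\<rbrakk> \<Longrightarrow> XY 1 n j \<in> Hmu n \<mu>"
    and "\<lbrakk>1 \<le> j; j \<le> n\<rbrakk> \<Longrightarrow> inv\<^bsub>Y 1 n\<^esub> (XY 1 n j) \<in> Hmu n \<mu>"
    and "\<lbrakk>1 \<le> i; i < n; st i \<in> young_subgroup n \<mu>\<rbrakk> \<Longrightarrow> gY 1 n i \<in> Hmu n \<mu>"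
    and "\<lbrakk>x \<in> Hmu n \<mu>; y \<in> Hmu n \<mu>\<rbrakk> \<Longrightarrow> x \<oplus>\<^bsub>Y 1 n\<^esub> y \<in> Hmu n \<mu>"
    and "\<lbrakk>x \<in> Hmu n \<mu>; y \<in> Hmu n \<mu>\<rbrakk> \<Longrightarrow> x \<otimes>\<^bsub>Y 1 n\<^esub> y \<in> Hmu n \<mu>"
  unfolding Hmu_def
        apply (rule Yr.zero_in_generate)
       apply (rule generate_ring.incl, simp)
      apply (rule generate_ring.incl, simp)
     apply (rule generate_ring.incl, simp)
    apply (rule generate_ring.incl, rule UnI2, rule imageI, simp add: st_def flip: Suc_eq_plus1)
   apply (rule generate_ring.eng_add; assumption)
  apply (rule generate_ring.eng_mult; assumption)
  done

lemma st_young: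
  assumes "1 \<le> a" "a < n" "block \<mu> (Suc a) = block \<mu> a"
  shows "st a \<in> young_subgroup n \<mu>"
  using assms st_permutes[OF assms(1,2)] by (auto simp: young_subgroup_def st_apply)

lemma mat_alg_sel:
  "mult (mat_alg \<xi> d n) M N = (\<lambda>\<chi> \<chi>'. \<Oplus>\<^bsub>Y 1 n\<^esub>\<kappa>\<in>Irr d n. M \<chi> \<kappa> \<otimes>\<^bsub>Y 1 n\<^esub> N \<kappa> \<chi>')"
  "one (mat_alg \<xi> d n) = (\<lambda>\<chi> \<chi>'. if \<chi> = \<chi>' \<and> \<chi> \<in> Irr d n then \<one>\<^bsub>Y 1 n\<^esub> else \<zero>\<^bsub>Y 1 n\<^esub>)"
  "add (mat_alg \<xi> d n) M N = (\<lambda>\<chi> \<chi>'. M \<chi> \<chi>' \<oplus>\<^bsub>Y 1 n\<^esub> N \<chi> \<chi>')"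
  by (simp_all add: mat_alg_def)

lemma mat_alg_carrier_iff:
  "M \<in> carrier (mat_alg \<xi> d n) \<longleftrightarrow> (\<forall>\<chi> \<chi>'.
      if \<chi> \<in> Irr d n \<and> \<chi>' \<in> Irr d n \<and> Comp \<xi> d n \<chi> = Comp \<xi> d n \<chi>'
      then M \<chi> \<chi>' \<in> Hmu n (Comp \<xi> d n \<chi>) else M \<chi> \<chi>' = \<zero>\<^bsub>Y 1 n\<^esub>)"
  by (simp only: mat_alg_def partial_object.simps mem_Collect_eq)

lemma mat_entry_closed:
  assumes "M \<in> carrier (mat_alg \<xi> d n)"
  shows "M \<chi> \<chi>' \<in> carrier (Y 1 n)"
proof (cases "\<chi> \<in> Irr d n \<and> \<chi>' \<in> Irr d n \<and> Comp \<xi> d n \<chi> = Comp \<xi> d n \<chi>'")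
  case True
  show ?thesis
    using spec[OF spec[OF assms[unfolded mat_alg_carrier_iff], of \<chi>], of \<chi>'] unfolding if_P[OF True]
    by (rule Hmu_closed)
next
  case False
  show ?thesis
    using spec[OF spec[OF assms[unfolded mat_alg_carrier_iff], of \<chi>], of \<chi>'] unfolding if_not_P[OF False]
    by simp
qed

lemma mat_entry_zero:
  assumes "M \<in> carrier (mat_alg \<xi> d n)" "\<chi> \<notin> Irr d n"
  shows "M \<chi> \<chi>' = \<zero>\<^bsub>Y 1 n\<^esub>"
  using assms by (simp add: mat_alg_def)

context numbered_roots begin

lemma cls_lval_Hmu:
  assumes \<chi>: "\<chi> \<in> Irr d n" and a: "a \<in> gens n"
  shows "cls 1 n (lval a \<chi>) \<in> Hmu n (Comp \<xi> d n \<chi>)"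
proof (cases a)
  case (Gg i)
  then have i: "1 \<le> i" "i < n" using a by auto
  show ?thesis
  proof (cases "\<chi> i = \<chi> (Suc i)")
    case True
    have "block (Comp \<xi> d n \<chi>) (pos \<chi> (Suc i)) = block (Comp \<xi> d n \<chi>) (pos \<chi> i)"
      unfolding pos_def using block_rank[OF \<xi> \<chi>, of i] block_rank[OF \<xi> \<chi>, of "Suc i"] i True by simp
    then show ?thesis
      using True pos_Suc[OF True i] pos_range[of i \<chi>] i
      by (auto simp: Gg cls_lval_Gg intro!: Hmu_intros st_young)
  qed (simp add: Gg cls_lval_Gg Hmu_intros)
next
  case Xp
  then show ?thesis using pos_range[of 1 \<chi>] n by (simp add: cls_lval_Xp Hmu_intros)
next
  case Xm
  then show ?thesis using pos_range[of 1 \<chi>] n by (simp add: lval_Xm Hmu_intros)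
next
  case (Tt j)
  then show ?thesis by (simp add: cls_lval_Tt Hmu_intros)
qed

lemma cls_wval_Hmu:
  "\<chi> \<in> Irr d n \<Longrightarrow> w \<in> lists (gens n) \<Longrightarrow> cls 1 n (wval w \<chi>) \<in> Hmu n (Comp \<xi> d n \<chi>)"
proof (induct w arbitrary: \<chi>)
  case Nil
  show ?case using Hmu_intros(2)[of n 1] by simp
next
  case (Cons a w)
  have a: "a \<in> gens n" "w \<in> lists (gens n)" using Cons.prems by auto
  have "Comp \<xi> d n (lcol a \<chi>) = Comp \<xi> d n \<chi>" using Comp_wcol[of "[a]" \<chi>] a by simp
  then show ?case
    unfolding cls_wval_Cons[OF a]
    using Cons.hyps[OF Irr_lcol[OF Cons.prems(1) a(1)] a(2)] cls_lval_Hmu[OF Cons.prems(1) a(1)]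
    by (simp add: Hmu_intros)
qed

lemma cls_Phi_Hmu:
  assumes f: "f \<in> carrier (free_alg n)" and \<chi>: "\<chi> \<in> Irr d n"
  shows "cls 1 n (Phi f \<chi> \<chi>') \<in> Hmu n (Comp \<xi> d n \<chi>)"
proof -
  have w: "w \<in> lists (gens n)" if "w \<in> Poly_Mapping.keys f" for w
    using f that by (auto simp: free_alg_carrier_iff)
  define T where "T w = fscal (Poly_Mapping.lookup f w) * (if wcol w \<chi> = \<chi>' then wval w \<chi> else 0)" for w
  have T: "T w \<in> carrier (free_alg n)" "cls 1 n (T w) \<in> Hmu n (Comp \<xi> d n \<chi>)"
    if "w \<in> lists (gens n)" for w
    using wval_closed[OF that] cls_wval_Hmu[OF \<chi> that]
    by (auto simp: T_def cls_mult scal_def[symmetric] intro!: Hmu_intros)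
  have "cls 1 n (\<Sum>w\<in>A. T w) \<in> Hmu n (Comp \<xi> d n \<chi>)" if "A \<subseteq> lists (gens n)" for A
    using that
  proof (induct A rule: infinite_finite_induct)
    case (insert x A)
    then have "cls 1 n (sum T (insert x A)) = cls 1 n (T x) \<oplus>\<^bsub>Y 1 n\<^esub> cls 1 n (sum T A)"
      using T by (simp add: cls_add subset_iff)
    then show ?case using insert T(2)[of x] by (simp add: Hmu_intros)
  qed (simp_all add: Hmu_intros)
  then show ?thesis unfolding Phi_def T_def using w by blast
qed

text \<open>By \<open>yideal_subset_ker\<close> the value is independent of the representative (\<open>Psi0_cls\<close>).\<close>

definition Psi0 :: "falg set \<Rightarrow> chr \<Rightarrow> chr \<Rightarrow> falg set" where
  "Psi0 x \<chi> \<chi>' = (if \<chi> \<in> Irr d n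
     then cls 1 n (Phi (SOME f. f \<in> carrier (free_alg n) \<and> x = cls d n f) \<chi> \<chi>') else \<zero>\<^bsub>Y 1 n\<^esub>)"

lemma Psi0_cls:
  assumes f: "f \<in> carrier (free_alg n)"
  shows "Psi0 (cls d n f) \<chi> \<chi>' = (if \<chi> \<in> Irr d n then cls 1 n (Phi f \<chi> \<chi>') else \<zero>\<^bsub>Y 1 n\<^esub>)"
proof (cases "\<chi> \<in> Irr d n")
  case \<chi>: True
  define h where "h = (SOME h. h \<in> carrier (free_alg n) \<and> cls d n f = cls d n h)"
  have "h \<in> carrier (free_alg n) \<and> cls d n f = cls d n h"
    unfolding h_def by (rule someI[of _ f]) (use f in simp)
  then have h: "h \<in> carrier (free_alg n)" "f - h \<in> yideal d n"
    using cls_eq_iff[OF f, of h d] by auto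
  then have "cls 1 n (Phi (f - h) \<chi> \<chi>') = \<zero>\<^bsub>Y 1 n\<^esub>"
    using yideal_subset_ker \<chi> by (auto simp: ker_def)
  then have "cls 1 n (Phi f \<chi> \<chi>') \<ominus>\<^bsub>Y 1 n\<^esub> cls 1 n (Phi h \<chi> \<chi>') = \<zero>\<^bsub>Y 1 n\<^esub>"
    using Phi_closed[OF f \<chi>] Phi_closed[OF h(1) \<chi>] by (simp add: Phi_diff cls_diff)
  then have "cls 1 n (Phi f \<chi> \<chi>') = cls 1 n (Phi h \<chi> \<chi>')"
    using Phi_closed[OF f \<chi>] Phi_closed[OF h(1) \<chi>] by (simp add: Yr.r_right_minus_eq)
  then show ?thesis using \<chi> unfolding Psi0_def h_def by simp
qed (simp add: Psi0_def)

lemma Psi0_closed: "x \<in> carrier (Y d n) \<Longrightarrow> Psi0 x \<in> carrier (mat_alg \<xi> d n)"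
proof -
  assume "x \<in> carrier (Y d n)"
  then obtain f where f: "f \<in> carrier (free_alg n)" "x = cls d n f" using cls_surj by meson
  have "if \<chi> \<in> Irr d n \<and> \<chi>' \<in> Irr d n \<and> Comp \<xi> d n \<chi> = Comp \<xi> d n \<chi>'
      then Psi0 x \<chi> \<chi>' \<in> Hmu n (Comp \<xi> d n \<chi>) else Psi0 x \<chi> \<chi>' = \<zero>\<^bsub>Y 1 n\<^esub>" for \<chi> \<chi>'
  proof (cases "\<chi> \<in> Irr d n \<and> \<chi>' \<in> Irr d n \<and> Comp \<xi> d n \<chi> = Comp \<xi> d n \<chi>'")
    case True
    then have \<chi>: "\<chi> \<in> Irr d n" by blast
    have "Psi0 x \<chi> \<chi>' \<in> Hmu n (Comp \<xi> d n \<chi>)"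
      using cls_Phi_Hmu[OF f(1) \<chi>] \<chi> by (simp only: f(2) Psi0_cls[OF f(1)] if_True)
    then show ?thesis by (simp only: if_P[OF True])
  next
    case False
    then have "Psi0 x \<chi> \<chi>' = \<zero>\<^bsub>Y 1 n\<^esub>"
      using Phi_zero_outside[OF f(1), of \<chi> \<chi>'] by (auto simp: f(2) Psi0_cls[OF f(1)])
    then show ?thesis by (simp only: if_not_P[OF False])
  qed
  then show ?thesis unfolding mat_alg_carrier_iff by (intro allI)
qed

lemma Phi_fscal:
  assumes \<chi>: "\<chi> \<in> Irr d n"
  shows "Phi (fscal c * f) \<chi> \<chi>' = fscal c * Phi f \<chi> \<chi>'"
proof -
  have "Phi (fscal c * f) \<chi> \<chi>' = (\<Sum>\<kappa>\<in>Irr d n. if \<chi> = \<kappa> then fscal c * Phi f \<kappa> \<chi>' else 0)"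
    unfolding Phi_mult[OF fcar_basic(3) \<chi>]
    using Phi_word[of "[]" c] by (intro sum.cong HOL.refl) (simp add: fscal_def)
  then show ?thesis using finite_Irr[OF d, of n] \<chi> by (simp add: sum.delta')
qed

lemma Psi0_hom: "Psi0 \<in> ring_hom (Y d n) (mat_alg \<xi> d n)"
proof (rule ring_hom_memI)
  fix x assume x: "x \<in> carrier (Y d n)"
  show "Psi0 x \<in> carrier (mat_alg \<xi> d n)" by (rule Psi0_closed[OF x])
  fix y assume y: "y \<in> carrier (Y d n)"
  obtain f h where f: "f \<in> carrier (free_alg n)" "x = cls d n f"
    and h: "h \<in> carrier (free_alg n)" "y = cls d n h"
    using cls_surj x y by meson
  show "Psi0 (x \<otimes>\<^bsub>Y d n\<^esub> y) = Psi0 x \<otimes>\<^bsub>mat_alg \<xi> d n\<^esub> Psi0 y"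
  proof (intro ext)
    fix \<chi> \<chi>'
    have eq: "Psi0 (x \<otimes>\<^bsub>Y d n\<^esub> y) \<chi> \<chi>' = (if \<chi> \<in> Irr d n then cls 1 n (Phi (f * h) \<chi> \<chi>') else \<zero>\<^bsub>Y 1 n\<^esub>)"
      using f h Psi0_cls[of "f * h"] by (simp add: cls_mult)
    show "Psi0 (x \<otimes>\<^bsub>Y d n\<^esub> y) \<chi> \<chi>' = (Psi0 x \<otimes>\<^bsub>mat_alg \<xi> d n\<^esub> Psi0 y) \<chi> \<chi>'"
    proof (cases "\<chi> \<in> Irr d n")
      case True
      have "cls 1 n (Phi (f * h) \<chi> \<chi>') = (\<Oplus>\<^bsub>Y 1 n\<^esub>\<kappa>\<in>Irr d n. cls 1 n (Phi f \<chi> \<kappa> * Phi h \<kappa> \<chi>'))"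
        unfolding Phi_mult[OF f(1) True]
        using True f h by (intro cls_sum finite_Irr d) (simp add: Phi_closed)
      also have "\<dots> = (\<Oplus>\<^bsub>Y 1 n\<^esub>\<kappa>\<in>Irr d n. Psi0 x \<chi> \<kappa> \<otimes>\<^bsub>Y 1 n\<^esub> Psi0 y \<kappa> \<chi>')"
        by (rule Yr.finsum_cong')
          (use True f h in \<open>auto simp: Psi0_cls cls_mult Phi_closed\<close>)
      finally show ?thesis using True by (simp add: eq mat_alg_sel)
    next
      case False
      then have z: "Psi0 x \<chi> \<kappa> = \<zero>\<^bsub>Y 1 n\<^esub>" for \<kappa> by (simp add: Psi0_def)
      have "(\<Oplus>\<^bsub>Y 1 n\<^esub>\<kappa>\<in>Irr d n. Psi0 x \<chi> \<kappa> \<otimes>\<^bsub>Y 1 n\<^esub> Psi0 y \<kappa> \<chi>') = (\<Oplus>\<^bsub>Y 1 n\<^esub>\<kappa>\<in>Irr d n. \<zero>\<^bsub>Y 1 n\<^esub>)"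
        by (rule Yr.finsum_cong')
          (use mat_entry_closed[OF Psi0_closed[OF y]] in \<open>simp_all add: z\<close>)
      then show ?thesis using False by (simp add: eq mat_alg_sel)
    qed
  qed
  show "Psi0 (x \<oplus>\<^bsub>Y d n\<^esub> y) = Psi0 x \<oplus>\<^bsub>mat_alg \<xi> d n\<^esub> Psi0 y"
  proof (intro ext)
    fix \<chi> \<chi>'
    show "Psi0 (x \<oplus>\<^bsub>Y d n\<^esub> y) \<chi> \<chi>' = (Psi0 x \<oplus>\<^bsub>mat_alg \<xi> d n\<^esub> Psi0 y) \<chi> \<chi>'"
      using f h Psi0_cls[of "f + h"] by (simp add: cls_add mat_alg_sel Psi0_cls Phi_add Phi_closed)
  qed
next
  show "Psi0 \<one>\<^bsub>Y d n\<^esub> = \<one>\<^bsub>mat_alg \<xi> d n\<^esub>"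
  proof (intro ext)
    fix \<chi> \<chi>'
    have "Phi 1 \<kappa> \<kappa>' = (if \<kappa> = \<kappa>' then 1 else 0)" for \<kappa> \<kappa>'
      using Phi_word[of "[]" 1 \<kappa> \<kappa>'] by (simp add: word_Nil)
    then show "Psi0 \<one>\<^bsub>Y d n\<^esub> \<chi> \<chi>' = \<one>\<^bsub>mat_alg \<xi> d n\<^esub> \<chi> \<chi>'"
      using Psi0_cls[of 1 \<chi> \<chi>'] by (simp add: mat_alg_sel)
  qed
qed

lemma Psi0_scal:
  assumes "x \<in> carrier (Y d n)"
  shows "Psi0 (scal d n c \<otimes>\<^bsub>Y d n\<^esub> x) = (\<lambda>\<chi> \<chi>'. scal 1 n c \<otimes>\<^bsub>Y 1 n\<^esub> Psi0 x \<chi> \<chi>')"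
proof (intro ext)
  fix \<chi> \<chi>'
  obtain f where f: "f \<in> carrier (free_alg n)" "x = cls d n f" using cls_surj assms by meson
  have "scal d n c \<otimes>\<^bsub>Y d n\<^esub> x = cls d n (fscal c * f)" using f by (simp add: scal_def cls_mult)
  then show "Psi0 (scal d n c \<otimes>\<^bsub>Y d n\<^esub> x) \<chi> \<chi>' = scal 1 n c \<otimes>\<^bsub>Y 1 n\<^esub> Psi0 x \<chi> \<chi>'"
    using f Psi0_cls[of "fscal c * f" \<chi> \<chi>']
    by (simp only:) (simp add: Psi0_cls Phi_fscal cls_mult Phi_closed scal_def)
qed

subsection \<open>Rows of monomial matrices\<close>

text \<open>The notion \<open>monomial\<close> for matrices over the affine Hecke algebra itself.\<close>

definition row :: "(chr \<Rightarrow> chr \<Rightarrow> falg set) \<Rightarrow> (chr \<Rightarrow> chr) \<Rightarrow> (chr \<Rightarrow> falg set) \<Rightarrow> bool" where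
  "row M \<sigma> a \<longleftrightarrow> (\<forall>\<chi>\<in>Irr d n. \<forall>\<chi>'. M \<chi> \<chi>' = (if \<sigma> \<chi> = \<chi>' then a \<chi> else \<zero>\<^bsub>Y 1 n\<^esub>))"

lemma row_cong:
  assumes "row M \<sigma> a" "\<And>\<chi>. \<chi> \<in> Irr d n \<Longrightarrow> \<sigma> \<chi> = \<tau> \<chi>" "\<And>\<chi>. \<chi> \<in> Irr d n \<Longrightarrow> a \<chi> = b \<chi>"
  shows "row M \<tau> b"
  using assms by (simp add: row_def)

lemma row_entry: "row M \<sigma> a \<Longrightarrow> \<chi> \<in> Irr d n \<Longrightarrow> a \<chi> = M \<chi> (\<sigma> \<chi>)"
  by (simp add: row_def)

lemma row_mat_mult:
  assumes M: "M \<in> carrier (mat_alg \<xi> d n)" and N: "N \<in> carrier (mat_alg \<xi> d n)"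
    and r: "row M \<sigma> a" and \<chi>: "\<chi> \<in> Irr d n" "\<sigma> \<chi> \<in> Irr d n"
  shows "(M \<otimes>\<^bsub>mat_alg \<xi> d n\<^esub> N) \<chi> \<chi>' = a \<chi> \<otimes>\<^bsub>Y 1 n\<^esub> N (\<sigma> \<chi>) \<chi>'"
proof -
  have "(\<Oplus>\<^bsub>Y 1 n\<^esub>\<kappa>\<in>Irr d n. M \<chi> \<kappa> \<otimes>\<^bsub>Y 1 n\<^esub> N \<kappa> \<chi>') =
      (\<Oplus>\<^bsub>Y 1 n\<^esub>\<kappa>\<in>Irr d n. if \<sigma> \<chi> = \<kappa> then a \<chi> \<otimes>\<^bsub>Y 1 n\<^esub> N \<kappa> \<chi>' else \<zero>\<^bsub>Y 1 n\<^esub>)"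
  proof (rule Yr.finsum_cong'[OF HOL.refl])
    have "a \<chi> \<in> carrier (Y 1 n)" using mat_entry_closed[OF M] row_entry[OF r \<chi>(1)] by simp
    then show "(\<lambda>\<kappa>. if \<sigma> \<chi> = \<kappa> then a \<chi> \<otimes>\<^bsub>Y 1 n\<^esub> N \<kappa> \<chi>' else \<zero>\<^bsub>Y 1 n\<^esub>) \<in> Irr d n \<rightarrow> carrier (Y 1 n)"
      using mat_entry_closed[OF N] by simp
    fix \<kappa>
    show "M \<chi> \<kappa> \<otimes>\<^bsub>Y 1 n\<^esub> N \<kappa> \<chi>' = (if \<sigma> \<chi> = \<kappa> then a \<chi> \<otimes>\<^bsub>Y 1 n\<^esub> N \<kappa> \<chi>' else \<zero>\<^bsub>Y 1 n\<^esub>)"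
      using r \<chi> mat_entry_closed[OF N] by (simp add: row_def)
  qed
  also have "\<dots> = a \<chi> \<otimes>\<^bsub>Y 1 n\<^esub> N (\<sigma> \<chi>) \<chi>'"
    using Yr.finsum_singleton[OF \<chi>(2) finite_Irr[OF d], of "\<lambda>\<kappa>. a \<chi> \<otimes>\<^bsub>Y 1 n\<^esub> N \<kappa> \<chi>'" 1 n]
      mat_entry_closed[OF N] mat_entry_closed[OF M, of \<chi> "\<sigma> \<chi>"] row_entry[OF r \<chi>(1)]
    by simp
  finally show ?thesis by (simp add: mat_alg_sel)
qed

lemma row_mult:
  assumes \<Psi>: "\<Psi> \<in> ring_hom (Y d n) (mat_alg \<xi> d n)"
    and xy: "x \<in> carrier (Y d n)" "y \<in> carrier (Y d n)"
    and r: "row (\<Psi> x) \<sigma> a" "row (\<Psi> y) \<tau> b"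
    and \<sigma>: "\<And>\<chi>. \<chi> \<in> Irr d n \<Longrightarrow> \<sigma> \<chi> \<in> Irr d n"
  shows "row (\<Psi> (x \<otimes>\<^bsub>Y d n\<^esub> y)) (\<lambda>\<chi>. \<tau> (\<sigma> \<chi>)) (\<lambda>\<chi>. a \<chi> \<otimes>\<^bsub>Y 1 n\<^esub> b (\<sigma> \<chi>))"
  unfolding row_def
proof (intro ballI allI)
  fix \<chi> \<chi>' assume \<chi>: "\<chi> \<in> Irr d n"
  note M = ring_hom_closed[OF \<Psi> xy(1)] and N = ring_hom_closed[OF \<Psi> xy(2)]
  have "\<Psi> (x \<otimes>\<^bsub>Y d n\<^esub> y) \<chi> \<chi>' = a \<chi> \<otimes>\<^bsub>Y 1 n\<^esub> \<Psi> y (\<sigma> \<chi>) \<chi>'"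
    using row_mat_mult[OF M N r(1) \<chi> \<sigma>[OF \<chi>]] ring_hom_mult[OF \<Psi> xy] by simp
  then show "\<Psi> (x \<otimes>\<^bsub>Y d n\<^esub> y) \<chi> \<chi>' = (if \<tau> (\<sigma> \<chi>) = \<chi>' then a \<chi> \<otimes>\<^bsub>Y 1 n\<^esub> b (\<sigma> \<chi>) else \<zero>\<^bsub>Y 1 n\<^esub>)"
    using r(2) \<sigma>[OF \<chi>] mat_entry_closed[OF M, of \<chi> "\<sigma> \<chi>"] row_entry[OF r(1) \<chi>] by (simp add: row_def)
qed

text \<open>The equation \<open>\<Psi>(x) \<Psi>(x\<^sup>-\<^sup>1) = 1\<close> is read off row by row.\<close>

lemma row_inv:
  assumes \<Psi>: "\<Psi> \<in> ring_hom (Y d n) (mat_alg \<xi> d n)"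
    and x: "x \<in> Units (Y d n)" and r: "row (\<Psi> x) \<sigma> a"
    and a: "\<And>\<chi>. \<chi> \<in> Irr d n \<Longrightarrow> a \<chi> \<in> Units (Y 1 n)"
    and \<tau>: "\<And>\<chi>. \<chi> \<in> Irr d n \<Longrightarrow> \<tau> \<chi> \<in> Irr d n \<and> \<sigma> (\<tau> \<chi>) = \<chi>"
  shows "row (\<Psi> (inv\<^bsub>Y d n\<^esub> x)) \<tau> (\<lambda>\<chi>. inv\<^bsub>Y 1 n\<^esub> (a (\<tau> \<chi>)))"
  unfolding row_def
proof (intro ballI allI)
  fix \<kappa> \<chi>' assume \<kappa>: "\<kappa> \<in> Irr d n"
  let ?\<chi> = "\<tau> \<kappa>"
  have \<chi>: "?\<chi> \<in> Irr d n" "\<sigma> ?\<chi> = \<kappa>" using \<tau>[OF \<kappa>] by auto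
  have xc: "x \<in> carrier (Y d n)" "inv\<^bsub>Y d n\<^esub> x \<in> carrier (Y d n)" using x by auto
  note M = ring_hom_closed[OF \<Psi> xc(1)] and N = ring_hom_closed[OF \<Psi> xc(2)]
  have "\<Psi> x \<otimes>\<^bsub>mat_alg \<xi> d n\<^esub> \<Psi> (inv\<^bsub>Y d n\<^esub> x) = \<one>\<^bsub>mat_alg \<xi> d n\<^esub>"
    using ring_hom_mult[OF \<Psi> xc] ring_hom_one[OF \<Psi>] x by simp
  then have "a ?\<chi> \<otimes>\<^bsub>Y 1 n\<^esub> \<Psi> (inv\<^bsub>Y d n\<^esub> x) \<kappa> \<chi>' = (if ?\<chi> = \<chi>' then \<one>\<^bsub>Y 1 n\<^esub> else \<zero>\<^bsub>Y 1 n\<^esub>)"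
    using row_mat_mult[OF M N r \<chi>(1), of \<chi>'] \<chi> \<kappa> by (simp add: mat_alg_sel(2))
  then have "inv\<^bsub>Y 1 n\<^esub> (a ?\<chi>) \<otimes>\<^bsub>Y 1 n\<^esub> (a ?\<chi> \<otimes>\<^bsub>Y 1 n\<^esub> \<Psi> (inv\<^bsub>Y d n\<^esub> x) \<kappa> \<chi>') =
      (if ?\<chi> = \<chi>' then inv\<^bsub>Y 1 n\<^esub> (a ?\<chi>) else \<zero>\<^bsub>Y 1 n\<^esub>)"
    using Yr.Units_inv_closed[OF a[OF \<chi>(1)]] by (cases "?\<chi> = \<chi>'") simp_all
  then show "\<Psi> (inv\<^bsub>Y d n\<^esub> x) \<kappa> \<chi>' = (if ?\<chi> = \<chi>' then inv\<^bsub>Y 1 n\<^esub> (a ?\<chi>) else \<zero>\<^bsub>Y 1 n\<^esub>)"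
    using a[OF \<chi>(1)] mat_entry_closed[OF N] by (simp add: Yr.m_assoc[symmetric] Yr.Units_closed)
qed

lemma Psi0_monomial:
  assumes "f \<in> carrier (free_alg n)" "monomial f \<sigma> a"
  shows "row (Psi0 (cls d n f)) \<sigma> (\<lambda>\<chi>. cls 1 n (a \<chi>))"
  using assms by (simp add: row_def Psi0_cls monomial_def)

lemma row_gY: "1 \<le> i \<Longrightarrow> i < n \<Longrightarrow> row (Psi0 (gY d n i)) (\<lambda>\<chi>. \<chi> \<circ> st i) (\<lambda>\<chi>. cls 1 n (lval (Gg i) \<chi>))"
  using Psi0_monomial[OF _ monomial_fvar[of "Gg i"]] by (simp add: gY_def row_def)

lemma row_scal: "row (Psi0 (scal d n c)) (\<lambda>\<chi>. \<chi>) (\<lambda>\<chi>. scal 1 n c)"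
proof -
  have "monomial (fscal c) (\<lambda>\<chi>. \<chi>) (\<lambda>\<chi>. fscal c)"
    using Phi_word[of "[]" c] by (simp add: monomial_def fscal_def)
  then show ?thesis using Psi0_monomial[of "fscal c"] by (simp add: scal_def)
qed

text \<open>By induction through \<open>X\<^sub>j\<^sub>+\<^sub>1 = u\<^sup>-\<^sup>2 g\<^sub>j X\<^sub>j g\<^sub>j\<close>: for equal colours the same formula holds for the sorted places, and
  for different colours the two exchanges cancel the factor \<open>u\<^sup>-\<^sup>2\<close> and move the place of \<open>j\<close> to that of \<open>j + 1\<close>.\<close>

lemma row_XY: "1 \<le> j \<Longrightarrow> j \<le> n \<Longrightarrow> row (Psi0 (XY d n j)) (\<lambda>\<chi>. \<chi>) (\<lambda>\<chi>. XY 1 n (pos \<chi> j))"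
proof (induct j)
  case (Suc j)
  show ?case
  proof (cases "j = 0")
    case True
    then have j: "Suc j = 1" by simp
    show ?thesis
      unfolding j using Psi0_monomial[OF _ monomial_fvar[of Xp]] by (simp add: row_def XY_1 cls_lval_Xp)
  next
    case False
    then have j: "1 \<le> j" "j < n" using Suc.prems by auto
    have c: "gY d n j \<in> carrier (Y d n)" "XY d n j \<in> carrier (Y d n)" using j by auto
    let ?g = "\<lambda>\<chi>. cls 1 n (lval (Gg j) \<chi>)"
    have s: "\<And>\<chi>. \<chi> \<in> Irr d n \<Longrightarrow> \<chi> \<circ> st j \<in> Irr d n" using Irr_st j by blast
    have "row (Psi0 (scal d n (upow (- 2)) \<otimes>\<^bsub>Y d n\<^esub> gY d n j \<otimes>\<^bsub>Y d n\<^esub> XY d n j \<otimes>\<^bsub>Y d n\<^esub> gY d n j))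
        (\<lambda>\<chi>. \<chi> \<circ> st j \<circ> st j)
        (\<lambda>\<chi>. scal 1 n (upow (- 2)) \<otimes>\<^bsub>Y 1 n\<^esub> ?g \<chi> \<otimes>\<^bsub>Y 1 n\<^esub> XY 1 n (pos (\<chi> \<circ> st j) j) \<otimes>\<^bsub>Y 1 n\<^esub> ?g (\<chi> \<circ> st j))"
      by (rule row_mult[OF Psi0_hom _ _ row_mult[OF Psi0_hom _ _ row_mult[OF Psi0_hom _ _ row_scal row_gY[OF j]]
              Suc.hyps[OF j(1)]] row_gY[OF j]]) (use c s j in \<open>simp_all del: comp_apply\<close>)
    then show ?thesis
      unfolding XY_Suc[OF j]
    proof (rule row_cong)
      fix \<chi> assume \<chi>: "\<chi> \<in> Irr d n"
      show "\<chi> \<circ> st j \<circ> st j = \<chi>" by (simp add: fun_eq_iff)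
      show "scal 1 n (upow (- 2)) \<otimes>\<^bsub>Y 1 n\<^esub> ?g \<chi> \<otimes>\<^bsub>Y 1 n\<^esub> XY 1 n (pos (\<chi> \<circ> st j) j) \<otimes>\<^bsub>Y 1 n\<^esub> ?g (\<chi> \<circ> st j)
          = XY 1 n (pos \<chi> (Suc j))"
      proof (cases "\<chi> j = \<chi> (Suc j)")
        case True
        then show ?thesis
          using XY_Suc[of "pos \<chi> j" n 1] pos_range[of j \<chi>] pos_Suc[OF True j] j
          by (simp add: comp_st_fixed cls_lval_Gg)
      next
        case False
        have p: "pos (\<chi> \<circ> st j) j = pos \<chi> (Suc j)" using pos_st[OF \<chi> False j] by (simp add: st_apply)
        have X: "XY 1 n (pos \<chi> (Suc j)) \<in> carrier (Y 1 n)" using j by simp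
        have "scal 1 n (upow (- 2)) \<otimes>\<^bsub>Y 1 n\<^esub> scal 1 n (upow 1) \<otimes>\<^bsub>Y 1 n\<^esub> scal 1 n (upow 1) = \<one>\<^bsub>Y 1 n\<^esub>"
          by (simp flip: scal_mult upow_add)
        then show ?thesis
          using False X by (simp add: cls_lval_Gg p st_apply Yr.m_assoc scal_central[OF X])
            (simp flip: Yr.m_assoc)
      qed
    qed
  qed
qed simp

end

section \<open>The values of the homomorphism on the spanning set\<close>

lemma (in Group.monoid) Units_int_pow_closed:
  "x \<in> Units G \<Longrightarrow> x [^] (k :: int) \<in> carrier G"
  unfolding int_pow_def2
  by (cases "k < 0") (simp_all only: if_True if_False Units_closed Units_inv_Units Units_pow_closed)

lemma lprod_one: "lprod (Y d n) (map (\<lambda>j. \<one>\<^bsub>Y d n\<^esub>) js) = \<one>\<^bsub>Y d n\<^esub>"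
  by (induct js) auto

context numbered_roots begin

lemma row_one:
  assumes "\<Psi> \<in> ring_hom (Y d n) (mat_alg \<xi> d n)"
  shows "row (\<Psi> \<one>\<^bsub>Y d n\<^esub>) (\<lambda>\<chi>. \<chi>) (\<lambda>\<chi>. \<one>\<^bsub>Y 1 n\<^esub>)"
  using ring_hom_one[OF assms] by (simp add: row_def mat_alg_sel)

lemma row_nat_pow:
  assumes \<Psi>: "\<Psi> \<in> ring_hom (Y d n) (mat_alg \<xi> d n)" and x: "x \<in> carrier (Y d n)"
    and r: "row (\<Psi> x) (\<lambda>\<chi>. \<chi>) a"
  shows "row (\<Psi> (x [^]\<^bsub>Y d n\<^esub> (k :: nat))) (\<lambda>\<chi>. \<chi>) (\<lambda>\<chi>. a \<chi> [^]\<^bsub>Y 1 n\<^esub> k)"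
proof (induct k)
  case 0
  then show ?case using row_one[OF \<Psi>] by simp
next
  case (Suc k)
  then show ?case using row_mult[OF \<Psi> _ x Suc r] x by simp
qed

lemma row_int_pow:
  assumes \<Psi>: "\<Psi> \<in> ring_hom (Y d n) (mat_alg \<xi> d n)" and x: "x \<in> Units (Y d n)"
    and r: "row (\<Psi> x) (\<lambda>\<chi>. \<chi>) a" and a: "\<And>\<chi>. a \<chi> \<in> Units (Y 1 n)"
  shows "row (\<Psi> (x [^]\<^bsub>Y d n\<^esub> (k :: int))) (\<lambda>\<chi>. \<chi>) (\<lambda>\<chi>. a \<chi> [^]\<^bsub>Y 1 n\<^esub> k)"
proof -
  have p: "row (\<Psi> (x [^]\<^bsub>Y d n\<^esub> m)) (\<lambda>\<chi>. \<chi>) (\<lambda>\<chi>. a \<chi> [^]\<^bsub>Y 1 n\<^esub> m)" for m :: nat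
    by (rule row_nat_pow[OF \<Psi> _ r]) (use x in auto)
  have "row (\<Psi> (inv\<^bsub>Y d n\<^esub> (x [^]\<^bsub>Y d n\<^esub> m))) (\<lambda>\<chi>. \<chi>) (\<lambda>\<chi>. inv\<^bsub>Y 1 n\<^esub> (a \<chi> [^]\<^bsub>Y 1 n\<^esub> m))" for m :: nat
    by (rule row_inv[OF \<Psi> _ p]) (use x a in \<open>auto intro: Yr.Units_pow_closed\<close>)
  then show ?thesis using p unfolding int_pow_def2 by (cases "k < 0") (simp_all only: if_True if_False)
qed

lemma row_lprod:
  assumes \<Psi>: "\<Psi> \<in> ring_hom (Y d n) (mat_alg \<xi> d n)"
    and "\<And>j. j \<in> set js \<Longrightarrow> x j \<in> carrier (Y d n)"
    and "\<And>j. j \<in> set js \<Longrightarrow> row (\<Psi> (x j)) (\<lambda>\<chi>. \<chi>) (a j)"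
  shows "row (\<Psi> (lprod (Y d n) (map x js))) (\<lambda>\<chi>. \<chi>) (\<lambda>\<chi>. lprod (Y 1 n) (map (\<lambda>j. a j \<chi>) js))"
  using assms(2,3)
proof (induct js)
  case Nil
  then show ?case using row_one[OF \<Psi>] by simp
next
  case (Cons j js)
  have c: "x j \<in> carrier (Y d n)" "lprod (Y d n) (map x js) \<in> carrier (Y d n)"
    using Cons.prems(1) by (auto intro!: monoid.lprod_closed[OF monoid_Y])
  have "row (\<Psi> (x j)) (\<lambda>\<chi>. \<chi>) (a j)"
    "row (\<Psi> (lprod (Y d n) (map x js))) (\<lambda>\<chi>. \<chi>) (\<lambda>\<chi>. lprod (Y 1 n) (map (\<lambda>j. a j \<chi>) js))"
    using Cons by auto
  from row_mult[OF \<Psi> c this] show ?case by simp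
qed

lemma XY_pow_closed: "1 \<le> j \<Longrightarrow> j \<le> n \<Longrightarrow> XY d n j [^]\<^bsub>Y d n\<^esub> (k :: int) \<in> carrier (Y d n)"
  by (intro monoid.Units_int_pow_closed[OF monoid_Y] XY_Unit d)

lemma XY_pos_pow_closed: "1 \<le> j \<Longrightarrow> j \<le> n \<Longrightarrow> XY 1 n (pos \<chi> j) [^]\<^bsub>Y 1 n\<^esub> (k :: int) \<in> carrier (Y 1 n)"
  by (intro monoid.Units_int_pow_closed[OF monoid_Y] XY_pos_Unit)

lemma X_monom_closed: "X_monom d n l \<in> carrier (Y d n)"
  unfolding X_monom_def by (intro monoid.lprod_closed[OF monoid_Y]) (auto intro!: XY_pow_closed)

lemma row_X_monom:
  "row (Psi0 (X_monom d n l)) (\<lambda>\<chi>. \<chi>)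
     (\<lambda>\<chi>. lprod (Y 1 n) (map (\<lambda>j. XY 1 n (pos \<chi> j) [^]\<^bsub>Y 1 n\<^esub> l j) [1..<n + 1]))"
  unfolding X_monom_def
proof (rule row_lprod[OF Psi0_hom])
  fix j assume "j \<in> set [1..<n + 1]"
  then have j: "1 \<le> j" "j \<le> n" by auto
  show "XY d n j [^]\<^bsub>Y d n\<^esub> l j \<in> carrier (Y d n)" by (rule XY_pow_closed[OF j])
  show "row (Psi0 (XY d n j [^]\<^bsub>Y d n\<^esub> l j)) (\<lambda>\<chi>. \<chi>) (\<lambda>\<chi>. XY 1 n (pos \<chi> j) [^]\<^bsub>Y 1 n\<^esub> l j)"
    by (rule row_int_pow[OF Psi0_hom XY_Unit[OF d j] row_XY[OF j] XY_pos_Unit[OF j]])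
qed

lemma Gg_word: "set is \<subseteq> {1..<n} \<Longrightarrow> map Gg is \<in> lists (gens n)"
  by (induct "is") auto

lemma lprod_gY: "set is \<subseteq> {1..<n} \<Longrightarrow>
    lprod (Y d n) (map (gY d n) is) = cls d n (Poly_Mapping.single (map Gg is) 1)"
proof (induct "is")
  case (Cons i "is")
  then have "map Gg is \<in> lists (gens n)" "1 \<le> i" "i < n" using Gg_word[of "is"] by auto
  moreover from this(1) have "Poly_Mapping.single (map Gg is) 1 \<in> carrier (free_alg n)" by (rule fcar_word)
  ultimately have "cls d n (Poly_Mapping.single (map Gg (i # is)) 1) =
      gY d n i \<otimes>\<^bsub>Y d n\<^esub> cls d n (Poly_Mapping.single (map Gg is) 1)"
    unfolding list.map word_Cons gY_def by (intro cls_mult fcar_fvar) simp_all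
  then show ?case using Cons by simp
qed (simp add: word_Nil)

lemma wcol_Gg: "wcol (map Gg is) \<chi> = \<chi> \<circ> perm_of is"
  by (induct "is" arbitrary: \<chi>) (simp_all add: perm_of_simps comp_assoc)

lemma row_gw:
  assumes w: "w permutes {1..n}" and r: "reduced_word n w is"
  shows "row (Psi0 (gw d n w)) (\<lambda>\<chi>. \<chi> \<circ> w) (\<lambda>\<chi>. cls 1 n (wval (map Gg is) \<chi>))"
proof -
  have s: "set is \<subseteq> {1..<n}" "perm_of is = w" using r by (auto simp: reduced_word_def)
  have g: "gw d n w = cls d n (Poly_Mapping.single (map Gg is) 1)"
    using gw_reduced_word[OF w r, of d] lprod_gY[OF s(1)] by simp
  have "map Gg is \<in> lists (gens n)" by (rule Gg_word[OF s(1)])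
  then have "row (Psi0 (gw d n w)) (wcol (map Gg is)) (\<lambda>\<chi>. cls 1 n (wval (map Gg is) \<chi>))"
    unfolding g by (intro Psi0_monomial monomial_word) auto
  then show ?thesis by (rule row_cong) (simp_all add: wcol_Gg s del: comp_apply)
qed

lemma Irr_perm:
  assumes "\<chi> \<in> Irr d n" "v permutes {1..n}"
  shows "\<chi> \<circ> v \<in> Irr d n"
proof -
  obtain "is" where "set is \<subseteq> {1..<n}" "perm_of is = v" using ex_word[OF assms(2)] by blast
  then show ?thesis using Irr_wcol[OF assms(1) Gg_word[of "is"]] by (simp add: wcol_Gg)
qed

lemma std_conj_permutes:
  "v permutes {1..n} \<Longrightarrow> pos \<chi> \<circ> v \<circ> pinv (pos \<kappa>) permutes {1..n}"
  by (intro permutes_compose permutes_inv pos_permutes)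

text \<open>Along a reduced word each letter exchanges two neighbours of equal or of different colours. Exchanging
  different colours costs a factor \<open>u\<close> and leaves the sorted permutation unchanged, exchanging equal colours
  multiplies the sorted permutation by a simple transposition, and it increases its length because the
  standardization is increasing on every colour.\<close>

lemma cls_wval_reduced_word:
  assumes "\<chi> \<in> Irr d n" "reduced_word n v is" "v permutes {1..n}"
  shows "cls 1 n (wval (map Gg is) \<chi>) =
    scal 1 n (upow (int (len n v) - int (len n (pos \<chi> \<circ> v \<circ> pinv (pos (\<chi> \<circ> v)))))) \<otimes>\<^bsub>Y 1 n\<^esub>
      gw 1 n (pos \<chi> \<circ> v \<circ> pinv (pos (\<chi> \<circ> v)))"
  using assms
proof (induct "is" arbitrary: v \<chi>)
  case Nil
  then have v: "v = id" by (auto simp: reduced_word_def perm_of_simps)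
  have "pos \<chi> \<circ> id \<circ> pinv (pos (\<chi> \<circ> id)) = id"
    using permutes_inv_o(1)[OF pos_permutes] by simp
  then show ?case unfolding v by (simp only: gw_id) simp
next
  case (Cons i "is")
  define v' where "v' = perm_of is"
  have v: "v = st i \<circ> v'" using Cons.prems(2) by (simp add: reduced_word_def perm_of_simps v'_def)
  have "reduced_word n (perm_of (i # is)) (i # is)"
    using Cons.prems(2) unfolding v v'_def perm_of_simps .
  from reduced_word_Cons[OF this]
  have i: "1 \<le> i" "i < n" and r: "reduced_word n v' is" and lt: "pinv v' i < pinv v' (Suc i)"
    by (auto simp: v'_def)
  have v': "v' permutes {1..n}"
    using r perm_of_permutes[of "is" n] by (auto simp: reduced_word_def)
  note \<chi> = Cons.prems(1)
  let ?\<chi> = "\<chi> \<circ> st i"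
  have I: "?\<chi> \<in> Irr d n" by (rule Irr_st[OF \<chi> i])
  have cv: "?\<chi> \<circ> v' = \<chi> \<circ> v" unfolding v by (simp add: comp_assoc)
  define y' where "y' = pos ?\<chi> \<circ> v' \<circ> pinv (pos (\<chi> \<circ> v))"
  have y': "y' permutes {1..n}" unfolding y'_def by (rule std_conj_permutes[OF v'])
  have IH: "cls 1 n (wval (map Gg is) ?\<chi>) =
      scal 1 n (upow (int (len n v') - int (len n y'))) \<otimes>\<^bsub>Y 1 n\<^esub> gw 1 n y'"
    using Cons.hyps[OF I r v'] unfolding cv y'_def .
  have lv: "len n v = Suc (len n v')"
    unfolding len_eq_ninv[OF v'] len_eq_ninv[OF Cons.prems(3)] unfolding v by (rule ninv_up[OF v' i lt])
  have "map Gg is \<in> lists (gens n)" using r by (intro Gg_word) (simp add: reduced_word_def)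
  then have W: "cls 1 n (wval (map Gg (i # is)) \<chi>) = cls 1 n (lval (Gg i) \<chi>) \<otimes>\<^bsub>Y 1 n\<^esub>
      (scal 1 n (upow (int (len n v') - int (len n y'))) \<otimes>\<^bsub>Y 1 n\<^esub> gw 1 n y')"
    using cls_wval_Cons[of "Gg i" "map Gg is" \<chi>] i IH by simp
  have gy: "gw 1 n y' \<in> carrier (Y 1 n)" by (rule gw_closed[OF y'])
  define y where "y = pos \<chi> \<circ> v \<circ> pinv (pos (\<chi> \<circ> v))"
  show ?case
    unfolding W y_def[symmetric]
  proof (cases "\<chi> i = \<chi> (Suc i)")
    case False
    have y: "y = y'" unfolding y_def y'_def v pos_st[OF \<chi> False i] by (simp add: comp_assoc)
    have "int (len n v) - int (len n y) = 1 + (int (len n v') - int (len n y'))"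
      unfolding y lv by simp
    then have "scal 1 n (upow (int (len n v) - int (len n y))) =
        scal 1 n (upow 1) \<otimes>\<^bsub>Y 1 n\<^esub> scal 1 n (upow (int (len n v') - int (len n y')))"
      by (simp only: upow_add scal_mult)
    then show "cls 1 n (lval (Gg i) \<chi>) \<otimes>\<^bsub>Y 1 n\<^esub>
        (scal 1 n (upow (int (len n v') - int (len n y'))) \<otimes>\<^bsub>Y 1 n\<^esub> gw 1 n y') =
        scal 1 n (upow (int (len n v) - int (len n y))) \<otimes>\<^bsub>Y 1 n\<^esub> gw 1 n y"
      using False gy by (simp add: cls_lval_Gg y Yr.m_assoc)
  next
    case True
    let ?a = "pos \<chi> i"
    have a: "1 \<le> ?a" "?a < n" "pos \<chi> (Suc i) = Suc ?a"
      using pos_Suc[OF True i] pos_range[of i \<chi>] i by auto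
    have "pos \<chi> \<circ> (st i \<circ> v') = st ?a \<circ> (pos \<chi> \<circ> v')"
      using pos_st_conj[OF True i] by (simp only: comp_assoc[symmetric])
    then have y: "y = st ?a \<circ> y'"
      unfolding y_def y'_def v comp_st_fixed[OF True] by (simp only: comp_assoc)
    let ?q = "pos (\<chi> \<circ> v)"
    have py: "pinv y' (pos \<chi> k) = ?q (pinv v' k)" for k
    proof -
      have "y' (?q (pinv v' k)) = pos \<chi> k"
        using permutes_inverses(2)[OF pos_permutes] permutes_inverses(1)[OF v']
        by (simp add: y'_def comp_st_fixed[OF True])
      then show ?thesis using permutes_inverses(2)[OF y'] by metis
    qed
    have "?q (pinv v' i) < ?q (pinv v' (Suc i))"
      unfolding pos_def
    proof (rule std_mono)
      show "pinv v' i \<in> {1..n}" "pinv v' (Suc i) \<in> {1..n}"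
        using permutes_in_image[OF permutes_inv[OF v']] i by auto
      have "(\<chi> \<circ> v) (pinv v' i) = (\<chi> \<circ> v) (pinv v' (Suc i))"
        using True permutes_inverses(1)[OF v'] by (simp add: v st_apply)
      then show "(rank \<xi> d \<circ> (\<chi> \<circ> v)) (pinv v' i) < (rank \<xi> d \<circ> (\<chi> \<circ> v)) (pinv v' (Suc i)) \<or>
          (rank \<xi> d \<circ> (\<chi> \<circ> v)) (pinv v' i) = (rank \<xi> d \<circ> (\<chi> \<circ> v)) (pinv v' (Suc i)) \<and> pinv v' i < pinv v' (Suc i)"
        using lt by simp
    qed
    then have lty: "pinv y' ?a < pinv y' (Suc ?a)" using py[of i] py[of "Suc i"] a(3) by simp
    have yp: "y permutes {1..n}" unfolding y by (rule st_comp_permutes[OF y' a(1,2)])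
    have ly: "len n y = Suc (len n y')"
      unfolding len_eq_ninv[OF y'] len_eq_ninv[OF yp] unfolding y by (rule ninv_up[OF y' a(1,2) lty])
    have gyy: "gw 1 n y = gY 1 n ?a \<otimes>\<^bsub>Y 1 n\<^esub> gw 1 n y'"
      unfolding y by (rule gw_st_comp[OF y' a(1,2) lty])
    have "gY 1 n ?a \<in> carrier (Y 1 n)" using a by simp
    then show "cls 1 n (lval (Gg i) \<chi>) \<otimes>\<^bsub>Y 1 n\<^esub>
        (scal 1 n (upow (int (len n v') - int (len n y'))) \<otimes>\<^bsub>Y 1 n\<^esub> gw 1 n y') =
        scal 1 n (upow (int (len n v) - int (len n y))) \<otimes>\<^bsub>Y 1 n\<^esub> gw 1 n y"
      using True gy by (simp add: cls_lval_Gg gyy lv ly scal_central)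
  qed
qed

theorem is_Psi_Psi0: "is_Psi \<xi> d n Psi0"
  unfolding is_Psi_def Let_def
proof (intro conjI allI ballI impI)
  show "Psi0 \<in> ring_hom (Y d n) (mat_alg \<xi> d n)" by (rule Psi0_hom)
  show "Psi0 (scal d n c \<otimes>\<^bsub>Y d n\<^esub> x) = (\<lambda>\<chi> \<chi>'. scal 1 n c \<otimes>\<^bsub>Y 1 n\<^esub> Psi0 x \<chi> \<chi>')"
    if "x \<in> carrier (Y d n)" for c x by (rule Psi0_scal[OF that])
  fix \<chi> and l :: "nat \<Rightarrow> int" and w
  assume \<chi>: "\<chi> \<in> Irr d n" and w: "w permutes {1..n}"
  let ?v = "pinv w" and ?E = "cls d n (E_elt d n \<chi>)"
  have v: "?v permutes {1..n}" by (rule permutes_inv[OF w])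
  have act: "act w \<chi> = \<chi> \<circ> ?v" by (simp add: act_def fun_eq_iff)
  have I: "\<chi> \<circ> ?v \<in> Irr d n" by (rule Irr_perm[OF \<chi> v])
  have p: "pinv (pi_chi \<xi> d n \<chi>) = pos \<chi>"
    using pi_chi_std(2)[OF \<xi> \<chi>] by (simp add: pos_def)
  have "pinv (pinv (pi_chi \<xi> d n (\<chi> \<circ> ?v))) = pi_chi \<xi> d n (\<chi> \<circ> ?v)"
    by (rule inv_inv_eq[OF permutes_bij[OF pi_chi_std(1)[OF \<xi> I]]])
  then have p': "pi_chi \<xi> d n (\<chi> \<circ> ?v) = pinv (pos (\<chi> \<circ> ?v))"
    using pi_chi_std(2)[OF \<xi> I] by (simp add: pos_def)
  define y where "y = pos \<chi> \<circ> ?v \<circ> pinv (pos (\<chi> \<circ> ?v))"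
  define X where "X \<kappa> = lprod (Y 1 n) (map (\<lambda>j. XY 1 n (pos \<kappa> j) [^]\<^bsub>Y 1 n\<^esub> l j) [1..<n + 1])" for \<kappa>
  define "is" where "is = (SOME is. reduced_word n ?v is)"
  define G where "G \<kappa> = cls 1 n (wval (map Gg is) \<kappa>)" for \<kappa>
  define \<delta> where "\<delta> \<kappa> = scal 1 n (cconst (if \<kappa> = \<chi> then 1 else 0))" for \<kappa>
  have r: "reduced_word n ?v is" unfolding is_def by (rule reduced_word_ex[OF v])
  have rE: "row (Psi0 ?E) (\<lambda>\<kappa>. \<kappa>) \<delta>"
    using tdiag_E[OF \<chi>] Psi0_monomial unfolding tdiag_def \<delta>_def scal_def by blast
  have rX: "row (Psi0 (X_monom d n l)) (\<lambda>\<kappa>. \<kappa>) X"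
    using row_X_monom[of l] unfolding X_def .
  have rG: "row (Psi0 (gw d n ?v)) (\<lambda>\<kappa>. \<kappa> \<circ> ?v) G"
    using row_gw[OF v r] unfolding G_def .
  have row: "row (Psi0 (?E \<otimes>\<^bsub>Y d n\<^esub> X_monom d n l \<otimes>\<^bsub>Y d n\<^esub> gw d n ?v)) (\<lambda>\<kappa>. \<kappa> \<circ> ?v)
      (\<lambda>\<kappa>. \<delta> \<kappa> \<otimes>\<^bsub>Y 1 n\<^esub> X \<kappa> \<otimes>\<^bsub>Y 1 n\<^esub> G \<kappa>)"
    by (rule row_mult[OF Psi0_hom _ _ row_mult[OF Psi0_hom _ _ rE rX] rG])
      (simp_all add: X_monom_closed gw_closed[OF v])
  have XG: "X \<kappa> \<in> carrier (Y 1 n)" "G \<kappa> \<in> carrier (Y 1 n)" for \<kappa>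
  proof -
    show "X \<kappa> \<in> carrier (Y 1 n)" unfolding X_def
      by (intro monoid.lprod_closed[OF monoid_Y]) (auto intro!: XY_pos_pow_closed)
    have "map Gg is \<in> lists (gens n)" using r by (intro Gg_word) (simp add: reduced_word_def)
    then show "G \<kappa> \<in> carrier (Y 1 n)" unfolding G_def by (intro cls_closed wval_closed)
  qed
  let ?h = "scal 1 n (upow (int (len n ?v) - int (len n y))) \<otimes>\<^bsub>Y 1 n\<^esub> X \<chi> \<otimes>\<^bsub>Y 1 n\<^esub> gw 1 n y"
  have "gw 1 n y \<in> carrier (Y 1 n)"
    unfolding y_def by (intro gw_closed std_conj_permutes v)
  then have val: "X \<chi> \<otimes>\<^bsub>Y 1 n\<^esub> G \<chi> = ?h"
    using cls_wval_reduced_word[OF \<chi> r v] XG(1)[of \<chi>]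
    unfolding G_def y_def[symmetric] by (simp add: scal_central Yr.m_assoc)
  have c: "?E \<otimes>\<^bsub>Y d n\<^esub> X_monom d n l \<otimes>\<^bsub>Y d n\<^esub> gw d n ?v \<in> carrier (Y d n)"
    using X_monom_closed gw_closed[OF v] by simp
  have "Psi0 (?E \<otimes>\<^bsub>Y d n\<^esub> X_monom d n l \<otimes>\<^bsub>Y d n\<^esub> gw d n ?v) \<kappa> \<kappa>' = mat_unit n \<chi> (\<chi> \<circ> ?v) ?h \<kappa> \<kappa>'" for \<kappa> \<kappa>'
  proof (cases "\<kappa> \<in> Irr d n")
    case True
    have \<delta>1: "\<delta> \<chi> = \<one>\<^bsub>Y 1 n\<^esub>" and \<delta>0: "\<And>\<kappa>. \<kappa> \<noteq> \<chi> \<Longrightarrow> \<delta> \<kappa> = \<zero>\<^bsub>Y 1 n\<^esub>" by (simp_all add: \<delta>_def)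
    have E: "Psi0 (?E \<otimes>\<^bsub>Y d n\<^esub> X_monom d n l \<otimes>\<^bsub>Y d n\<^esub> gw d n ?v) \<kappa> \<kappa>' =
        (if \<kappa> \<circ> ?v = \<kappa>' then \<delta> \<kappa> \<otimes>\<^bsub>Y 1 n\<^esub> X \<kappa> \<otimes>\<^bsub>Y 1 n\<^esub> G \<kappa> else \<zero>\<^bsub>Y 1 n\<^esub>)"
      using row True unfolding row_def by blast
    show ?thesis
    proof (cases "\<kappa> = \<chi>")
      case True
      then show ?thesis unfolding E mat_unit_def using val XG[of \<chi>] by (auto simp: \<delta>1)
    next
      case False
      then show ?thesis unfolding E mat_unit_def using XG[of \<kappa>] by (simp add: \<delta>0)
    qed
  next
    case False
    then show ?thesis using mat_entry_zero[OF Psi0_closed[OF c]] \<chi> by (auto simp: mat_unit_def)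
  qed
  then show "Psi0 (?E \<otimes>\<^bsub>Y d n\<^esub> X_monom d n l \<otimes>\<^bsub>Y d n\<^esub> gw d n ?v) =
      mat_unit n \<chi> (act w \<chi>)
        (scal 1 n (upow (int (len n ?v) -
            int (len n (pinv (pi_chi \<xi> d n \<chi>) \<circ> ?v \<circ> pi_chi \<xi> d n (act w \<chi>))))) \<otimes>\<^bsub>Y 1 n\<^esub>
          lprod (Y 1 n) (map (\<lambda>j. XY 1 n (pinv (pi_chi \<xi> d n \<chi>) j) [^]\<^bsub>Y 1 n\<^esub> l j) [1..<n + 1]) \<otimes>\<^bsub>Y 1 n\<^esub>
          gw 1 n (pinv (pi_chi \<xi> d n \<chi>) \<circ> ?v \<circ> pi_chi \<xi> d n (act w \<chi>)))"
    unfolding act p p' X_def y_def by (intro ext)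
qed

end

section \<open>Uniqueness of the homomorphism on the generators\<close>

text \<open>The distributive law for non-commuting factors.\<close>

lemma sum_PiE_prod_list:
  fixes F :: "'a \<Rightarrow> 'b \<Rightarrow> 'c :: semiring_1"
  assumes "distinct js"
  shows "(\<Sum>\<chi>\<in>set js \<rightarrow>\<^sub>E R. prod_list (map (\<lambda>j. F j (\<chi> j)) js)) = prod_list (map (\<lambda>j. \<Sum>z\<in>R. F j z) js)"
  using assms
proof (induct js)
  case (Cons j js)
  have inj: "inj_on (\<lambda>(z, \<chi>). \<chi>(j := z)) (R \<times> (set js \<rightarrow>\<^sub>E R))"
    by (rule inj_combinator) (use Cons.prems in simp)
  have "(\<Sum>\<chi>\<in>set (j # js) \<rightarrow>\<^sub>E R. prod_list (map (\<lambda>j. F j (\<chi> j)) (j # js))) =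
      (\<Sum>(z, \<chi>)\<in>R \<times> (set js \<rightarrow>\<^sub>E R). prod_list (map (\<lambda>k. F k ((\<chi>(j := z)) k)) (j # js)))"
    by (simp only: set_simps PiE_insert_eq) (subst sum.reindex[OF inj], simp add: case_prod_unfold comp_def)
  also have "\<dots> = (\<Sum>(z, \<chi>)\<in>R \<times> (set js \<rightarrow>\<^sub>E R). F j z * prod_list (map (\<lambda>j. F j (\<chi> j)) js))"
  proof (rule sum.cong[OF HOL.refl], clarify)
    fix z \<chi>
    have m: "map (\<lambda>k. F k ((\<chi>(j := z)) k)) js = map (\<lambda>j. F j (\<chi> j)) js"
      using Cons.prems by (intro map_cong) auto
    show "prod_list (map (\<lambda>k. F k ((\<chi>(j := z)) k)) (j # js)) = F j z * prod_list (map (\<lambda>j. F j (\<chi> j)) js)"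
      unfolding list.map m by simp
  qed
  also have "\<dots> = (\<Sum>z\<in>R. F j z) * (\<Sum>\<chi>\<in>set js \<rightarrow>\<^sub>E R. prod_list (map (\<lambda>j. F j (\<chi> j)) js))"
    by (simp only: sum_product sum.cartesian_product)
  finally show ?case using Cons by simp
qed simp

text \<open>The sum is invariant under multiplication by \<open>w\<^sup>-\<^sup>m\<close> for a root of unity \<open>w\<close> with \<open>w\<^sup>m \<noteq> 1\<close>, which exists since the
  equation \<open>z\<^sup>m = 1\<close> has fewer than \<open>d\<close> solutions.\<close>

lemma sum_roots_inverse:
  assumes "0 < m" "m < d"
  shows "(\<Sum>z | z ^ d = 1. inverse (z :: complex) ^ m) = 0"
proof -
  let ?R = "{z :: complex. z ^ d = 1}"
  have fin: "finite {z :: complex. z ^ m = 1}" using assms by (intro finite_roots_unity) simp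
  have "\<not> ?R \<subseteq> {z. z ^ m = 1}"
  proof
    assume "?R \<subseteq> {z. z ^ m = 1}"
    then have "card ?R \<le> card {z :: complex. z ^ m = 1}" by (rule card_mono[OF fin])
    then show False using card_roots_unity_eq[of d] card_roots_unity_eq[of m] assms by simp
  qed
  then obtain w :: complex where w: "w ^ d = 1" "w ^ m \<noteq> 1" by blast
  have w0: "w \<noteq> 0" using w assms by (auto simp: power_0_left)
  have "(\<Sum>z\<in>?R. inverse z ^ m) = (\<Sum>z\<in>?R. inverse (w * z) ^ m)"
    by (rule sum.reindex_bij_witness[of _ "\<lambda>z. w * z" "\<lambda>z. z / w"])
      (use w w0 in \<open>auto simp: power_mult_distrib power_divide\<close>)
  also have "\<dots> = inverse w ^ m * (\<Sum>z\<in>?R. inverse z ^ m)"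
    by (simp add: power_mult_distrib sum_distrib_left)
  finally have "(1 - inverse w ^ m) * (\<Sum>z\<in>?R. inverse z ^ m) = 0" by (simp add: algebra_simps)
  moreover have "inverse w ^ m \<noteq> 1" using w by (simp add: power_inverse)
  ultimately show ?thesis by simp
qed

lemma cconst_sum: "cconst (sum f A) = (\<Sum>x\<in>A. cconst (f x))"
  by (induct A rule: infinite_finite_induct) (auto simp: cconst_add)

lemma fscal_sum: "fscal (sum f A) = (\<Sum>x\<in>A. fscal (f x))"
  by (induct A rule: infinite_finite_induct) (auto simp: fscal_add)

text \<open>The idempotent of the group generated by \<open>t\<^sub>j\<close> on which \<open>t\<^sub>j\<close> acts as \<open>z\<close>.\<close>

definition eps :: "nat \<Rightarrow> nat \<Rightarrow> complex \<Rightarrow> falg" where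
  "eps d j z = fscal (cconst (1 / of_nat d)) *
     (\<Sum>s<d. fscal (cconst (inverse z ^ s)) * fvar (Tt j) ^ s)"

lemma E_elt_eps: "E_elt d n \<chi> = prod_list (map (\<lambda>j. eps d j (\<chi> j)) [1..<n + 1])"
  by (simp add: E_elt_def eps_def)

lemma sum_eps_weighted:
  "(\<Sum>z | z ^ d = 1. fscal (cconst (c z)) * eps d j z) = fscal (cconst (1 / of_nat d)) *
     (\<Sum>s<d. fscal (cconst (\<Sum>z | z ^ d = 1. c z * inverse z ^ s)) * fvar (Tt j) ^ s)"
proof -
  let ?k = "fscal (cconst (1 / of_nat d))"
  have "fscal (cconst (c z)) * eps d j z =
      ?k * (\<Sum>s<d. fscal (cconst (c z * inverse z ^ s)) * fvar (Tt j) ^ s)" for z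
  proof -
    have "fscal (cconst (c z)) * eps d j z =
        ?k * (fscal (cconst (c z)) * (\<Sum>s<d. fscal (cconst (inverse z ^ s)) * fvar (Tt j) ^ s))"
      unfolding eps_def by (simp only: mult.assoc[symmetric] fscal_commute[of _ ?k])
    then show ?thesis by (simp add: sum_distrib_left cconst_mult fscal_mult mult.assoc)
  qed
  then have "(\<Sum>z | z ^ d = 1. fscal (cconst (c z)) * eps d j z) =
      ?k * (\<Sum>z | z ^ d = 1. \<Sum>s<d. fscal (cconst (c z * inverse z ^ s)) * fvar (Tt j) ^ s)"
    by (simp add: sum_distrib_left)
  also have "(\<Sum>z | z ^ d = 1. \<Sum>s<d. fscal (cconst (c z * inverse z ^ s)) * fvar (Tt j) ^ s) =
      (\<Sum>s<d. \<Sum>z | z ^ d = 1. fscal (cconst (c z * inverse z ^ s)) * fvar (Tt j) ^ s)"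
    by (rule sum.swap)
  finally show ?thesis by (simp add: cconst_sum fscal_sum sum_distrib_right)
qed

lemma sum_eps:
  assumes d: "1 \<le> d"
  shows "(\<Sum>z | z ^ d = 1. eps d j z) = 1"
proof -
  have "(\<Sum>z | z ^ d = 1. eps d j z) = fscal (cconst (1 / of_nat d)) *
     (\<Sum>s<d. fscal (cconst (\<Sum>z | z ^ d = 1. inverse z ^ s)) * fvar (Tt j) ^ s)"
    using sum_eps_weighted[where c = "\<lambda>z. 1"] by simp
  also have "(\<Sum>s<d. fscal (cconst (\<Sum>z | z ^ d = 1. inverse z ^ s)) * fvar (Tt j) ^ s) =
      (\<Sum>s<d. if s = 0 then fscal (cconst (of_nat d)) else 0)"
  proof (rule sum.cong[OF HOL.refl])
    fix s assume "s \<in> {..<d}"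
    then show "fscal (cconst (\<Sum>z | z ^ d = 1. inverse z ^ s)) * fvar (Tt j) ^ s =
        (if s = 0 then fscal (cconst (of_nat d)) else 0)"
      using d sum_roots_inverse[of s d] card_roots_unity_eq[of d] by (cases "s = 0") simp_all
  qed
  also have "\<dots> = fscal (cconst (of_nat d))" using d by (simp add: sum.delta)
  finally show ?thesis using d by (simp flip: fscal_mult cconst_mult)
qed

lemma sum_eps_root:
  assumes d: "2 \<le> d"
  shows "(\<Sum>z | z ^ d = 1. fscal (cconst z) * eps d j z) = fvar (Tt j)"
proof -
  have "(\<Sum>z | z ^ d = 1. (z :: complex) * inverse z ^ s) = (if s = 1 then of_nat d else 0)" if s: "s < d" for s
  proof (cases s)
    case 0
    have "(\<Sum>z | z ^ d = 1. (z :: complex) * inverse z ^ s) = (\<Sum>z | z ^ d = 1. inverse z ^ (d - 1))"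
    proof (rule sum.cong[OF HOL.refl])
      fix z :: complex assume "z \<in> {z. z ^ d = 1}"
      then have z: "z * z ^ (d - 1) = 1" using d by (simp flip: power_Suc)
      then have "z = inverse (z ^ (d - 1))" by (metis inverse_unique mult.commute)
      then show "z * inverse z ^ s = inverse z ^ (d - 1)" using 0 by (simp add: power_inverse)
    qed
    then show ?thesis using sum_roots_inverse[of "d - 1" d] d 0 by simp
  next
    case (Suc m)
    have "(\<Sum>z | z ^ d = 1. (z :: complex) * inverse z ^ s) = (\<Sum>z | z ^ d = 1. inverse z ^ m)"
    proof (rule sum.cong[OF HOL.refl])
      fix z :: complex assume "z \<in> {z. z ^ d = 1}"
      then have "z \<noteq> 0" using d by (auto simp: power_0_left)
      then show "z * inverse z ^ s = inverse z ^ m" using Suc by simp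
    qed
    then show ?thesis using sum_roots_inverse[of m d] card_roots_unity_eq[of d] d s Suc
      by (cases "m = 0") simp_all
  qed
  then have "(\<Sum>s<d. fscal (cconst (\<Sum>z | z ^ d = 1. z * inverse z ^ s)) * fvar (Tt j) ^ s) =
      (\<Sum>s<d. if s = 1 then fscal (cconst (of_nat d)) * fvar (Tt j) else 0)"
    by (intro sum.cong) auto
  also have "\<dots> = fscal (cconst (of_nat d)) * fvar (Tt j)" using d by (simp add: sum.delta)
  finally have "(\<Sum>z | z ^ d = 1. fscal (cconst z) * eps d j z) =
      fscal (cconst (1 / of_nat d)) * (fscal (cconst (of_nat d)) * fvar (Tt j))"
    by (simp only: sum_eps_weighted)
  then show ?thesis using d by (simp flip: mult.assoc fscal_mult cconst_mult)
qed

lemma prod_list_ones: "(\<And>x. x \<in> set xs \<Longrightarrow> f x = 1) \<Longrightarrow> prod_list (map f xs) = (1 :: 'a :: monoid_mult)"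
  by (induct xs) auto

lemma sum_E_elt:
  assumes d: "1 \<le> d"
  shows "(\<Sum>\<chi>\<in>Irr d n. E_elt d n \<chi>) = 1"
proof -
  have "{1..n} = set [1..<n + 1]" by auto
  then have "(\<Sum>\<chi>\<in>Irr d n. E_elt d n \<chi>) = prod_list (map (\<lambda>j. \<Sum>z | z ^ d = 1. eps d j z) [1..<n + 1])"
    unfolding Irr_def E_elt_eps by (simp only:) (rule sum_PiE_prod_list, simp)
  then show ?thesis by (simp add: sum_eps[OF d] prod_list_ones)
qed

lemma prod_list_scale:
  assumes "distinct ks"
  shows "prod_list (map (\<lambda>k. (if k = j then fscal c else 1) * H k) ks) =
    (if j \<in> set ks then fscal c else 1) * prod_list (map H ks)"
  using assms
proof (induct ks)
  case (Cons k ks)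
  have "H k * (fscal c * x) = fscal c * (H k * x)" for x
    by (simp only: fscal_commute[of c "H k"] flip: mult.assoc)
  then show ?case using Cons by (auto simp: mult.assoc)
qed simp

lemma sum_E_elt_root:
  assumes d: "2 \<le> d" and j: "1 \<le> j" "j \<le> n"
  shows "(\<Sum>\<chi>\<in>Irr d n. fscal (cconst (\<chi> j)) * E_elt d n \<chi>) = fvar (Tt j)"
proof -
  let ?F = "\<lambda>k z. (if k = j then fscal (cconst z) else 1) * eps d k z"
  let ?js = "[1..<n + 1]"
  have "prod_list (map (\<lambda>k. ?F k (\<chi> k)) ?js) = fscal (cconst (\<chi> j)) * E_elt d n \<chi>" for \<chi>
  proof -
    have m: "map (\<lambda>k. ?F k (\<chi> k)) ?js = map (\<lambda>k. (if k = j then fscal (cconst (\<chi> j)) else 1) * eps d k (\<chi> k)) ?js"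
      by (intro map_cong) auto
    show ?thesis
      unfolding m E_elt_eps using prod_list_scale[of ?js j "cconst (\<chi> j)" "\<lambda>k. eps d k (\<chi> k)"] j by simp
  qed
  then have "(\<Sum>\<chi>\<in>Irr d n. fscal (cconst (\<chi> j)) * E_elt d n \<chi>) =
      (\<Sum>\<chi>\<in>Irr d n. prod_list (map (\<lambda>k. ?F k (\<chi> k)) ?js))" by simp
  also have "\<dots> = prod_list (map (\<lambda>k. \<Sum>z | z ^ d = 1. ?F k z) ?js)"
  proof -
    have "{1..n} = set ?js" by auto
    then show ?thesis unfolding Irr_def by (simp only:) (rule sum_PiE_prod_list, simp)
  qed
  also have "map (\<lambda>k. \<Sum>z | z ^ d = 1. ?F k z) ?js = map (\<lambda>k. if k = j then fvar (Tt j) else 1) ?js"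
    using sum_eps_root[OF d] sum_eps[of d] d by (intro map_cong) auto
  also have "prod_list (map (\<lambda>k. if k = j then fvar (Tt j) else 1) ks) = (if j \<in> set ks then fvar (Tt j) else 1)"
    if "distinct ks" for ks using that by (induct ks) auto
  finally show ?thesis using j by simp
qed

context numbered_roots begin

context
  fixes \<Psi> :: "falg set \<Rightarrow> chr \<Rightarrow> chr \<Rightarrow> falg set"
  assumes is\<Psi>: "is_Psi \<xi> d n \<Psi>"
begin

text \<open>An arbitrary homomorphism with the prescribed values, such as the one that is chosen for \<open>\<Psi>\<close>, is known only
  on the \<open>E\<^sub>\<chi> X\<^sup>\<lambda> g\<^sub>w\<close>. The set on which it coincides with the constructed one is closed under the ring operations, so
  that one generator after the other can be shown to belong to it.\<close>

definition agree :: "falg set set" where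
  "agree = {x \<in> carrier (Y d n). \<Psi> x = Psi0 x}"

lemma hom: "\<Psi> \<in> ring_hom (Y d n) (mat_alg \<xi> d n)"
  using is\<Psi> by (simp add: is_Psi_def)

lemma agree_one: "\<one>\<^bsub>Y d n\<^esub> \<in> agree"
  using ring_hom_one[OF hom] ring_hom_one[OF Psi0_hom] by (simp add: agree_def)

lemma agree_add: "x \<in> agree \<Longrightarrow> y \<in> agree \<Longrightarrow> x \<oplus>\<^bsub>Y d n\<^esub> y \<in> agree"
  using ring_hom_add[OF hom, of x y] ring_hom_add[OF Psi0_hom, of x y] by (simp add: agree_def)

lemma agree_mult: "x \<in> agree \<Longrightarrow> y \<in> agree \<Longrightarrow> x \<otimes>\<^bsub>Y d n\<^esub> y \<in> agree"
  using ring_hom_mult[OF hom, of x y] ring_hom_mult[OF Psi0_hom, of x y] by (simp add: agree_def)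

lemma agree_scal: "scal d n c \<in> agree"
proof -
  have "\<Psi> (scal d n c \<otimes>\<^bsub>Y d n\<^esub> \<one>\<^bsub>Y d n\<^esub>) = (\<lambda>\<chi> \<chi>'. scal 1 n c \<otimes>\<^bsub>Y 1 n\<^esub> \<Psi> \<one>\<^bsub>Y d n\<^esub> \<chi> \<chi>')"
    using is\<Psi> by (simp only: is_Psi_def Yr.one_closed simp_thms)
  then show ?thesis using Psi0_scal[of "\<one>\<^bsub>Y d n\<^esub>" c] agree_one by (simp add: agree_def)
qed

lemma agree_cls_sum:
  assumes "\<And>x. x \<in> A \<Longrightarrow> f x \<in> carrier (free_alg n)" "\<And>x. x \<in> A \<Longrightarrow> cls d n (f x) \<in> agree"
  shows "cls d n (sum f A) \<in> agree"
  using assms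
proof (induct A rule: infinite_finite_induct)
  case (insert x A)
  then show ?case by (simp add: cls_add agree_add)
qed (use agree_scal[of 0] in simp_all)

lemma agree_basis:
  assumes \<chi>: "\<chi> \<in> Irr d n" and w: "w permutes {1..n}"
  shows "cls d n (E_elt d n \<chi>) \<otimes>\<^bsub>Y d n\<^esub> X_monom d n l \<otimes>\<^bsub>Y d n\<^esub> gw d n (pinv w) \<in> agree"
proof -
  have formula: "\<Psi>' (cls d n (E_elt d n \<chi>) \<otimes>\<^bsub>Y d n\<^esub> X_monom d n l \<otimes>\<^bsub>Y d n\<^esub> gw d n (pinv w)) =
      mat_unit n \<chi> (act w \<chi>)
        (scal 1 n (upow (int (len n (pinv w)) -
            int (len n (pinv (pi_chi \<xi> d n \<chi>) \<circ> pinv w \<circ> pi_chi \<xi> d n (act w \<chi>))))) \<otimes>\<^bsub>Y 1 n\<^esub>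
          lprod (Y 1 n) (map (\<lambda>j. XY 1 n (pinv (pi_chi \<xi> d n \<chi>) j) [^]\<^bsub>Y 1 n\<^esub> l j) [1..<n + 1]) \<otimes>\<^bsub>Y 1 n\<^esub>
          gw 1 n (pinv (pi_chi \<xi> d n \<chi>) \<circ> pinv w \<circ> pi_chi \<xi> d n (act w \<chi>)))"
    if "is_Psi \<xi> d n \<Psi>'" for \<Psi>'
    using that \<chi> w unfolding is_Psi_def Let_def by blast
  note eq = formula[OF is\<Psi>, folded formula[OF is_Psi_Psi0]]
  have "gw d n (pinv w) \<in> carrier (Y d n)" by (rule gw_closed[OF permutes_inv[OF w]])
  then show ?thesis using eq X_monom_closed by (simp add: agree_def)
qed

lemma X_monom_0: "X_monom d n (\<lambda>j. 0) = \<one>\<^bsub>Y d n\<^esub>"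
  by (simp add: X_monom_def lprod_one del: upt_Suc)

lemma X_monom_1: "X_monom d n (\<lambda>j. if j = 1 then 1 else 0) = XY d n 1"
proof -
  have "[1..<n + 1] = 1 # [2..<n + 1]" using n by (simp add: upt_conv_Cons numeral_2_eq_2)
  moreover have "lprod (Y d n) (map (\<lambda>j. XY d n j [^]\<^bsub>Y d n\<^esub> (if j = 1 then 1 else 0 :: int)) [2..<n + 1]) = \<one>\<^bsub>Y d n\<^esub>"
  proof -
    have "map (\<lambda>j. XY d n j [^]\<^bsub>Y d n\<^esub> (if j = 1 then 1 else 0 :: int)) [2..<n + 1] = map (\<lambda>j. \<one>\<^bsub>Y d n\<^esub>) [2..<n + 1]"
      by (intro map_cong) auto
    then show ?thesis by (simp only: lprod_one)
  qed
  moreover have "XY d n 1 [^]\<^bsub>Y d n\<^esub> (1 :: int) = XY d n 1"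
    using n by (simp add: int_pow_def2)
  ultimately show ?thesis using n by (simp add: X_monom_def del: upt_Suc)
qed

lemma agree_sum_E:
  assumes f: "f \<in> carrier (free_alg n)"
    and a: "\<And>\<chi>. \<chi> \<in> Irr d n \<Longrightarrow> cls d n (E_elt d n \<chi>) \<otimes>\<^bsub>Y d n\<^esub> cls d n f \<in> agree"
  shows "cls d n f \<in> agree"
proof -
  have "f = (\<Sum>\<chi>\<in>Irr d n. E_elt d n \<chi> * f)"
    using sum_E_elt[OF d, of n] by (simp flip: sum_distrib_right)
  moreover have "cls d n (\<Sum>\<chi>\<in>Irr d n. E_elt d n \<chi> * f) \<in> agree"
    using f a by (intro agree_cls_sum) (simp_all add: cls_mult)
  ultimately show ?thesis by simp
qed

lemma agree_E: "\<chi> \<in> Irr d n \<Longrightarrow> cls d n (E_elt d n \<chi>) \<in> agree"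
  using agree_basis[of \<chi> id "\<lambda>j. 0"] by (simp add: X_monom_0 permutes_id gw_id)

lemma agree_gY:
  assumes i: "1 \<le> i" "i < n"
  shows "gY d n i \<in> agree"
  unfolding gY_def
proof (rule agree_sum_E)
  fix \<chi> assume "\<chi> \<in> Irr d n"
  moreover have "pinv (st i) = st i" by (rule inv_unique_comp) (auto simp: fun_eq_iff)
  ultimately show "cls d n (E_elt d n \<chi>) \<otimes>\<^bsub>Y d n\<^esub> cls d n (fvar (Gg i)) \<in> agree"
    using agree_basis[of \<chi> "st i" "\<lambda>j. 0"] st_permutes[OF i] i by (simp add: X_monom_0 gw_st gY_def)
qed (use i in simp)

lemma agree_XY: "XY d n 1 \<in> agree"
  unfolding XY_1
proof (rule agree_sum_E)
  fix \<chi> assume "\<chi> \<in> Irr d n"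
  then show "cls d n (E_elt d n \<chi>) \<otimes>\<^bsub>Y d n\<^esub> cls d n (fvar Xp) \<in> agree"
    using agree_basis[of \<chi> id "\<lambda>j. if j = 1 then 1 else 0"] n
    by (simp add: X_monom_1 permutes_id gw_id flip: XY_1)
qed simp

text \<open>For \<open>d = 1\<close> the sum formula for \<open>t\<^sub>j\<close> fails in the free algebra, but then \<open>t\<^sub>j = 1\<close> in the quotient.\<close>

lemma agree_tY:
  assumes j: "1 \<le> j" "j \<le> n"
  shows "cls d n (fvar (Tt j)) \<in> agree"
proof (cases "d = 1")
  case True
  then have "cls d n (fvar (Tt j)) = \<one>\<^bsub>Y d n\<^esub>" using cls_t_pow[OF j, of 1] by simp
  then show ?thesis using agree_one by simp
next
  case False
  then have "fvar (Tt j) = (\<Sum>\<chi>\<in>Irr d n. fscal (cconst (\<chi> j)) * E_elt d n \<chi>)"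
    using sum_E_elt_root[OF _ j, of d] d by simp
  moreover have "cls d n (\<Sum>\<chi>\<in>Irr d n. fscal (cconst (\<chi> j)) * E_elt d n \<chi>) \<in> agree"
    by (rule agree_cls_sum) (use agree_E agree_scal in \<open>auto simp: cls_mult scal_def intro!: agree_mult\<close>)
  ultimately show ?thesis by simp
qed

lemma agree_cls_power: "f \<in> carrier (free_alg n) \<Longrightarrow> cls d n f \<in> agree \<Longrightarrow> cls d n (f ^ k) \<in> agree"
  by (induct k) (simp_all add: cls_mult agree_one agree_mult)

lemma agree_eY:
  assumes i: "1 \<le> i" "i < n"
  shows "cls d n (e_elt d i) \<in> agree"
proof -
  have "cls d n (\<Sum>s = 1..d. fvar (Tt i) ^ s * fvar (Tt (Suc i)) ^ (d - s)) \<in> agree"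
    using i by (intro agree_cls_sum) (simp_all add: cls_mult agree_mult agree_cls_power agree_tY)
  then show ?thesis
    using agree_scal i by (simp add: e_elt_def cls_mult agree_mult scal_def flip: Suc_eq_plus1)
qed

lemma agree_delta_gen:
  assumes "i < n"
  shows "delta_gen d n i \<in> agree"
proof (cases "i = 0")
  case True
  then show ?thesis using agree_XY by (simp add: delta_gen_def XY_1)
next
  case False
  then have i: "1 \<le> i" "i < n" using assms by auto
  then show ?thesis
    using agree_gY[OF i] agree_eY[OF i] agree_scal
    by (simp add: delta_gen_def cls_mult cls_add gY_def scal_def agree_mult agree_add)
qed


end

end

section \<open>The matrices of braids\<close>

definition dcol :: "nat \<Rightarrow> chr \<Rightarrow> chr" where
  "dcol i \<chi> = (if i = 0 then \<chi> else \<chi> \<circ> st i)"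

lemma dcol_dcol: "dcol i (dcol i \<chi>) = \<chi>"
  by (simp add: dcol_def fun_eq_iff)

text \<open>The sign of a letter has no influence on the column because exchanges are involutions.\<close>

fun bcol :: "bword \<Rightarrow> chr \<Rightarrow> chr" where
  "bcol [] \<chi> = \<chi>"
| "bcol ((i, b) # w) \<chi> = bcol w (dcol i \<chi>)"

context numbered_roots begin

definition dval :: "nat \<Rightarrow> chr \<Rightarrow> falg set" where
  "dval i \<chi> = (if i = 0 then XY 1 n (pos \<chi> 1)
     else if \<chi> i = \<chi> (Suc i) then gY 1 n (pos \<chi> i) else scal 1 n (gampow 1 * upow 1))"

text \<open>An inverse letter is represented by the inverse of a matrix with one entry in each row. Its entry in the row of
  \<open>\<chi>\<close> is the inverse of the entry in the column of \<open>\<chi>\<close>, which lies in the row of \<open>dcol i \<chi>\<close>.\<close>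

fun bval :: "bword \<Rightarrow> chr \<Rightarrow> falg set" where
  "bval [] \<chi> = \<one>\<^bsub>Y 1 n\<^esub>"
| "bval ((i, b) # w) \<chi> =
     (if b then dval i \<chi> else inv\<^bsub>Y 1 n\<^esub> (dval i (dcol i \<chi>))) \<otimes>\<^bsub>Y 1 n\<^esub> bval w (dcol i \<chi>)"

lemma Irr_dcol: "\<chi> \<in> Irr d n \<Longrightarrow> i < n \<Longrightarrow> dcol i \<chi> \<in> Irr d n"
  by (simp add: dcol_def Irr_st del: comp_apply)

lemma dval_Unit: "i < n \<Longrightarrow> dval i \<chi> \<in> Units (Y 1 n)"
proof -
  assume i: "i < n"
  have "gampow 1 * upow 1 * (gampow (- 1) * upow (- 1)) = (gampow 1 * gampow (- 1)) * (upow 1 * upow (- 1))"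
    by (simp only: ac_simps)
  then have "gampow 1 * upow 1 * (gampow (- 1) * upow (- 1)) = 1"
    using gampow_inverse[of 1] upow_inverse(1)[of 1] by simp
  then have "scal 1 n (gampow 1 * upow 1) \<in> Units (Y 1 n)" by (rule scal_Unit)
  moreover have "gY 1 n (pos \<chi> i) \<in> Units (Y 1 n)" if "\<chi> i = \<chi> (Suc i)" "i \<noteq> 0"
    using pos_Suc(2)[OF that(1) _ i] pos_range[of i \<chi>] that(2) i by (intro gY_Unit) auto
  ultimately show ?thesis using XY_pos_Unit[of 1 \<chi>] n by (auto simp: dval_def)
qed

text \<open>In the row of \<open>\<chi>\<close> the factor \<open>\<gamma> + (1 - \<gamma>) e\<^sub>i\<close> is \<open>1\<close> or \<open>\<gamma>\<close>, according to whether the colours of \<open>i\<close> and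
  \<open>i + 1\<close> are equal or not. This is why the number of colours does not enter.\<close>

lemma row_delta_gen:
  assumes i: "i < n"
  shows "row (Psi0 (delta_gen d n i)) (dcol i) (dval i)"
proof (cases "i = 0")
  case True
  have "row (Psi0 (cls d n (fvar Xp))) (\<lambda>\<chi>. \<chi>) (\<lambda>\<chi>. XY 1 n (pos \<chi> 1))"
    using row_XY[of 1] n unfolding XY_1 by simp
  then show ?thesis using True by (simp add: delta_gen_def dcol_def[abs_def] dval_def[abs_def])
next
  case False
  then have i1: "1 \<le> i" "i < n" using i by auto
  let ?c = "\<lambda>\<chi> :: chr. fscal (gampow 1) + fscal (1 - gampow 1) * fscal (cconst (if \<chi> i = \<chi> (Suc i) then 1 else 0))"
  have sc: "monomial (fscal c) (\<lambda>\<chi>. \<chi>) (\<lambda>\<chi>. fscal c)" for c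
    using Phi_word[of "[]" c] by (simp add: monomial_def fscal_def)
  have e: "monomial (e_elt d i) (\<lambda>\<chi>. \<chi>) (\<lambda>\<chi>. fscal (cconst (if \<chi> i = \<chi> (Suc i) then 1 else 0)))"
    using tdiag_e[OF i1] unfolding tdiag_def by simp
  have se: "monomial (fscal (1 - gampow 1) * e_elt d i) (\<lambda>\<chi>. \<chi>)
      (\<lambda>\<chi>. fscal (1 - gampow 1) * fscal (cconst (if \<chi> i = \<chi> (Suc i) then 1 else 0)))"
    by (rule monomial_mult[OF _ sc e]) auto
  have "monomial (fscal (gampow 1) + fscal (1 - gampow 1) * e_elt d i) (\<lambda>\<chi>. \<chi>) ?c"
    using sc[of "gampow 1"] se by (simp add: monomial_def Phi_add)
  from monomial_mult[OF _ this monomial_fvar[of "Gg i"]]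
  have "monomial ((fscal (gampow 1) + fscal (1 - gampow 1) * e_elt d i) * fvar (Gg i))
      (\<lambda>\<chi>. \<chi> \<circ> st i) (\<lambda>\<chi>. ?c \<chi> * lval (Gg i) \<chi>)"
    using i1 by simp
  then have "row (Psi0 (delta_gen d n i)) (\<lambda>\<chi>. \<chi> \<circ> st i) (\<lambda>\<chi>. cls 1 n (?c \<chi> * lval (Gg i) \<chi>))"
    using Psi0_monomial i1 False by (simp add: delta_gen_def)
  then show ?thesis
  proof (rule row_cong)
    fix \<chi>
    show "\<chi> \<circ> st i = dcol i \<chi>" using False by (simp add: dcol_def)
    show "cls 1 n (?c \<chi> * lval (Gg i) \<chi>) = dval i \<chi>"
    proof (cases "\<chi> i = \<chi> (Suc i)")
      case True
      have "?c \<chi> = 1" using True by (simp flip: fscal_add)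
      then show ?thesis using True False by (simp add: dval_def lval_def gY_def)
    next
      case neq: False
      then show ?thesis using False by (simp add: dval_def lval_def scal_def fscal_mult)
    qed
  qed
qed

lemma row_delta:
  assumes \<Psi>: "is_Psi \<xi> d n \<Psi>"
  shows "w \<in> bwords 0 n \<Longrightarrow> row (\<Psi> (delta d n w)) (bcol w) (bval w)"
proof (induct w)
  case Nil
  then show ?case using row_one[OF hom[OF \<Psi>]] by (simp add: delta_def row_def)
next
  case (Cons a w)
  obtain i b where a: "a = (i, b)" by (cases a)
  have i: "i < n" and w: "w \<in> bwords 0 n" using Cons.prems a by (auto simp: bwords_def)
  let ?x = "if b then delta_gen d n i else inv\<^bsub>Y d n\<^esub> (delta_gen d n i)"
  note U = delta_gen_Unit[OF d i]
  have x: "?x \<in> carrier (Y d n)" using U by auto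
  have "set w \<subseteq> {0..<n} \<times> UNIV" using w by (auto simp: bwords_def)
  then have dw: "delta d n w \<in> carrier (Y d n)"
    unfolding delta_def using delta_gen_Unit[OF d]
    by (intro monoid.lprod_closed[OF monoid_Y]) (auto simp: Yr.Units_closed)
  have r: "row (\<Psi> (delta_gen d n i)) (dcol i) (dval i)"
    using row_delta_gen[OF i] agree_delta_gen[OF \<Psi> i] by (simp add: agree_def[OF \<Psi>])
  have "row (\<Psi> ?x) (dcol i) (\<lambda>\<chi>. if b then dval i \<chi> else inv\<^bsub>Y 1 n\<^esub> (dval i (dcol i \<chi>)))"
  proof (cases b)
    case False
    have "row (\<Psi> (inv\<^bsub>Y d n\<^esub> (delta_gen d n i))) (dcol i) (\<lambda>\<chi>. inv\<^bsub>Y 1 n\<^esub> (dval i (dcol i \<chi>)))"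
      by (rule row_inv[OF hom[OF \<Psi>] U r]) (simp_all add: dval_Unit i Irr_dcol dcol_dcol)
    then show ?thesis using False by simp
  qed (use r in simp)
  from row_mult[OF hom[OF \<Psi>] x dw this Cons.hyps[OF w]] Irr_dcol i
  have "row (\<Psi> (?x \<otimes>\<^bsub>Y d n\<^esub> delta d n w)) (\<lambda>\<chi>. bcol w (dcol i \<chi>))
      (\<lambda>\<chi>. (if b then dval i \<chi> else inv\<^bsub>Y 1 n\<^esub> (dval i (dcol i \<chi>))) \<otimes>\<^bsub>Y 1 n\<^esub> bval w (dcol i \<chi>))"
    by blast
  moreover have "delta d n (a # w) = ?x \<otimes>\<^bsub>Y d n\<^esub> delta d n w" by (simp add: delta_def a)
  ultimately show ?case by (simp add: row_def a)
qed

lemma is_Psi_Psi: "is_Psi \<xi> d n (Psi \<xi> d n)"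
  unfolding Psi_def by (rule someI[of "is_Psi \<xi> d n", OF is_Psi_Psi0])

lemma Psi_delta_diagonal:
  assumes "w \<in> bwords 0 n" "\<chi> \<in> Irr d n"
  shows "Psi \<xi> d n (delta d n w) \<chi> \<chi> = (if bcol w \<chi> = \<chi> then bval w \<chi> else \<zero>\<^bsub>Y 1 n\<^esub>)"
  using row_delta[OF is_Psi_Psi assms(1)] assms(2) by (simp add: row_def)

lemma delta_closed: "w \<in> bwords 0 n \<Longrightarrow> delta d n w \<in> carrier (Y d n)"
proof -
  assume "w \<in> bwords 0 n"
  then have "set w \<subseteq> {0..<n} \<times> UNIV" by (auto simp: bwords_def)
  then show ?thesis
    unfolding delta_def using delta_gen_Unit[OF d]
    by (intro monoid.lprod_closed[OF monoid_Y]) (auto simp: Yr.Units_closed)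
qed

end

section \<open>Recolouring\<close>

text \<open>Only the order of the colours matters, and two colours are equal when neither is smaller.\<close>

lemma std_order_cong:
  assumes "\<And>j k. j \<in> {1..n} \<Longrightarrow> k \<in> {1..n} \<Longrightarrow> c j < c k \<longleftrightarrow> c' j < c' k"
  shows "std n c = std n c'"
proof (rule std_unique[OF std_permutes])
  fix j k assume jk: "j \<in> {1..n}" "k \<in> {1..n}" "c' j < c' k \<or> c' j = c' k \<and> j < k"
  then have "c j < c k \<or> c j = c k \<and> j < k"
    using assms[OF jk(1,2)] assms[OF jk(2,1)] by linarith
  then show "std n c j < std n c k" by (rule std_mono[OF jk(1,2)])
qed

text \<open>The colours \<open>1, \<dots>, d'\<close> are renamed by the increasing map \<open>i\<close> to the elements of \<open>S\<close>.\<close>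

locale recolouring =
  fixes \<xi> \<xi>' :: "nat \<Rightarrow> complex" and d d' n :: nat and S :: "nat set" and i :: "nat \<Rightarrow> nat"
  assumes n: "1 \<le> n" and d: "1 \<le> d" and S: "S \<subseteq> {1..d}" "S \<noteq> {}" "d' = card S"
    and i: "strict_mono_on {1..d'} i" "i ` {1..d'} = S"
    and \<xi>: "roots_enum d \<xi>" and \<xi>': "roots_enum d' \<xi>'"
begin

lemma d': "1 \<le> d'"
proof -
  have "finite S" using S(1) by (rule finite_subset) simp
  then show ?thesis using S(2,3) by (simp add: Suc_le_eq card_gt_0_iff One_nat_def)
qed

sublocale A: numbered_roots \<xi> d n by unfold_locales (rule d n \<xi>)+
sublocale B: numbered_roots \<xi>' d' n by unfold_locales (rule d' n \<xi>')+

lemma i_less_iff: "j \<in> {1..d'} \<Longrightarrow> k \<in> {1..d'} \<Longrightarrow> i j < i k \<longleftrightarrow> j < k"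
  using strict_mono_onD[OF i(1)] by (metis linorder_less_linear less_asym)

lemma i_inj: "inj_on i {1..d'}"
  by (rule strict_mono_on_imp_inj_on[OF i(1)])

lemma i_range:
  assumes "j \<in> {1..d'}"
  shows "i j \<in> S" "i j \<in> {1..d}"
  using imageI[OF assms, of i] S(1) unfolding i(2) by blast+

abbreviation "inv_i \<equiv> inv_into {1..d'} i"

lemma inv_i: "j \<in> {1..d'} \<Longrightarrow> inv_i (i j) = j" "a \<in> S \<Longrightarrow> inv_i a \<in> {1..d'}" "a \<in> S \<Longrightarrow> i (inv_i a) = a"
  using i_inj i(2) by (auto simp: inv_into_f_f inv_into_into f_inv_into_f)

definition lift :: "chr \<Rightarrow> chr" where
  "lift \<chi> = restrict (\<lambda>k. \<xi> (i (rank \<xi>' d' (\<chi> k)))) {1..n}"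

lemma rank_lift:
  assumes "\<chi> \<in> Irr d' n" "k \<in> {1..n}"
  shows "rank \<xi> d (lift \<chi> k) = i (rank \<xi>' d' (\<chi> k))"
  using rank_\<xi>[OF \<xi> i_range(2)[OF rank(1)[OF \<xi>' assms]]] assms(2) by (simp add: lift_def)

lemma lift_Irr: "\<chi> \<in> Irr d' n \<Longrightarrow> lift \<chi> \<in> Irr d n"
proof -
  assume \<chi>: "\<chi> \<in> Irr d' n"
  have "\<xi> (i (rank \<xi>' d' (\<chi> k))) ^ d = 1" if "k \<in> {1..n}" for k
    using i_range(2)[OF rank(1)[OF \<xi>' \<chi> that]] \<xi> by (auto simp: roots_enum_def bij_betw_def)
  then show ?thesis by (simp add: Irr_def lift_def)
qed

lemma lift_eq_iff:
  assumes \<chi>: "\<chi> \<in> Irr d' n" and k: "j \<in> {1..n}" "k \<in> {1..n}"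
  shows "lift \<chi> j = lift \<chi> k \<longleftrightarrow> \<chi> j = \<chi> k"
proof
  assume "lift \<chi> j = lift \<chi> k"
  then have "i (rank \<xi>' d' (\<chi> j)) = i (rank \<xi>' d' (\<chi> k))"
    using rank_lift[OF \<chi> k(1)] rank_lift[OF \<chi> k(2)] by simp
  then have "rank \<xi>' d' (\<chi> j) = rank \<xi>' d' (\<chi> k)"
    by (simp only: inj_on_eq_iff[OF i_inj rank(1)[OF \<xi>' \<chi> k(1)] rank(1)[OF \<xi>' \<chi> k(2)]])
  then show "\<chi> j = \<chi> k" using rank(2)[OF \<xi>' \<chi> k(1)] rank(2)[OF \<xi>' \<chi> k(2)] by metis
qed (use k in \<open>simp add: lift_def\<close>)

lemma lift_inj: "inj_on lift (Irr d' n)"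
proof (rule inj_onI)
  fix \<chi> \<kappa> assume \<chi>: "\<chi> \<in> Irr d' n" and \<kappa>: "\<kappa> \<in> Irr d' n" and eq: "lift \<chi> = lift \<kappa>"
  have "\<chi> k = \<kappa> k" if k: "k \<in> {1..n}" for k
  proof -
    have "i (rank \<xi>' d' (\<chi> k)) = i (rank \<xi>' d' (\<kappa> k))"
      using rank_lift[OF \<chi> k] rank_lift[OF \<kappa> k] eq by simp
    then have "rank \<xi>' d' (\<chi> k) = rank \<xi>' d' (\<kappa> k)"
      by (simp only: inj_on_eq_iff[OF i_inj rank(1)[OF \<xi>' \<chi> k] rank(1)[OF \<xi>' \<kappa> k]])
    then show ?thesis using rank(2)[OF \<xi>' \<chi> k] rank(2)[OF \<xi>' \<kappa> k] by metis
  qed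
  then show "\<chi> = \<kappa>" using \<chi> \<kappa> unfolding Irr_def by (intro PiE_ext)
qed

lemma pos_lift: "\<chi> \<in> Irr d' n \<Longrightarrow> A.pos (lift \<chi>) = B.pos \<chi>"
  unfolding A.pos_def B.pos_def
  by (rule std_order_cong) (simp only: comp_apply rank_lift i_less_iff rank(1)[OF \<xi>'])

lemma lift_dcol: "j < n \<Longrightarrow> lift (dcol j \<chi>) = dcol j (lift \<chi>)"
  using st_in_range[of j n] by (auto simp: dcol_def lift_def restrict_def fun_eq_iff)

lemma dval_lift: "\<chi> \<in> Irr d' n \<Longrightarrow> j < n \<Longrightarrow> A.dval j (lift \<chi>) = B.dval j \<chi>"
  using lift_eq_iff[of \<chi> j "Suc j"] by (simp add: A.dval_def B.dval_def pos_lift)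

lemma lift_bcol: "w \<in> bwords 0 n \<Longrightarrow> lift (bcol w \<chi>) = bcol w (lift \<chi>)"
proof (induct w arbitrary: \<chi>)
  case (Cons a w)
  then show ?case by (cases a) (auto simp: bwords_def lift_dcol)
qed simp

lemma bval_lift: "w \<in> bwords 0 n \<Longrightarrow> \<chi> \<in> Irr d' n \<Longrightarrow> A.bval w (lift \<chi>) = B.bval w \<chi>"
proof (induct w arbitrary: \<chi>)
  case (Cons a w)
  obtain j b where a: "a = (j, b)" by (cases a)
  have j: "j < n" and w: "w \<in> bwords 0 n" using Cons.prems a by (auto simp: bwords_def)
  show ?case
    using Cons.hyps[OF w B.Irr_dcol[OF Cons.prems(2) j]] dval_lift[OF Cons.prems(2) j]
      dval_lift[OF B.Irr_dcol[OF Cons.prems(2) j] j]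
    by (simp add: a lift_dcol[OF j, symmetric])
qed simp

lemma Irr_bcol: "w \<in> bwords 0 n \<Longrightarrow> \<chi> \<in> Irr d' n \<Longrightarrow> bcol w \<chi> \<in> Irr d' n"
proof (induct w arbitrary: \<chi>)
  case (Cons a w)
  then show ?case by (cases a) (auto simp: bwords_def B.Irr_dcol)
qed simp

lemma Psi_delta_lift:
  assumes w: "w \<in> bwords 0 n" and \<chi>: "\<chi> \<in> Irr d' n"
  shows "Psi \<xi> d n (delta d n w) (lift \<chi>) (lift \<chi>) = Psi \<xi>' d' n (delta d' n w) \<chi> \<chi>"
proof -
  have "bcol w (lift \<chi>) = lift \<chi> \<longleftrightarrow> bcol w \<chi> = \<chi>"
    using lift_inj Irr_bcol[OF w \<chi>] \<chi> lift_bcol[OF w, of \<chi>] by (metis inj_onD)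
  then show ?thesis
    by (simp add: A.Psi_delta_diagonal[OF w lift_Irr[OF \<chi>]] B.Psi_delta_diagonal[OF w \<chi>] bval_lift[OF w \<chi>])
qed

subsection \<open>Compositions with support \<open>S\<close>\<close>

definition up :: "(nat \<Rightarrow> nat) \<Rightarrow> nat \<Rightarrow> nat" where
  "up \<mu> a = (if a \<in> S then \<mu> (inv_i a) else 0)"

lemma up_i [simp]: "j \<in> {1..d'} \<Longrightarrow> up \<mu> (i j) = \<mu> j"
  using i_range(1)[of j] inv_i(1)[of j] by (simp add: up_def)

lemma sum_up: "(\<Sum>b = 1..a. up \<mu> b) = (\<Sum>k \<in> {k \<in> {1..d'}. i k \<le> a}. \<mu> k)"
proof -
  let ?K = "{k \<in> {1..d'}. i k \<le> a}"
  have "(\<Sum>b = 1..a. up \<mu> b) = (\<Sum>b \<in> i ` ?K. up \<mu> b)"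
  proof (rule sum.mono_neutral_right)
    show "i ` ?K \<subseteq> {1..a}" using i_range(2) by fastforce
    show "\<forall>b\<in>{1..a} - i ` ?K. up \<mu> b = 0"
    proof
      fix b assume b: "b \<in> {1..a} - i ` ?K"
      have "b \<notin> S"
      proof
        assume "b \<in> S"
        then obtain k where "k \<in> {1..d'}" "b = i k" using i(2) by auto
        then show False using b by auto
      qed
      then show "up \<mu> b = 0" by (simp add: up_def)
    qed
  qed simp
  also have "\<dots> = (\<Sum>k\<in>?K. up \<mu> (i k))"
  proof -
    have "inj_on i ?K" by (rule inj_on_subset[OF i_inj]) auto
    then show ?thesis by (simp only: sum.reindex comp_def)
  qed
  also have "\<dots> = (\<Sum>k\<in>?K. \<mu> k)" by (rule sum.cong) auto
  finally show ?thesis .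
qed

lemma sum_up_before:
  assumes j: "j \<in> {1..d'}"
  shows "(\<Sum>b = 1..<i j. up \<mu> b) = (\<Sum>b = 1..<j. \<mu> b)"
proof -
  have "1 \<le> i j" using i_range(2)[OF j] by simp
  then have "{1..<i j} = {1..i j - 1}" by auto
  moreover have "{k \<in> {1..d'}. i k \<le> i j - 1} = {1..<j}"
  proof -
    have "i k \<le> i j - 1 \<longleftrightarrow> k < j" if "k \<in> {1..d'}" for k
      using i_less_iff[OF that j] \<open>1 \<le> i j\<close> by linarith
    then show ?thesis using j by auto
  qed
  ultimately show ?thesis using sum_up[of \<mu> "i j - 1"] by simp
qed

lemma sum_up_all: "(\<Sum>a = 1..d. up \<mu> a) = (\<Sum>k = 1..d'. \<mu> k)"
proof -
  have "{k \<in> {1..d'}. i k \<le> d} = {1..d'}" using i_range(2) by auto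
  then show ?thesis using sum_up[of \<mu> d] by simp
qed

lemma block_exists:
  assumes \<mu>: "\<mu> \<in> compositions d' n" and j: "j \<in> {1..n}"
  shows "block \<mu> j \<in> {1..d'}" "j \<le> (\<Sum>b = 1..block \<mu> j. \<mu> b)"
    "a < block \<mu> j \<Longrightarrow> \<not> j \<le> (\<Sum>b = 1..a. \<mu> b)"
proof -
  have ex: "j \<le> (\<Sum>b = 1..d'. \<mu> b)" using \<mu> j by (simp add: compositions_def)
  show le: "j \<le> (\<Sum>b = 1..block \<mu> j. \<mu> b)"
    unfolding block_def by (rule LeastI[where P = "\<lambda>a. j \<le> (\<Sum>b = 1..a. \<mu> b)"]) (rule ex)
  show "a < block \<mu> j \<Longrightarrow> \<not> j \<le> (\<Sum>b = 1..a. \<mu> b)"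
    unfolding block_def by (rule not_less_Least)
  have "block \<mu> j \<le> d'" unfolding block_def by (rule Least_le) (rule ex)
  moreover have "block \<mu> j \<noteq> 0" using le j by (intro notI) simp
  ultimately show "block \<mu> j \<in> {1..d'}" by simp
qed

text \<open>The partial sums of the two compositions are the same numbers, so a position lies in blocks of corresponding
  colours.\<close>

lemma block_up:
  assumes \<mu>: "\<mu> \<in> compositions d' n" and j: "j \<in> {1..n}"
  shows "block (up \<mu>) j = i (block \<mu> j)"
  unfolding block_def[of "up \<mu>"]
proof (rule Least_equality)
  note b = block_exists[OF \<mu> j]
  have "{k \<in> {1..d'}. i k \<le> i (block \<mu> j)} = {1..block \<mu> j}"
  proof -
    have "i k \<le> i (block \<mu> j) \<longleftrightarrow> k \<le> block \<mu> j" if "k \<in> {1..d'}" for k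
      using i_less_iff[OF b(1) that] by linarith
    then show ?thesis using b(1) by auto
  qed
  then show "j \<le> (\<Sum>b = 1..i (block \<mu> j). up \<mu> b)" using b(2) by (simp add: sum_up)
  fix a assume a: "j \<le> (\<Sum>b = 1..a. up \<mu> b)"
  show "i (block \<mu> j) \<le> a"
  proof (rule ccontr)
    assume "\<not> i (block \<mu> j) \<le> a"
    then have "{k \<in> {1..d'}. i k \<le> a} \<subseteq> {1..block \<mu> j - 1}"
      using i_less_iff[OF _ b(1)] by fastforce
    then have "(\<Sum>k \<in> {k \<in> {1..d'}. i k \<le> a}. \<mu> k) \<le> (\<Sum>k = 1..block \<mu> j - 1. \<mu> k)"
      by (intro sum_mono2) auto
    then have "j \<le> (\<Sum>k = 1..block \<mu> j - 1. \<mu> k)" using a by (simp add: sum_up)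
    then show False using b(3)[of "block \<mu> j - 1"] b(1) by simp
  qed
qed

lemma young_up:
  assumes \<mu>: "\<mu> \<in> compositions d' n"
  shows "young_subgroup n (up \<mu>) = young_subgroup n \<mu>"
proof -
  have "block (up \<mu>) (w j) = block (up \<mu>) j \<longleftrightarrow> block \<mu> (w j) = block \<mu> j"
    if w: "w permutes {1..n}" and j: "j \<in> {1..n}" for w j
  proof -
    have wj: "w j \<in> {1..n}" using permutes_in_image[OF w] j by blast
    show ?thesis
      unfolding block_up[OF \<mu> j] block_up[OF \<mu> wj]
      by (rule inj_on_eq_iff[OF i_inj block_exists(1)[OF \<mu> wj] block_exists(1)[OF \<mu> j]])
  qed
  then show ?thesis unfolding young_subgroup_def by blast
qed

lemma Hmu_up: "\<mu> \<in> compositions d' n \<Longrightarrow> Hmu n (up \<mu>) = Hmu n \<mu>"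
  by (simp add: Hmu_def young_up)


end

section \<open>The trace forms agree\<close>

context recolouring begin

lemma sorted_S: "sorted_list_of_set S = map i [1..<d' + 1]"
proof -
  have s: "{1..d'} = set [1..<d' + 1]" by auto
  have "sorted_wrt (<) (map i [1..<d' + 1])"
    unfolding sorted_wrt_map
    by (rule sorted_wrt_mono_rel[OF _ sorted_wrt_upt]) (simp add: i_less_iff)
  moreover have "set (map i [1..<d' + 1]) = S" using i(2) by (simp only: set_map flip: s)
  moreover have "finite S" unfolding i(2)[symmetric] by simp
  ultimately show ?thesis
    by (intro strict_sorted_equal) simp_all
qed

lemma sorted_interval: "sorted_list_of_set {1..d'} = [1..<d' + 1]"
  by (metis atLeastLessThanSuc_atLeastAtMost Suc_eq_plus1 sorted_list_of_set_range)

text \<open>The two conditions on \<open>T\<close> speak about the same subalgebra, the same offsets of the blocks and the same traces on them.\<close>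

lemma is_tensor_trace_up:
  assumes \<mu>: "\<mu> \<in> compositions d' n"
  shows "is_tensor_trace n S (\<lambda>a. \<tau> (inv_i a)) (up \<mu>) T \<longleftrightarrow> is_tensor_trace n {1..d'} \<tau> \<mu> T"
proof -
  let ?P = "\<lambda>f. (\<forall>a\<in>S. f a \<in> carrier (free_alg (up \<mu> a))) \<longrightarrow>
        T (lprod (Y 1 n) (map (\<lambda>a. block_emb n (\<Sum>b = 1..<a. up \<mu> b) (f a)) (sorted_list_of_set S)))
          = (\<Prod>a\<in>S. \<tau> (inv_i a) (up \<mu> a) (cls 1 (up \<mu> a) (f a)))"
  let ?Q = "\<lambda>f. (\<forall>j\<in>{1..d'}. f j \<in> carrier (free_alg (\<mu> j))) \<longrightarrow>
        T (lprod (Y 1 n) (map (\<lambda>j. block_emb n (\<Sum>b = 1..<j. \<mu> b) (f j)) (sorted_list_of_set {1..d'})))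
          = (\<Prod>j\<in>{1..d'}. \<tau> j (\<mu> j) (cls 1 (\<mu> j) (f j)))"
  have ball: "(\<forall>a\<in>S. P a) \<longleftrightarrow> (\<forall>j\<in>{1..d'}. P (i j))" for P
    unfolding i(2)[symmetric] by blast
  have prod: "prod F S = (\<Prod>j\<in>{1..d'}. F (i j))" for F :: "nat \<Rightarrow> coeff"
    unfolding i(2)[symmetric] by (simp only: prod.reindex[OF i_inj] comp_def)
  have PQ: "?P f \<longleftrightarrow> ?Q h" if fh: "\<And>j. j \<in> {1..d'} \<Longrightarrow> f (i j) = h j" for f h
  proof -
    have "(\<forall>a\<in>S. f a \<in> carrier (free_alg (up \<mu> a))) \<longleftrightarrow> (\<forall>j\<in>{1..d'}. h j \<in> carrier (free_alg (\<mu> j)))"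
      unfolding ball by (rule ball_cong[OF HOL.refl]) (simp only: up_i fh)
    moreover have "map (\<lambda>a. block_emb n (\<Sum>b = 1..<a. up \<mu> b) (f a)) (sorted_list_of_set S) =
        map (\<lambda>j. block_emb n (\<Sum>b = 1..<j. \<mu> b) (h j)) (sorted_list_of_set {1..d'})"
      unfolding sorted_S sorted_interval map_map comp_def
      by (rule map_cong[OF HOL.refl]) (simp add: sum_up_before fh)
    moreover have "(\<Prod>a\<in>S. \<tau> (inv_i a) (up \<mu> a) (cls 1 (up \<mu> a) (f a))) =
        (\<Prod>j\<in>{1..d'}. \<tau> j (\<mu> j) (cls 1 (\<mu> j) (h j)))"
    proof -
      have "(\<Prod>a\<in>S. \<tau> (inv_i a) (up \<mu> a) (cls 1 (up \<mu> a) (f a))) =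
          (\<Prod>j\<in>{1..d'}. \<tau> (inv_i (i j)) (up \<mu> (i j)) (cls 1 (up \<mu> (i j)) (f (i j))))"
        by (rule prod)
      also have "\<dots> = (\<Prod>j\<in>{1..d'}. \<tau> j (\<mu> j) (cls 1 (\<mu> j) (h j)))"
        by (rule prod.cong[OF HOL.refl]) (simp only: inv_i(1) up_i fh)
      finally show ?thesis .
    qed
    ultimately show ?thesis by (simp only:)
  qed
  have "(\<forall>f. ?P f) \<longleftrightarrow> (\<forall>h. ?Q h)"
  proof
    assume P: "\<forall>f. ?P f"
    show "\<forall>h. ?Q h"
    proof
      fix h
      have "?P (\<lambda>a. h (inv_i a)) \<longleftrightarrow> ?Q h" by (rule PQ) (simp only: inv_i(1))
      then show "?Q h" using spec[OF P, of "\<lambda>a. h (inv_i a)"] by blast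
    qed
  next
    assume Q: "\<forall>h. ?Q h"
    show "\<forall>f. ?P f"
    proof
      fix f
      have "?P f \<longleftrightarrow> ?Q (\<lambda>j. f (i j))" by (rule PQ) (rule HOL.refl)
      then show "?P f" using spec[OF Q, of "\<lambda>j. f (i j)"] by blast
    qed
  qed
  then show ?thesis unfolding is_tensor_trace_def Hmu_up[OF \<mu>] by (simp only:)
qed

lemma tensor_trace_up:
  "\<mu> \<in> compositions d' n \<Longrightarrow>
    tensor_trace n S (\<lambda>a. \<tau> (inv_i a)) (up \<mu>) = tensor_trace n {1..d'} \<tau> \<mu>"
  by (simp only: tensor_trace_def is_tensor_trace_up)

lemma Comp_lift:
  assumes \<chi>: "\<chi> \<in> Irr d' n"
  shows "Comp \<xi> d n (lift \<chi>) = up (Comp \<xi>' d' n \<chi>)"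
proof
  fix a
  have C: "Comp \<xi> d n (lift \<chi>) a = card {k \<in> {1..n}. i (rank \<xi>' d' (\<chi> k)) = a}"
  proof -
    have "{k \<in> {1..n}. (rank \<xi> d \<circ> lift \<chi>) k = a} = {k \<in> {1..n}. i (rank \<xi>' d' (\<chi> k)) = a}"
      by (rule Collect_cong, rule conj_cong[OF HOL.refl]) (simp only: comp_apply rank_lift[OF \<chi>])
    then show ?thesis by (simp only: Comp_rank[OF \<xi> lift_Irr[OF \<chi>]])
  qed
  show "Comp \<xi> d n (lift \<chi>) a = up (Comp \<xi>' d' n \<chi>) a"
  proof (cases "a \<in> S")
    case True
    have "i (rank \<xi>' d' (\<chi> k)) = a \<longleftrightarrow> rank \<xi>' d' (\<chi> k) = inv_i a" if "k \<in> {1..n}" for k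
      using inv_i(1)[OF rank(1)[OF \<xi>' \<chi> that]] inv_i(3)[OF True] by metis
    then have "{k \<in> {1..n}. i (rank \<xi>' d' (\<chi> k)) = a} = {k \<in> {1..n}. (rank \<xi>' d' \<circ> \<chi>) k = inv_i a}"
      by (intro Collect_cong conj_cong[OF HOL.refl]) (simp only: comp_apply)
    then show ?thesis using True C by (simp only: up_def if_True Comp_rank[OF \<xi>' \<chi>])
  next
    case False
    then have "{k \<in> {1..n}. i (rank \<xi>' d' (\<chi> k)) = a} = {}"
      using i_range(1)[OF rank(1)[OF \<xi>' \<chi>]] by blast
    then show ?thesis using False C by (simp only: up_def if_False card.empty)
  qed
qed

lemma up_inj:
  assumes "\<mu> \<in> compositions d' n" "\<nu> \<in> compositions d' n" "up \<mu> = up \<nu>"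
  shows "\<mu> = \<nu>"
proof
  fix j
  show "\<mu> j = \<nu> j"
  proof (cases "j \<in> {1..d'}")
    case True
    then show ?thesis using up_i[of j \<mu>] up_i[of j \<nu>] assms(3) by simp
  next
    case False
    then show ?thesis using assms(1,2) by (simp add: compositions_def)
  qed
qed

lemma Comp_compositions:
  assumes \<chi>: "\<chi> \<in> Irr d' n"
  shows "Comp \<xi>' d' n \<chi> \<in> compositions d' n"
proof -
  have "(\<Sum>a = 1..d'. Comp \<xi>' d' n \<chi> a) = card (\<Union>a\<in>{1..d'}. {k \<in> {1..n}. (rank \<xi>' d' \<circ> \<chi>) k = a})"
    unfolding Comp_rank[OF \<xi>' \<chi>] by (subst card_UN_disjoint') (auto simp: disjoint_family_on_def)
  also have "(\<Union>a\<in>{1..d'}. {k \<in> {1..n}. (rank \<xi>' d' \<circ> \<chi>) k = a}) = {1..n}"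
    using rank(1)[OF \<xi>' \<chi>] by auto
  finally show ?thesis by (auto simp: compositions_def Comp_def)
qed

lemma lift_image:
  assumes \<mu>: "\<mu> \<in> compositions d' n"
  shows "lift ` {\<chi> \<in> Irr d' n. Comp \<xi>' d' n \<chi> = \<mu>} = {\<chi> \<in> Irr d n. Comp \<xi> d n \<chi> = up \<mu>}"
proof
  show "lift ` {\<chi> \<in> Irr d' n. Comp \<xi>' d' n \<chi> = \<mu>} \<subseteq> {\<chi> \<in> Irr d n. Comp \<xi> d n \<chi> = up \<mu>}"
    using lift_Irr Comp_lift by auto
  show "{\<chi> \<in> Irr d n. Comp \<xi> d n \<chi> = up \<mu>} \<subseteq> lift ` {\<chi> \<in> Irr d' n. Comp \<xi>' d' n \<chi> = \<mu>}"
  proof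
    fix \<chi> assume "\<chi> \<in> {\<chi> \<in> Irr d n. Comp \<xi> d n \<chi> = up \<mu>}"
    then have \<chi>: "\<chi> \<in> Irr d n" and C: "Comp \<xi> d n \<chi> = up \<mu>" by auto
    have inS: "rank \<xi> d (\<chi> k) \<in> S" if k: "k \<in> {1..n}" for k
    proof (rule ccontr)
      assume "rank \<xi> d (\<chi> k) \<notin> S"
      then have "card {m \<in> {1..n}. (rank \<xi> d \<circ> \<chi>) m = rank \<xi> d (\<chi> k)} = 0"
        using fun_cong[OF C, of "rank \<xi> d (\<chi> k)"] by (simp only: up_def if_False Comp_rank[OF \<xi> \<chi>])
      then have "{m \<in> {1..n}. (rank \<xi> d \<circ> \<chi>) m = rank \<xi> d (\<chi> k)} = {}" by (subst (asm) card_0_eq) auto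
      then show False using k by auto
    qed
    define \<kappa> where "\<kappa> = restrict (\<lambda>k. \<xi>' (inv_i (rank \<xi> d (\<chi> k)))) {1..n}"
    have \<kappa>: "\<kappa> \<in> Irr d' n"
    proof -
      have "\<xi>' (inv_i (rank \<xi> d (\<chi> k))) ^ d' = 1" if "k \<in> {1..n}" for k
      proof -
        have "\<xi>' (inv_i (rank \<xi> d (\<chi> k))) \<in> \<xi>' ` {1..d'}" by (rule imageI[OF inv_i(2)[OF inS[OF that]]])
        then show ?thesis using \<xi>' unfolding roots_enum_def bij_betw_def by blast
      qed
      then show ?thesis by (simp add: Irr_def \<kappa>_def)
    qed
    have "lift \<kappa> k = \<chi> k" if k: "k \<in> {1..n}" for k
    proof -
      have "rank \<xi>' d' (\<kappa> k) = inv_i (rank \<xi> d (\<chi> k))"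
        using rank_\<xi>[OF \<xi>' inv_i(2)[OF inS[OF k]]] k by (simp add: \<kappa>_def)
      then have "lift \<kappa> k = \<xi> (rank \<xi> d (\<chi> k))" using k inv_i(3)[OF inS[OF k]] by (simp add: lift_def)
      then show ?thesis using rank(2)[OF \<xi> \<chi> k] by simp
    qed
    then have l: "lift \<kappa> = \<chi>" using lift_Irr[OF \<kappa>] \<chi> unfolding Irr_def by (intro PiE_ext)
    have "up (Comp \<xi>' d' n \<kappa>) = up \<mu>" using Comp_lift[OF \<kappa>] C l by simp
    then have "Comp \<xi>' d' n \<kappa> = \<mu>" by (rule up_inj[OF Comp_compositions[OF \<kappa>] \<mu>])
    then show "\<chi> \<in> lift ` {\<chi> \<in> Irr d' n. Comp \<xi>' d' n \<chi> = \<mu>}" using \<kappa> l by blast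
  qed
qed

text \<open>The diagonal entries are matched by the bijection \<open>lift\<close>.\<close>

lemma matrix_trace_up:
  assumes \<mu>: "\<mu> \<in> compositions d' n" and w: "w \<in> bwords 0 n"
  shows "(\<Oplus>\<^bsub>Y 1 n\<^esub>\<chi>\<in>{\<chi> \<in> Irr d n. Comp \<xi> d n \<chi> = up \<mu>}. Psi \<xi> d n (delta d n w) \<chi> \<chi>) =
    (\<Oplus>\<^bsub>Y 1 n\<^esub>\<chi>\<in>{\<chi> \<in> Irr d' n. Comp \<xi>' d' n \<chi> = \<mu>}. Psi \<xi>' d' n (delta d' n w) \<chi> \<chi>)"
proof -
  let ?A = "{\<chi> \<in> Irr d' n. Comp \<xi>' d' n \<chi> = \<mu>}"
  have cl: "Psi \<xi> d n (delta d n w) \<chi> \<chi>' \<in> carrier (Y 1 n)" for \<chi> \<chi>'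
    by (rule mat_entry_closed[OF ring_hom_closed[OF A.hom[OF A.is_Psi_Psi] A.delta_closed[OF w]]])
  have cl': "Psi \<xi>' d' n (delta d' n w) \<chi> \<chi>' \<in> carrier (Y 1 n)" for \<chi> \<chi>'
    by (rule mat_entry_closed[OF ring_hom_closed[OF B.hom[OF B.is_Psi_Psi] B.delta_closed[OF w]]])
  have "(\<Oplus>\<^bsub>Y 1 n\<^esub>\<chi>\<in>lift ` ?A. Psi \<xi> d n (delta d n w) \<chi> \<chi>) =
      (\<Oplus>\<^bsub>Y 1 n\<^esub>\<chi>\<in>?A. Psi \<xi> d n (delta d n w) (lift \<chi>) (lift \<chi>))"
    by (rule Yr.finsum_reindex) (use cl in \<open>auto intro: inj_on_subset[OF lift_inj]\<close>)
  also have "\<dots> = (\<Oplus>\<^bsub>Y 1 n\<^esub>\<chi>\<in>?A. Psi \<xi>' d' n (delta d' n w) \<chi> \<chi>)"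
    by (rule Yr.finsum_cong') (use cl' Psi_delta_lift[OF w] in auto)
  finally show ?thesis unfolding lift_image[OF \<mu>] .
qed

theorem rho_delta_recolour:
  assumes w: "w \<in> bwords 0 n"
  shows "rho \<xi> d S (\<lambda>a. \<tau> (inv_i a)) n (delta d n w) = rho \<xi>' d' {1..d'} \<tau> n (delta d' n w)"
proof -
  let ?M' = "{\<mu> \<in> compositions d' n. \<forall>a \<in> {1..d'}. \<mu> a \<noteq> 0 \<longleftrightarrow> a \<in> {1..d'}}"
  let ?M = "{\<mu> \<in> compositions d n. \<forall>a \<in> {1..d}. \<mu> a \<noteq> 0 \<longleftrightarrow> a \<in> S}"
  have M: "up ` ?M' = ?M"
  proof
    show "up ` ?M' \<subseteq> ?M"
    proof (rule image_subsetI)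
      fix \<mu> assume "\<mu> \<in> ?M'"
      then have c: "\<mu> \<in> compositions d' n" and nz: "\<And>a. a \<in> {1..d'} \<Longrightarrow> \<mu> a \<noteq> 0" by auto
      have "up \<mu> \<in> compositions d n"
        using c S(1) sum_up_all[of \<mu>] unfolding compositions_def up_def[abs_def] by auto
      moreover have "up \<mu> a \<noteq> 0 \<longleftrightarrow> a \<in> S" for a
        using nz[OF inv_i(2), of a] by (cases "a \<in> S") (simp_all only: up_def if_True if_False simp_thms)
      ultimately show "up \<mu> \<in> ?M" by simp
    qed
    show "?M \<subseteq> up ` ?M'"
    proof
      fix \<nu> assume "\<nu> \<in> ?M"
      then have c: "\<nu> \<in> compositions d n" and nz: "\<And>a. a \<in> {1..d} \<Longrightarrow> \<nu> a \<noteq> 0 \<longleftrightarrow> a \<in> S" by auto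
      define \<mu> where "\<mu> j = (if j \<in> {1..d'} then \<nu> (i j) else 0)" for j
      have out: "\<nu> a = 0" if "a \<notin> S" for a
        using that nz[of a] c by (cases "a \<in> {1..d}") (auto simp: compositions_def)
      have up: "up \<mu> = \<nu>"
      proof
        fix a
        show "up \<mu> a = \<nu> a"
        proof (cases "a \<in> S")
          case True
          then show ?thesis using inv_i(2,3)[OF True] by (simp only: up_def \<mu>_def if_True)
        next
          case False
          show ?thesis unfolding out[OF False] using False by (simp only: up_def if_False)
        qed
      qed
      have "\<mu> \<in> compositions d' n"
        using c sum_up_all[of \<mu>] unfolding up by (auto simp: compositions_def \<mu>_def)
      moreover have "\<mu> a \<noteq> 0" if "a \<in> {1..d'}" for a
        using nz[OF i_range(2)[OF that]] i_range(1)[OF that] that by (simp only: \<mu>_def if_True simp_thms)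
      ultimately have "\<mu> \<in> ?M'" by auto
      then show "\<nu> \<in> up ` ?M'" using up by blast
    qed
  qed
  have "inj_on up ?M'" by (rule inj_onI) (rule up_inj, auto)
  then have "rho \<xi> d S (\<lambda>a. \<tau> (inv_i a)) n (delta d n w) =
      (\<Sum>\<mu>\<in>?M'. tensor_trace n S (\<lambda>a. \<tau> (inv_i a)) (up \<mu>)
        (\<Oplus>\<^bsub>Y 1 n\<^esub>\<chi>\<in>{\<chi> \<in> Irr d n. Comp \<xi> d n \<chi> = up \<mu>}. Psi \<xi> d n (delta d n w) \<chi> \<chi>))"
    unfolding rho_def M[symmetric] by (simp only: sum.reindex comp_def)
  also have "\<dots> = rho \<xi>' d' {1..d'} \<tau> n (delta d' n w)"
    unfolding rho_def
    by (rule sum.cong[OF HOL.refl]) (simp only: tensor_trace_up matrix_trace_up[OF _ w] mem_Collect_eq)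
  finally show ?thesis .
qed

end

section \<open>Links\<close>

lemma braid_eq_bwords: "braid_eq k n w w' \<Longrightarrow> w \<in> bwords k n \<and> w' \<in> bwords k n"
  by (induct rule: braid_eq.induct) (auto simp: bwords_def)

lemma bwords_append: "x @ y \<in> bwords k n \<longleftrightarrow> x \<in> bwords k n \<and> y \<in> bwords k n"
  by (auto simp: bwords_def)

lemma binv_bwords: "w \<in> bwords k n \<Longrightarrow> binv w \<in> bwords k n"
  by (induct w) (auto simp: bwords_def binv_def)

text \<open>The bound on \<open>k\<close> makes the letter \<open>(n, b)\<close> of a stabilization an admissible one on \<open>n + 1\<close> strands.\<close>

lemma same_closure_braids:
  assumes "same_closure k \<beta> \<beta>'" "k \<le> 1"
  shows "\<beta> \<in> braids k \<and> \<beta>' \<in> braids k"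
  using assms
proof (induct rule: same_closure.induct)
  case (braid n w w')
  then show ?case using braid_eq_bwords[of k n w w'] by (simp add: braids_def)
next
  case (conj n w x)
  then show ?case by (simp add: braids_def bwords_append binv_bwords)
next
  case (stab n w b)
  then show ?case by (auto simp: braids_def bwords_def)
qed auto

lemma link_braids:
  assumes "L \<in> solid_torus_links \<union> classical_links" "(n, w) \<in> L"
  shows "1 \<le> n" "w \<in> bwords 0 n"
proof -
  obtain k where "L \<in> links k" and k: "k \<le> 1" using assms(1) by (auto simp: solid_torus_links_def classical_links_def)
  then obtain \<beta> where "L = {(\<beta>, \<beta>'). same_closure k \<beta> \<beta>'} `` {\<beta>}" by (auto simp: links_def quotient_def)
  then have "same_closure k \<beta> (n, w)" using assms(2) by auto
  then have "(n, w) \<in> braids k" using same_closure_braids[OF _ k] by blast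
  then show "1 \<le> n" "w \<in> bwords 0 n" by (auto simp: braids_def bwords_def)
qed

theorem proposition6p1:
  fixes d d' :: nat and S :: "nat set" and i :: "nat \<Rightarrow> nat"
    and \<xi> \<xi>' :: "nat \<Rightarrow> complex"
    and \<tau> :: "nat \<Rightarrow> nat \<Rightarrow> falg set \<Rightarrow> coeff"
    and L :: "(nat \<times> bword) set"
  assumes "1 \<le> d"
    and "S \<subseteq> {1..d}" and "S \<noteq> {}" and "d' = card S"
    and "strict_mono_on {1..d'} i" and "i ` {1..d'} = S"
    and "roots_enum d \<xi>" and "roots_enum d' \<xi>'"
    and "\<And>j. j \<in> {1..d'} \<Longrightarrow> markov_trace 1 (\<tau> j)"
    and "L \<in> solid_torus_links \<union> classical_links"
  shows "link_inv \<xi> d S (\<lambda>a. \<tau> (inv_into {1..d'} i a)) L = link_inv \<xi>' d' {1..d'} \<tau> L"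
proof -
  have "rho \<xi> d S (\<lambda>a. \<tau> (inv_into {1..d'} i a)) n (delta d n w) =
      rho \<xi>' d' {1..d'} \<tau> n (delta d' n w)" if "(n, w) \<in> L" for n w
  proof -
    note nw = link_braids[OF assms(10) that]
    interpret recolouring \<xi> \<xi>' d d' n S i
      by unfold_locales (rule nw(1) assms)+
    show ?thesis by (rule rho_delta_recolour[OF nw(2)])
  qed
  \<comment> \<open>The invariant is a definite description, and both sides describe \<open>p\<close> by equivalent conditions.\<close>
  then have "(\<forall>(n, w) \<in> L. rho \<xi> d S (\<lambda>a. \<tau> (inv_into {1..d'} i a)) n (delta d n w) = p) \<longleftrightarrow>
      (\<forall>(n, w) \<in> L. rho \<xi>' d' {1..d'} \<tau> n (delta d' n w) = p)" for p
    by (intro ball_cong HOL.refl) auto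
  then show ?thesis unfolding link_inv_def by (simp only:)
qed

end
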